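(* Let $m\in\mathbb Z^+$, let $\boldsymbol\varrho=\underrightarrow{\lim}\,\boldsymbol\varrho(n)\in\boldsymbol\zeta^{(m)}$, where $\boldsymbol\varrho(n)\in\boldsymbol\zeta(n)^{(m)}$ and $\mathbf{i}_{n+1,n}(\boldsymbol\varrho(n))=\boldsymbol\varrho(n+1)$ for $n\ge m$, and let $\mu$ be a partition with conjugate $\widetilde\mu$. Then the eigenvalue $$\chi(\boldsymbol\varrho)(\widetilde\mu)=\chi_n(\boldsymbol\varrho(n))(\widetilde\mu),\qquad n\ \text{sufficiently large},$$ is well defined; i.e. the value $\chi_n(\boldsymbol\varrho(n))(\widetilde\mu)$ does not depend on $n$ for $n$ sufficiently large.
   Context: $\boldsymbol\zeta(n)$ is the center of $\mathbf{U}(gl(n))$, $gl(n)=gl(n,\mathbb C)$ with standard basis $e_{i,j}$; $\boldsymbol\zeta(n)^{(m)}$ is the $m$-th element of the filtration induced by the standard filtration of $\mathbf{U}(gl(n))$. With $\mathbf{cdet}(A)=\sum_\sigma(-1)^{|\sigma|}a_{\sigma(1),1}\cdots a_{\sigma(k),k}$, put $\mathbf{H}_k(n)=\sum_{1\le i_1<\cdots<i_k\le n}\mathbf{cdet}[e_{i_a,i_b}+\delta_{ab}(k-a)]_{a,b=1,\dots,k}$; $\mathbf{H}_1(n),\dots,\mathbf{H}_n(n)$ are algebraically independent generators of $\boldsymbol\zeta(n)$ (Capelli). $\mathbf{i}_{n+1,n}:\boldsymbol\zeta(n)\to\boldsymbol\zeta(n+1)$ is the algebra monomorphism with $\mathbf{H}_k(n)\mapsto\mathbf{H}_k(n+1)$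 ($1\le k\le n$); it preserves filtrations. $\boldsymbol\zeta=\underrightarrow{\lim}\,\boldsymbol\zeta(n)$ is the direct limit in the category of filtered algebras with respect to these maps, with $\boldsymbol\zeta^{(m)}=\underrightarrow{\lim}\,\boldsymbol\zeta(n)^{(m)}$. $\Lambda^*(n)$ is the algebra of shifted symmetric polynomials: complex polynomials $f(x_1,\dots,x_n)$ with $f(\dots,x_i,x_{i+1},\dots)=f(\dots,x_{i+1}-1,x_i+1,\dots)$ for $i=1,\dots,n-1$. The Harish-Chandra isomorphism $\chi_n:\boldsymbol\zeta(n)\to\Lambda^*(n)$ sends $A$ to the shifted symmetric polynomial such that $\chi_n(A)(\nu_1,\dots,\nu_n)$ is the eigenvalue of $A$ on the highest weight module $V_\nu$ of highest weight $\nu=(\nu_1,\dots,\nu_n)$. For $n\ge\mu_1$ (the length of $\widetilde\mu$), $\chi_n(A)(\widetilde\mu)$ means evaluation at $\widetilde\mu$ padded by zeros to length $n$. $\chi$ denotes the isomorphism obtained from the $\chi_n$ by passing to the direct limit. *)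

theory Defs
  imports
    Complex_Main
    "HOL-Library.Poly_Mapping"
    "HOL-Combinatorics.Permutations"
    "HOL-Algebra.QuotRing"
    "HOL-Algebra.Module"
begin

section \<open>The enveloping algebra of \<open>gl(n)\<close>\<close>

text \<open>
  A wrapper for lists that makes them the free monoid, written additively. By the convolution
  product of \<^theory>\<open>HOL-Library.Poly_Mapping\<close>, finitely supported functions on words are then
  the free associative algebra.
\<close>

datatype 'a word = Word (letters: "'a list")

instantiation word :: (type) monoid_add
begin

definition zero_word :: "'a word" where
  "0 = Word []"

definition plus_word :: "'a word \<Rightarrow> 'a word \<Rightarrow> 'a word" where
  "u + v = Word (letters u @ letters v)"

instance
  by standard (simp_all add: zero_word_def plus_word_def)

end

type_synonym free_alg = "(nat \<times> nat) word \<Rightarrow>\<^sub>0 complex"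

definition letter :: "nat \<Rightarrow> nat \<Rightarrow> free_alg" where
  "letter i j = Poly_Mapping.single (Word [(i, j)]) 1"

definition of_complex :: "complex \<Rightarrow> free_alg" where
  "of_complex c = Poly_Mapping.single 0 c"

text \<open>The free algebra on the symbols \<^term>\<open>letter i j\<close> with \<open>1 \<le> i, j \<le> n\<close>,
  that is, the tensor algebra of \<open>gl(n)\<close>.\<close>

definition tensor_gl :: "nat \<Rightarrow> free_alg ring" where
  "tensor_gl n =
     \<lparr>carrier = {p. \<forall>w \<in> Poly_Mapping.keys p. set (letters w) \<subseteq> {1..n} \<times> {1..n}},
      mult = (*), one = 1, zero = 0, add = (+)\<rparr>"

definition gl_relations :: "nat \<Rightarrow> free_alg set" where
  "gl_relations n =
     {letter i j * letter k l - letter k l * letter i j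
        - ((if j = k then letter i l else 0) - (if l = i then letter k j else 0))
      | i j k l. {i, j, k, l} \<subseteq> {1..n}}"

definition gl_ideal :: "nat \<Rightarrow> free_alg set" where
  "gl_ideal n = Idl\<^bsub>tensor_gl n\<^esub> (gl_relations n)"

type_synonym env_alg = "free_alg set"

definition U_gl :: "nat \<Rightarrow> env_alg ring" where
  "U_gl n = tensor_gl n Quot gl_ideal n"

definition U_class :: "nat \<Rightarrow> free_alg \<Rightarrow> env_alg" where
  "U_class n p = gl_ideal n +>\<^bsub>tensor_gl n\<^esub> p"

definition gl_unit :: "nat \<Rightarrow> nat \<Rightarrow> nat \<Rightarrow> env_alg" where
  "gl_unit n i j = U_class n (letter i j)"

definition scalar :: "nat \<Rightarrow> complex \<Rightarrow> env_alg" where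
  "scalar n c = U_class n (of_complex c)"

definition U_filtration :: "nat \<Rightarrow> nat \<Rightarrow> env_alg set" where
  "U_filtration n m =
     U_class n ` {p \<in> carrier (tensor_gl n). \<forall>w \<in> Poly_Mapping.keys p. length (letters w) \<le> m}"


section \<open>The center and the Capelli elements\<close>

definition U_center :: "nat \<Rightarrow> env_alg set" where
  "U_center n = {z \<in> carrier (U_gl n). \<forall>x \<in> carrier (U_gl n). z \<otimes>\<^bsub>U_gl n\<^esub> x = x \<otimes>\<^bsub>U_gl n\<^esub> z}"

definition center_alg :: "nat \<Rightarrow> env_alg ring" where
  "center_alg n = (U_gl n)\<lparr>carrier := U_center n\<rparr>"

definition center_filtration :: "nat \<Rightarrow> nat \<Rightarrow> env_alg set" where
  "center_filtration n m = U_center n \<inter> U_filtration n m"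

text \<open>The factors are multiplied in the order of their columns.\<close>

definition cdet :: "nat \<Rightarrow> (nat \<Rightarrow> nat \<Rightarrow> 'a::ring_1) \<Rightarrow> 'a" where
  "cdet k A = (\<Sum>p | p permutes {1..k}. of_int (sign p) * (\<Prod>j\<leftarrow>[1..<Suc k]. A (p j) j))"

text \<open>The indices \<open>i\<^sub>1 < \<dots> < i\<^sub>k\<close> enumerate a \<open>k\<close>-element set \<open>I\<close>. The formula is written in the
  free algebra and then projected to \<^term>\<open>U_gl n\<close>; the projection is a ring homomorphism.\<close>

definition capelli_H :: "nat \<Rightarrow> nat \<Rightarrow> env_alg" where
  "capelli_H n k = U_class n
     (\<Sum>I | I \<subseteq> {1..n} \<and> card I = k.
        let i = (\<lambda>a. sorted_list_of_set I ! (a - 1))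
        in cdet k (\<lambda>a b. letter (i a) (i b) + (if a = b then of_nat (k - a) else 0)))"

text \<open>By Capelli's theorem the \<^term>\<open>capelli_H n k\<close> are algebraically independent generators of
  the center, so on the center exactly one map has this property.\<close>

definition is_capelli_embedding :: "nat \<Rightarrow> (env_alg \<Rightarrow> env_alg) \<Rightarrow> bool" where
  "is_capelli_embedding n f \<longleftrightarrow>
     f \<in> ring_hom (center_alg n) (center_alg (Suc n)) \<and>
     (\<forall>c. f (scalar n c) = scalar (Suc n) c) \<and>
     inj_on f (U_center n) \<and>
     (\<forall>k \<in> {1..n}. f (capelli_H n k) = capelli_H (Suc n) k)"


section \<open>The direct limit of the centers\<close>

text \<open>A family \<open>\<iota>\<close> of maps, \<open>\<iota> n\<close> from the center at level \<open>n\<close> to the center at level \<open>n + 1\<close>, is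
  fixed throughout. Elements of the direct limit are the equivalence classes of pairs \<open>(n, A)\<close>
  with \<open>n \<ge> 1\<close> and \<open>A\<close> in the center at level \<open>n\<close>, two pairs being identified when their
  images at some later level agree.\<close>

definition transport :: "(nat \<Rightarrow> env_alg \<Rightarrow> env_alg) \<Rightarrow> nat \<Rightarrow> nat \<Rightarrow> env_alg \<Rightarrow> env_alg" where
  "transport \<iota> n N A = fold \<iota> [n..<N] A"

definition limit_class :: "(nat \<Rightarrow> env_alg \<Rightarrow> env_alg) \<Rightarrow> nat \<Rightarrow> env_alg \<Rightarrow> (nat \<times> env_alg) set" where
  "limit_class \<iota> n A =
     {(k, B). 1 \<le> k \<and> B \<in> U_center k \<and>
        (\<exists>N \<ge> max n k. transport \<iota> n N A = transport \<iota> k N B)}"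

definition limit_filtration :: "(nat \<Rightarrow> env_alg \<Rightarrow> env_alg) \<Rightarrow> nat \<Rightarrow> (nat \<times> env_alg) set set" where
  "limit_filtration \<iota> m = {limit_class \<iota> n A | n A. 1 \<le> n \<and> A \<in> center_filtration n m}"


section \<open>Highest weight modules\<close>

text \<open>The library's modules are over commutative rings, hence this variant. The scalars
  \<^term>\<open>scalar n c\<close> make a left module over \<^term>\<open>U_gl n\<close> a complex vector space.\<close>

locale left_module = R?: ring R + M?: abelian_group M
  for R (structure) and M :: "('a, 'b, 'c) module_scheme" (structure) +
  assumes smult_closed:
      "\<lbrakk>a \<in> carrier R; x \<in> carrier M\<rbrakk> \<Longrightarrow> a \<odot>\<^bsub>M\<^esub> x \<in> carrier M"
    and smult_l_distr:
      "\<lbrakk>a \<in> carrier R; b \<in> carrier R; x \<in> carrier M\<rbrakk> \<Longrightarrow>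
       (a \<oplus>\<^bsub>R\<^esub> b) \<odot>\<^bsub>M\<^esub> x = a \<odot>\<^bsub>M\<^esub> x \<oplus>\<^bsub>M\<^esub> b \<odot>\<^bsub>M\<^esub> x"
    and smult_r_distr:
      "\<lbrakk>a \<in> carrier R; x \<in> carrier M; y \<in> carrier M\<rbrakk> \<Longrightarrow>
       a \<odot>\<^bsub>M\<^esub> (x \<oplus>\<^bsub>M\<^esub> y) = a \<odot>\<^bsub>M\<^esub> x \<oplus>\<^bsub>M\<^esub> a \<odot>\<^bsub>M\<^esub> y"
    and smult_assoc:
      "\<lbrakk>a \<in> carrier R; b \<in> carrier R; x \<in> carrier M\<rbrakk> \<Longrightarrow>
       (a \<otimes>\<^bsub>R\<^esub> b) \<odot>\<^bsub>M\<^esub> x = a \<odot>\<^bsub>M\<^esub> (b \<odot>\<^bsub>M\<^esub> x)"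
    and smult_one:
      "x \<in> carrier M \<Longrightarrow> \<one>\<^bsub>R\<^esub> \<odot>\<^bsub>M\<^esub> x = x"

definition irreducible_module ::
    "('a, 'r) ring_scheme \<Rightarrow> ('a, 'b, 'c) module_scheme \<Rightarrow> bool" where
  "irreducible_module R M \<longleftrightarrow>
     left_module R M \<and> carrier M \<noteq> {\<zero>\<^bsub>M\<^esub>} \<and>
     (\<forall>W. additive_subgroup W M \<and> (\<forall>a \<in> carrier R. \<forall>w \<in> W. a \<odot>\<^bsub>M\<^esub> w \<in> W)
        \<longrightarrow> W = {\<zero>\<^bsub>M\<^esub>} \<or> W = carrier M)"

text \<open>Weights are functions on \<^typ>\<open>nat\<close> of which only the values at \<open>1, \<dots>, n\<close> matter.\<close>

definition is_highest_weight_vector ::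
    "nat \<Rightarrow> (nat \<Rightarrow> complex) \<Rightarrow> (env_alg, 'b, 'c) module_scheme \<Rightarrow> 'b \<Rightarrow> bool" where
  "is_highest_weight_vector n \<nu> M v \<longleftrightarrow>
     v \<in> carrier M \<and> v \<noteq> \<zero>\<^bsub>M\<^esub> \<and>
     (\<forall>i j. 1 \<le> i \<and> i < j \<and> j \<le> n \<longrightarrow> gl_unit n i j \<odot>\<^bsub>M\<^esub> v = \<zero>\<^bsub>M\<^esub>) \<and>
     (\<forall>i \<in> {1..n}. gl_unit n i i \<odot>\<^bsub>M\<^esub> v = scalar n (\<nu> i) \<odot>\<^bsub>M\<^esub> v)"

definition is_highest_weight_module ::
    "nat \<Rightarrow> (nat \<Rightarrow> complex) \<Rightarrow> (env_alg, 'b, 'c) module_scheme \<Rightarrow> bool" where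
  "is_highest_weight_module n \<nu> M \<longleftrightarrow>
     irreducible_module (U_gl n) M \<and> (\<exists>v. is_highest_weight_vector n \<nu> M v)"


section \<open>Shifted symmetric polynomials and the Harish-Chandra isomorphism\<close>

text \<open>Over the complex numbers a polynomial in \<open>x\<^sub>1, \<dots>, x\<^sub>n\<close> is the same as the polynomial function
  it defines. The points are functions \<open>x\<close> on \<^typ>\<open>nat\<close> whose values outside \<open>1, \<dots>, n\<close>
  are ignored.\<close>

inductive_set polynomials :: "nat \<Rightarrow> ((nat \<Rightarrow> complex) \<Rightarrow> complex) set" for n :: nat where
  const: "(\<lambda>x. c) \<in> polynomials n"
| coord: "i \<in> {1..n} \<Longrightarrow> (\<lambda>x. x i) \<in> polynomials n"
| add: "f \<in> polynomials n \<Longrightarrow> g \<in> polynomials n \<Longrightarrow> (\<lambda>x. f x + g x) \<in> polynomials n"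
| mult: "f \<in> polynomials n \<Longrightarrow> g \<in> polynomials n \<Longrightarrow> (\<lambda>x. f x * g x) \<in> polynomials n"

definition shifted_symmetric :: "nat \<Rightarrow> ((nat \<Rightarrow> complex) \<Rightarrow> complex) set" where
  "shifted_symmetric n =
     {f \<in> polynomials n. \<forall>i \<in> {1..<n}. \<forall>x.
        f x = f (x(i := x (i + 1) - 1, i + 1 := x i + 1))}"

text \<open>An irreducible module is a quotient of \<^term>\<open>U_gl n\<close> by a left ideal, so the type of the
  left cosets is large enough to realise every highest weight module up to isomorphism. The weights
  of highest weight modules fill a Zariski dense set, so their eigenvalues determine \<open>f\<close>.\<close>

definition harish_chandra :: "nat \<Rightarrow> env_alg \<Rightarrow> (nat \<Rightarrow> complex) \<Rightarrow> complex" where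
  "harish_chandra n A =
     (THE f. f \<in> shifted_symmetric n \<and>
        (\<forall>\<nu> (V :: (env_alg, env_alg set) module).
           is_highest_weight_module n \<nu> V \<longrightarrow>
             (\<forall>v \<in> carrier V. A \<odot>\<^bsub>V\<^esub> v = scalar n (f \<nu>) \<odot>\<^bsub>V\<^esub> v)))"

definition harish_chandra_limit :: "(nat \<times> env_alg) set \<Rightarrow> (nat \<Rightarrow> complex) \<Rightarrow> complex" where
  "harish_chandra_limit \<rho> x =
     (THE c. \<forall>\<^sub>F n in sequentially. \<exists>A. (n, A) \<in> \<rho> \<and> harish_chandra n A x = c)"


section \<open>Partitions\<close>

definition is_partition :: "nat list \<Rightarrow> bool" where
  "is_partition \<mu> \<longleftrightarrow> sorted_wrt (\<ge>) \<mu> \<and> 0 \<notin> set \<mu>"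

text \<open>The conjugate partition as a point, with parts numbered from 1; it is zero beyond
  the first part of \<open>\<mu>\<close>, so the padding by zeros is automatic.\<close>

definition conjugate_point :: "nat list \<Rightarrow> nat \<Rightarrow> complex" where
  "conjugate_point \<mu> i = of_nat (card {j. j < length \<mu> \<and> i \<le> \<mu> ! j})"

end

(*
  Evaluating on a highest weight vector kills all terms of a Capelli column determinant except the
  diagonal one, so the eigenvalue of H_k(n) is the shifted elementary symmetric polynomial
  sum_{|I| = k} prod_{i in I} (x_i + #{j in I. j > i}), which does not change when a zero is appended
  to x. It therefore suffices that rho(n) is, for one large n, a polynomial in the H_k(n): applying
  the embeddings shows that the same polynomial represents rho at all later levels.

  Only elements of bounded degree m at a level n >= 3 m have to be expressed in this way, and in this
  stable range Capelli's theorem follows from an elementary argument on leading symbols. The symbol of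
  a central element is an invariant polynomial in the matrix entries. Replacing one occurrence of a
  repeated index by an unused one, invariance expresses its coefficients through those at the
  monomials prod_a x_(a, sigma(a)), where the a are distinct and sigma is a permutation, and the latter
  depend on the cycle type of sigma only. On cycle types the symbols of the products of Capelli
  elements are triangular with respect to the number of cycles, so one of them can be subtracted to
  lower the degree. That the symbol is well defined is the Poincare-Birkhoff-Witt theorem for gl(n),
  obtained here from the action on tensor powers of C^n + C.
*)
theory Submission
  imports
    Defs
    "HOL-Combinatorics.Cycles"
    "HOL-Computational_Algebra.Polynomial"
begin

section \<open>The free algebra and the enveloping algebra\<close>

text \<open>Both \<open>harish_chandra\<close> and \<open>harish_chandra_limit\<close> are definite
  descriptions, so nothing is known about their values before uniqueness is shown. For the former
  this requires highest weight modules for a Zariski dense set of weights. Decreasing sequences of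
  natural numbers suffice, and their modules are quotients of the enveloping algebra by a maximal
  left ideal that contains the annihilator of an explicit tensor. For the latter, injectivity of the
  embeddings leaves a single element of the limit class at each level. The summand C in the tensor
  powers makes short words invisible: an alternating sum over the trivial components kills every
  position on which no letter has acted. Triangularity holds because at a permutation monomial each
  factor of a product of Capelli elements must use up a nonempty union of cycles, so there cannot be
  fewer cycles than factors.\<close>

lemma poly_mapping_add_induct [case_names zero single add]:
  assumes "P 0" "\<And>w c. P (Poly_Mapping.single w c)" "\<And>a b. P a \<Longrightarrow> P b \<Longrightarrow> P (a + b)"
  shows "P (a :: 'a \<Rightarrow>\<^sub>0 'b::comm_monoid_add)"
proof (induction a rule: update_induct)
  case const
  show ?case by fact
next
  case (update f a b)
  have "Poly_Mapping.update a b f = f + Poly_Mapping.single a b"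
    by (rule poly_mapping_eqI)
      (use update.hyps in \<open>auto simp: lookup_update lookup_add lookup_single in_keys_iff when_def\<close>)
  then show ?case using assms update.IH by simp
qed

text \<open>Linear extension of \<open>g\<close> from the basis of words. The scalar action
  \<open>s\<close> is a parameter because the values lie in the complex numbers (\<open>lin\<close>)
  in some places and in the free algebra itself in others.\<close>

definition ext :: "('c \<Rightarrow> 'b \<Rightarrow> 'b) \<Rightarrow> ('k \<Rightarrow> 'b) \<Rightarrow> ('k \<Rightarrow>\<^sub>0 'c::zero) \<Rightarrow> 'b::comm_monoid_add" where
  "ext s g a = (\<Sum>w\<in>Poly_Mapping.keys a. s (Poly_Mapping.lookup a w) (g w))"

context Modules.module
begin

lemma ext_superset:
  assumes "finite A" "Poly_Mapping.keys a \<subseteq> A"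
  shows "ext scale g a = (\<Sum>w\<in>A. scale (Poly_Mapping.lookup a w) (g w))"
  unfolding ext_def by (rule sum.mono_neutral_left) (use assms in \<open>auto simp: in_keys_iff\<close>)

lemma ext_zero [simp]: "ext scale g 0 = 0"
  by (simp add: ext_def)

lemma ext_add: "ext scale g (a + b) = ext scale g a + ext scale g b"
proof -
  let ?A = "Poly_Mapping.keys a \<union> Poly_Mapping.keys b"
  have *: "finite ?A" by simp
  show ?thesis
    using keys_add[of a b]
    by (simp add: ext_superset[OF *] lookup_add scale_left_distrib sum.distrib)
qed

lemma ext_single [simp]: "ext scale g (Poly_Mapping.single w c) = scale c (g w)"
  by (simp add: ext_def)

lemma ext_uminus: "ext scale g (- a) = - ext scale g a"
  by (metis add.right_inverse add_eq_0_iff ext_add ext_zero)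

lemma ext_diff: "ext scale g (a - b) = ext scale g a - ext scale g b"
  by (metis ext_add ext_uminus uminus_add_conv_diff add.commute)

lemma ext_sum: "ext scale g (sum h A) = (\<Sum>i\<in>A. ext scale g (h i))"
  by (induction A rule: infinite_finite_induct) (auto simp: ext_add)

lemma ext_fun_sum: "ext scale (\<lambda>w. \<Sum>i\<in>A. h i w) a = (\<Sum>i\<in>A. ext scale (h i) a)"
  by (simp add: ext_def scale_sum_right sum.swap[of _ A])

lemma ext_fun_diff: "ext scale (\<lambda>w. g w - h w) a = ext scale g a - ext scale h a"
  by (simp add: ext_def scale_right_diff_distrib sum_subtractf)

text \<open>By bilinearity it is enough to multiply two words. Functionals on a product thus become
  iterated functionals, which is how the action and the symbol of products are computed.\<close>

lemma ext_mult:
  "ext scale g (a * b) = ext scale (\<lambda>u. ext scale (\<lambda>v. g (u + v)) b) a"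
  for a b :: "'k::monoid_add \<Rightarrow>\<^sub>0 'a"
proof (induction a rule: poly_mapping_add_induct)
  case (single u c)
  show ?case
    by (induction b rule: poly_mapping_add_induct)
      (auto simp: algebra_simps ext_add mult_single)
qed (auto simp: algebra_simps ext_add)

end

interpretation complex_scale: Modules.module "(*) :: complex \<Rightarrow> complex \<Rightarrow> complex"
  by unfold_locales (simp_all add: algebra_simps)

declare complex_scale.scale_scale [simp del]

abbreviation lin :: "('k \<Rightarrow> complex) \<Rightarrow> ('k \<Rightarrow>\<^sub>0 complex) \<Rightarrow> complex" where
  "lin \<equiv> ext (*)"

lemma lin_fun_mult: "lin (\<lambda>w. c * g w) a = c * lin g a"
  by (simp add: ext_def sum_distrib_left algebra_simps)

lemma lin_fun_zero [simp]: "lin (\<lambda>w. 0) a = 0"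
  by (simp add: ext_def)

lemma lin_cong: "(\<And>w. w \<in> Poly_Mapping.keys a \<Longrightarrow> g w = h w) \<Longrightarrow> lin g a = lin h a"
  by (simp add: ext_def)

lemma of_complex_add: "of_complex (c + d) = of_complex c + of_complex d"
  by (simp add: of_complex_def single_add)

lemma of_complex_mult: "of_complex (c * d) = of_complex c * of_complex d"
  by (simp add: of_complex_def mult_single)

lemma of_complex_0 [simp]: "of_complex 0 = 0"
  and of_complex_1 [simp]: "of_complex 1 = 1"
  by (simp_all add: of_complex_def)

lemma of_complex_of_nat: "of_complex (of_nat k) = of_nat k"
  by (induction k) (auto simp: of_complex_add)

lemma of_complex_uminus: "of_complex (- c) = - of_complex c"
  by (metis add.right_inverse add_eq_0_iff of_complex_add of_complex_0)

lemma of_complex_commute: "of_complex c * a = a * of_complex c"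
  by (induction a rule: poly_mapping_add_induct)
    (auto simp: algebra_simps of_complex_def mult_single)

interpretation free_scale: Modules.module "\<lambda>c a. of_complex c * a"
  by unfold_locales (simp_all add: algebra_simps of_complex_add of_complex_mult)

declare free_scale.scale_scale [simp del]

definition wmono :: "(nat \<times> nat) list \<Rightarrow> free_alg" where
  "wmono u = Poly_Mapping.single (Word u) 1"

lemma wmono_Nil: "wmono [] = 1"
  by (simp add: wmono_def single_one flip: zero_word_def)

lemma wmono_Cons: "wmono ((i, j) # u) = letter i j * wmono u"
  by (simp add: wmono_def letter_def mult_single plus_word_def)

lemma free_expansion: "a = ext (\<lambda>c x. of_complex c * x) (\<lambda>w. wmono (letters w)) a"
proof (induction a rule: poly_mapping_add_induct)
  case (single w c)
  then show ?case
    by (simp add: free_scale.ext_single wmono_def) (simp add: of_complex_def mult_single)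
next
  case (add a b)
  then show ?case by (metis free_scale.ext_add)
qed (simp add: free_scale.ext_zero)

lemma lin_wmono [simp]: "lin g (wmono u) = g (Word u)"
  by (simp add: wmono_def)

lemma lin_of_complex_mult: "lin g (of_complex c * a) = c * lin g a"
  by (simp add: complex_scale.ext_mult of_complex_def lin_fun_mult)

lemma lin_ext: "lin g (ext (\<lambda>c x. of_complex c * x) h a) = lin (\<lambda>w. lin g (h w)) a"
  by (induction a rule: poly_mapping_add_induct)
    (auto simp: free_scale.ext_add complex_scale.ext_add lin_of_complex_mult)

lemma lin_letter_mult:
  "lin g (letter i j * a) = lin (\<lambda>w. g (Word ((i, j) # letters w))) a"
  by (simp add: complex_scale.ext_mult letter_def plus_word_def)

section \<open>The tensor algebra of gl(n) with its degree filtration\<close>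

abbreviation sq :: "nat \<Rightarrow> (nat \<times> nat) set" where
  "sq n \<equiv> {1..n} \<times> {1..n}"

definition tens :: "nat \<Rightarrow> free_alg set" where
  "tens n = {p. \<forall>w \<in> Poly_Mapping.keys p. set (letters w) \<subseteq> sq n}"

text \<open>Representatives for the filtration: \<open>U_filtration n d\<close> is the image of this
  set under \<open>U_class n\<close>.\<close>

definition tens_deg :: "nat \<Rightarrow> nat \<Rightarrow> free_alg set" where
  "tens_deg n d = {p \<in> tens n. \<forall>w \<in> Poly_Mapping.keys p. length (letters w) \<le> d}"

lemma carrier_tensor_gl [simp]: "carrier (tensor_gl n) = tens n"
  by (simp add: tensor_gl_def tens_def)

lemma tensor_gl_simps [simp]:
  "mult (tensor_gl n) = (*)" "add (tensor_gl n) = (+)" "one (tensor_gl n) = 1" "zero (tensor_gl n) = 0"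
  by (simp_all add: tensor_gl_def)

lemma keys_mult_word:
  assumes "w \<in> Poly_Mapping.keys (a * b :: free_alg)"
  obtains u v where "u \<in> Poly_Mapping.keys a" "v \<in> Poly_Mapping.keys b" "letters w = letters u @ letters v"
  using assms keys_mult[of a b] by (fastforce simp: plus_word_def)

lemma tens_degD: "a \<in> tens_deg n d \<Longrightarrow> a \<in> tens n"
  by (simp add: tens_deg_def)

lemma tens_deg_mono: "a \<in> tens_deg n d \<Longrightarrow> d \<le> e \<Longrightarrow> a \<in> tens_deg n e"
  by (force simp: tens_deg_def)

lemma tens_deg_add: "a \<in> tens_deg n d \<Longrightarrow> b \<in> tens_deg n d \<Longrightarrow> a + b \<in> tens_deg n d"
  using keys_add[of a b] unfolding tens_deg_def tens_def by fast

lemma tens_add: "a \<in> tens n \<Longrightarrow> b \<in> tens n \<Longrightarrow> a + b \<in> tens n"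
  using keys_add[of a b] unfolding tens_def by fast

lemma keys_uminus_complex: "Poly_Mapping.keys (- a) = Poly_Mapping.keys (a :: free_alg)"
  by (auto simp: in_keys_iff)

lemma tens_uminus: "a \<in> tens n \<Longrightarrow> - a \<in> tens n"
  unfolding tens_def by (simp add: keys_uminus_complex)

lemma tens_deg_uminus: "a \<in> tens_deg n d \<Longrightarrow> - a \<in> tens_deg n d"
  unfolding tens_deg_def by (simp add: keys_uminus_complex tens_uminus)

lemma tens_diff: "a \<in> tens n \<Longrightarrow> b \<in> tens n \<Longrightarrow> a - b \<in> tens n"
  by (metis tens_add tens_uminus uminus_add_conv_diff)

lemma tens_deg_diff: "a \<in> tens_deg n d \<Longrightarrow> b \<in> tens_deg n d \<Longrightarrow> a - b \<in> tens_deg n d"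
  by (metis tens_deg_add tens_deg_uminus uminus_add_conv_diff add.commute)

lemma tens_mult: "a \<in> tens n \<Longrightarrow> b \<in> tens n \<Longrightarrow> a * b \<in> tens n"
proof -
  assume *: "a \<in> tens n" "b \<in> tens n"
  have "set (letters w) \<subseteq> sq n" if "w \<in> Poly_Mapping.keys (a * b)" for w
    using that
  proof (rule keys_mult_word)
    fix u v assume uv: "u \<in> Poly_Mapping.keys a" "v \<in> Poly_Mapping.keys b" "letters w = letters u @ letters v"
    then have "set (letters u) \<subseteq> sq n" "set (letters v) \<subseteq> sq n" using * unfolding tens_def by blast+
    then show "set (letters w) \<subseteq> sq n" by (simp only: uv set_append Un_least)
  qed
  then show ?thesis by (simp add: tens_def)
qed

lemma tens_deg_mult: "a \<in> tens_deg n d \<Longrightarrow> b \<in> tens_deg n e \<Longrightarrow> a * b \<in> tens_deg n (d + e)"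
  unfolding tens_deg_def by (auto simp: tens_mult elim!: keys_mult_word intro!: add_mono)

lemma zero_in_tens [simp]: "0 \<in> tens n" "0 \<in> tens_deg n d"
  by (simp_all add: tens_def tens_deg_def)

lemma of_complex_in_tens_deg [simp]: "of_complex c \<in> tens_deg n d"
  by (simp add: of_complex_def tens_def tens_deg_def zero_word_def)

lemma of_complex_in_tens [simp]: "of_complex c \<in> tens n"
  using of_complex_in_tens_deg tens_degD by blast

lemma one_in_tens [simp]: "1 \<in> tens n" "1 \<in> tens_deg n d"
  using of_complex_in_tens[of 1] of_complex_in_tens_deg[of 1] by simp_all

lemma of_nat_in_tens [simp]: "of_nat k \<in> tens n" "of_nat k \<in> tens_deg n d"
  using of_complex_in_tens[of "of_nat k"] of_complex_in_tens_deg[of "of_nat k"]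
  by (simp_all add: of_complex_of_nat)

lemma of_int_in_tens [simp]: "of_int k \<in> tens n" "of_int k \<in> tens_deg n d"
  by (cases k; simp add: tens_diff tens_deg_diff tens_uminus tens_deg_uminus del: of_nat_Suc)+

lemma wmono_in_tens_deg: "set u \<subseteq> sq n \<Longrightarrow> length u \<le> d \<Longrightarrow> wmono u \<in> tens_deg n d"
  by (simp add: wmono_def tens_def tens_deg_def)

lemma letter_in_tens_deg: "i \<in> {1..n} \<Longrightarrow> j \<in> {1..n} \<Longrightarrow> 1 \<le> d \<Longrightarrow> letter i j \<in> tens_deg n d"
  by (simp add: letter_def tens_def tens_deg_def)

lemma letter_in_tens: "i \<in> {1..n} \<Longrightarrow> j \<in> {1..n} \<Longrightarrow> letter i j \<in> tens n"
  by (simp add: letter_def tens_def)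

lemma tens_deg_sum: "(\<And>i. i \<in> A \<Longrightarrow> h i \<in> tens_deg n d) \<Longrightarrow> sum h A \<in> tens_deg n d"
  by (induction A rule: infinite_finite_induct) (auto simp: tens_deg_add)

lemma tens_deg_prod_list:
  "(\<And>x. x \<in> set xs \<Longrightarrow> x \<in> tens_deg n 1) \<Longrightarrow> prod_list xs \<in> tens_deg n (length xs)"
proof (induction xs)
  case (Cons x xs)
  then show ?case using tens_deg_mult[of x n 1 "prod_list xs" "length xs"] by simp
qed simp

lemma tens_deg_ext:
  "(\<And>w. w \<in> Poly_Mapping.keys a \<Longrightarrow> h w \<in> tens_deg n d) \<Longrightarrow> ext (\<lambda>c x. of_complex c * x) h a \<in> tens_deg n d"
  unfolding ext_def using tens_deg_mult[OF of_complex_in_tens_deg[of _ n 0]]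
  by (simp add: tens_deg_sum)

lemma tensor_ring: "ring (tensor_gl n)"
proof (rule ringI)
  show "abelian_group (tensor_gl n)"
  proof (rule abelian_groupI)
    fix x assume "x \<in> carrier (tensor_gl n)"
    then show "\<exists>y\<in>carrier (tensor_gl n). y \<oplus>\<^bsub>tensor_gl n\<^esub> x = \<zero>\<^bsub>tensor_gl n\<^esub>"
      by (intro bexI[of _ "- x"]) (auto simp: tens_uminus)
  qed (auto simp: tens_add algebra_simps)
  show "Group.monoid (tensor_gl n)"
    by (rule monoidI) (auto simp: tens_mult algebra_simps)
qed (auto simp: algebra_simps)

lemma gl_relations_tens: "gl_relations n \<subseteq> tens n"
proof
  fix a assume "a \<in> gl_relations n"
  then obtain i j k l where a: "a = letter i j * letter k l - letter k l * letter i j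
        - ((if j = k then letter i l else 0) - (if l = i then letter k j else 0))"
    and "i \<in> {1..n}" "j \<in> {1..n}" "k \<in> {1..n}" "l \<in> {1..n}"
    unfolding gl_relations_def by blast
  then show "a \<in> tens n"
    unfolding a by (intro tens_diff tens_mult letter_in_tens) (auto simp: letter_in_tens)
qed

lemma gl_ideal_ideal: "ideal (gl_ideal n) (tensor_gl n)"
  unfolding gl_ideal_def using gl_relations_tens by (simp add: ring.genideal_ideal[OF tensor_ring])

lemma gl_ideal_tens: "a \<in> gl_ideal n \<Longrightarrow> a \<in> tens n"
  using ideal.Icarr[OF gl_ideal_ideal] by simp

lemma gl_ideal_add: "a \<in> gl_ideal n \<Longrightarrow> b \<in> gl_ideal n \<Longrightarrow> a + b \<in> gl_ideal n"
  using additive_subgroup.a_closed[OF ideal.axioms(1)[OF gl_ideal_ideal]] by simp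

lemma gl_ideal_mult:
  assumes "a \<in> gl_ideal n" "b \<in> tens n"
  shows "a * b \<in> gl_ideal n" "b * a \<in> gl_ideal n"
  using ideal.I_r_closed[OF gl_ideal_ideal, of a n b] ideal.I_l_closed[OF gl_ideal_ideal, of a n b] assms
  by simp_all

lemma gl_ideal_zero [simp]: "0 \<in> gl_ideal n"
  using additive_subgroup.zero_closed[OF ideal.axioms(1)[OF gl_ideal_ideal]] by simp

text \<open>The retraction onto the subalgebra generated by the letters of \<open>gl(n)\<close>. Pulling the ideal back
  along it gives an ideal of the full type, so that computations modulo the relations need no
  membership conditions.\<close>

definition ret :: "nat \<Rightarrow> free_alg \<Rightarrow> free_alg" where
  "ret n a = Poly_Mapping.mapp (\<lambda>w c. if set (letters w) \<subseteq> sq n then c else 0) a"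

lemma lookup_ret:
  "Poly_Mapping.lookup (ret n a) w = (if set (letters w) \<subseteq> sq n then Poly_Mapping.lookup a w else 0)"
  by (auto simp: ret_def lookup_mapp when_def in_keys_iff)

lemma ret_add: "ret n (a + b) = ret n a + ret n b"
  by (rule poly_mapping_eqI) (simp add: lookup_ret lookup_add)

lemma ret_zero [simp]: "ret n 0 = 0"
  by (rule poly_mapping_eqI) (simp add: lookup_ret)

lemma ret_single:
  "ret n (Poly_Mapping.single w c) = (if set (letters w) \<subseteq> sq n then Poly_Mapping.single w c else 0)"
  by (rule poly_mapping_eqI) (auto simp: lookup_ret lookup_single when_def)

lemma ret_mult: "ret n (a * b) = ret n a * ret n b"
proof (induction a rule: poly_mapping_add_induct)
  case (single u c)
  show ?case
    by (induction b rule: poly_mapping_add_induct)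
      (auto simp: algebra_simps ret_add mult_single ret_single plus_word_def)
qed (auto simp: algebra_simps ret_add)

lemma ret_in_tens [simp]: "ret n a \<in> tens n"
  unfolding tens_def mem_Collect_eq
proof
  fix w assume "w \<in> Poly_Mapping.keys (ret n a)"
  then show "set (letters w) \<subseteq> sq n"
    unfolding in_keys_iff lookup_ret by presburger
qed

lemma ret_tens: "a \<in> tens n \<Longrightarrow> ret n a = a"
  by (rule poly_mapping_eqI) (auto simp: tens_def lookup_ret in_keys_iff)

definition relI :: "nat \<Rightarrow> free_alg set" where
  "relI n = {a. ret n a \<in> gl_ideal n}"

lemma relI_add: "a \<in> relI n \<Longrightarrow> b \<in> relI n \<Longrightarrow> a + b \<in> relI n"
  by (simp add: relI_def ret_add gl_ideal_add)

lemma relI_mult_right: "a \<in> relI n \<Longrightarrow> a * b \<in> relI n"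
  and relI_mult_left: "a \<in> relI n \<Longrightarrow> b * a \<in> relI n"
  by (simp_all add: relI_def ret_mult gl_ideal_mult)

lemma relI_zero [simp]: "0 \<in> relI n"
  by (simp add: relI_def)

lemma relI_uminus: "a \<in> relI n \<Longrightarrow> - a \<in> relI n"
  using relI_mult_left[of a n "-1"] by simp

lemma relI_diff: "a \<in> relI n \<Longrightarrow> b \<in> relI n \<Longrightarrow> a - b \<in> relI n"
  by (metis relI_add relI_uminus uminus_add_conv_diff add.commute)

lemma relI_sum: "(\<And>i. i \<in> A \<Longrightarrow> h i \<in> relI n) \<Longrightarrow> sum h A \<in> relI n"
  by (induction A rule: infinite_finite_induct) (auto simp: relI_add)

lemma relI_ext:
  "(\<And>w. w \<in> Poly_Mapping.keys a \<Longrightarrow> h w \<in> relI n) \<Longrightarrow> ext (\<lambda>c x. of_complex c * x) h a \<in> relI n"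
  by (simp add: ext_def relI_sum relI_mult_left)

lemma gl_ideal_iff: "a \<in> gl_ideal n \<longleftrightarrow> a \<in> tens n \<and> a \<in> relI n"
  using gl_ideal_tens ret_tens by (auto simp: relI_def)

lemma relI_relation:
  assumes "i \<in> {1..n}" "j \<in> {1..n}" "k \<in> {1..n}" "l \<in> {1..n}"
  shows "letter i j * letter k l - letter k l * letter i j
        - ((if j = k then letter i l else 0) - (if l = i then letter k j else 0)) \<in> relI n"
proof -
  have "letter i j * letter k l - letter k l * letter i j
        - ((if j = k then letter i l else 0) - (if l = i then letter k j else 0)) \<in> gl_relations n"
    unfolding gl_relations_def using assms by blast
  then have "letter i j * letter k l - letter k l * letter i j
        - ((if j = k then letter i l else 0) - (if l = i then letter k j else 0)) \<in> gl_ideal n"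
    unfolding gl_ideal_def using ring.genideal_self[OF tensor_ring, of "gl_relations n" n] gl_relations_tens
    by auto
  then show ?thesis by (simp add: gl_ideal_iff)
qed

section \<open>Computing in the enveloping algebra with representatives\<close>

lemma U_class_eq_iff:
  assumes "a \<in> tens n" "b \<in> tens n"
  shows "U_class n a = U_class n b \<longleftrightarrow> a - b \<in> relI n"
proof -
  interpret ring "tensor_gl n" by (rule tensor_ring)
  have inv: "\<ominus>\<^bsub>tensor_gl n\<^esub> b = - b" if "b \<in> tens n" for b
    by (rule minus_equality) (use that in \<open>auto simp: tens_uminus\<close>)
  show ?thesis
    unfolding U_class_def using quotient_eq_iff_same_a_r_cos[OF gl_ideal_ideal, of a b] assms
    by (simp add: a_minus_def inv gl_ideal_iff tens_diff)
qed

lemma U_ring: "ring (U_gl n)"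
  unfolding U_gl_def by (rule ideal.quotient_is_ring[OF gl_ideal_ideal])

lemma U_class_hom: "U_class n \<in> ring_hom (tensor_gl n) (U_gl n)"
proof -
  have "U_class n = (+>\<^bsub>tensor_gl n\<^esub>) (gl_ideal n)" by (auto simp: U_class_def)
  then show ?thesis unfolding U_gl_def using ideal.rcos_ring_hom[OF gl_ideal_ideal] by simp
qed

lemma U_class_mult: "a \<in> tens n \<Longrightarrow> b \<in> tens n \<Longrightarrow> U_class n (a * b) = U_class n a \<otimes>\<^bsub>U_gl n\<^esub> U_class n b"
  and U_class_add: "a \<in> tens n \<Longrightarrow> b \<in> tens n \<Longrightarrow> U_class n (a + b) = U_class n a \<oplus>\<^bsub>U_gl n\<^esub> U_class n b"
  and U_class_one: "U_class n 1 = \<one>\<^bsub>U_gl n\<^esub>"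
  and U_class_closed: "a \<in> tens n \<Longrightarrow> U_class n a \<in> carrier (U_gl n)"
  using U_class_hom[of n] by (simp_all add: ring_hom_def Pi_def)

lemma carrier_U: "carrier (U_gl n) = U_class n ` tens n"
  unfolding U_gl_def FactRing_def U_class_def by (auto simp: A_RCOSETS_def' a_r_coset_def' A_RCOSETS_defs a_r_coset_defs)

lemma U_class_zero: "U_class n 0 = \<zero>\<^bsub>U_gl n\<^esub>"
  using ring_hom_zero[OF U_class_hom tensor_ring U_ring] by simp

lemma scalar_closed: "scalar n c \<in> carrier (U_gl n)"
  by (simp add: scalar_def U_class_closed)

section \<open>Action on tensors and the symbol\<close>

text \<open>Functions of a family of indices are tensors with one factor for each element of \<open>S\<close>; each factor
  is the sum of the natural module, with basis \<^term>\<open>Some i\<close>, and a trivial one, with basis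
  \<^term>\<open>None\<close>.\<close>

definition op_at :: "'p set \<Rightarrow> nat \<times> nat \<Rightarrow> (('p \<Rightarrow> nat option) \<Rightarrow> complex) \<Rightarrow> ('p \<Rightarrow> nat option) \<Rightarrow> complex" where
  "op_at S e F x = (\<Sum>k\<in>S. if x k = Some (fst e) then F (x(k := Some (snd e))) else 0)"

definition ops :: "'p set \<Rightarrow> (nat \<times> nat) list \<Rightarrow> (('p \<Rightarrow> nat option) \<Rightarrow> complex) \<Rightarrow> ('p \<Rightarrow> nat option) \<Rightarrow> complex" where
  "ops S u F = foldr (op_at S) u F"

definition act :: "'p set \<Rightarrow> free_alg \<Rightarrow> (('p \<Rightarrow> nat option) \<Rightarrow> complex) \<Rightarrow> ('p \<Rightarrow> nat option) \<Rightarrow> complex" where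
  "act S a F x = lin (\<lambda>w. ops S (letters w) F x) a"

lemma ops_Nil [simp]: "ops S [] F = F"
  and ops_Cons [simp]: "ops S (e # u) F = op_at S e (ops S u F)"
  and ops_append: "ops S (u @ v) F = ops S u (ops S v F)"
  by (simp_all add: ops_def)

lemma op_at_lin: "op_at S e (\<lambda>x. lin (\<lambda>v. G v x) b) = (\<lambda>x. lin (\<lambda>v. op_at S e (G v) x) b)"
  unfolding op_at_def complex_scale.ext_fun_sum by (intro ext sum.cong) auto

lemma ops_lin: "ops S u (\<lambda>x. lin (\<lambda>v. G v x) b) = (\<lambda>x. lin (\<lambda>v. ops S u (G v) x) b)"
  by (induction u) (simp_all add: op_at_lin)

lemma op_at_sum: "op_at S e (\<lambda>x. \<Sum>i\<in>A. G i x) = (\<lambda>x. \<Sum>i\<in>A. op_at S e (G i) x)"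
  unfolding op_at_def by (subst sum.swap) (intro ext sum.cong, auto)

lemma ops_sum: "ops S u (\<lambda>x. \<Sum>i\<in>A. G i x) = (\<lambda>x. \<Sum>i\<in>A. ops S u (G i) x)"
  by (induction u) (simp_all add: op_at_sum)

lemma act_add: "act S (a + b) F = (\<lambda>x. act S a F x + act S b F x)"
  by (rule HOL.ext) (simp add: act_def complex_scale.ext_add)

lemma act_diff: "act S (a - b) F = (\<lambda>x. act S a F x - act S b F x)"
  by (rule HOL.ext) (simp add: act_def complex_scale.ext_diff)

lemma act_mult: "act S (a * b) F = act S a (act S b F)"
proof
  fix x
  have "act S b F = (\<lambda>x. lin (\<lambda>v. ops S (letters v) F x) b)" by (simp add: act_def fun_eq_iff)
  then show "act S (a * b) F x = act S a (act S b F) x"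
    by (simp add: act_def complex_scale.ext_mult plus_word_def ops_append ops_lin)
qed

lemma act_letter: "act S (letter i j) F = op_at S (i, j) F"
  by (rule HOL.ext) (simp add: act_def letter_def)

lemma act_of_complex: "act S (of_complex c) F = (\<lambda>x. c * F x)"
  by (rule HOL.ext) (simp add: act_def of_complex_def zero_word_def)

lemma act_zero: "act S 0 F = (\<lambda>x. 0)"
  by (rule HOL.ext) (simp add: act_def)

lemma act_null: "act S a (\<lambda>x. 0) = (\<lambda>x. 0)"
proof -
  have "ops S u (\<lambda>x. 0) = (\<lambda>x. 0)" for u
    by (induction u) (simp_all add: op_at_def)
  then show ?thesis by (intro HOL.ext) (simp add: act_def)
qed

text \<open>Operators at different positions commute, so the commutator only sees both letters
  acting at the same position, where they multiply like matrix units.\<close>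

lemma op_at_commutator:
  assumes "finite S"
  shows "op_at S (i, j) (op_at S (k, l) F) x - op_at S (k, l) (op_at S (i, j) F) x
     = (if j = k then op_at S (i, l) F x else 0) - (if l = i then op_at S (k, j) F x else 0)"
proof -
  define t where "t p q = (if x p = Some i \<and> (x(p := Some j)) q = Some k
      then F (x(p := Some j, q := Some l)) else 0)" for p q
  define t' where "t' p q = (if x q = Some k \<and> (x(q := Some l)) p = Some i
      then F (x(q := Some l, p := Some j)) else 0)" for p q
  have "op_at S (i, j) (op_at S (k, l) F) x = (\<Sum>p\<in>S. \<Sum>q\<in>S. t p q)"
    unfolding op_at_def t_def by (auto intro!: sum.cong simp del: fun_upd_apply)
  moreover have "op_at S (k, l) (op_at S (i, j) F) x = (\<Sum>p\<in>S. \<Sum>q\<in>S. t' p q)"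
    unfolding op_at_def t'_def by (subst sum.swap) (auto intro!: sum.cong simp del: fun_upd_apply)
  ultimately have "op_at S (i, j) (op_at S (k, l) F) x - op_at S (k, l) (op_at S (i, j) F) x
      = (\<Sum>p\<in>S. \<Sum>q\<in>S. t p q - t' p q)"
    by (simp add: sum_subtractf)
  \<comment> \<open>For \<open>p \<noteq> q\<close> the two updates commute and \<open>t p q\<close>
    equals \<open>t' p q\<close>.\<close>
  also have "\<dots> = (\<Sum>p\<in>S. \<Sum>q\<in>S. if p = q then t p p - t' p p else 0)"
    by (intro sum.cong refl) (auto simp: t_def t'_def fun_upd_twist)
  also have "\<dots> = (\<Sum>p\<in>S. t p p - t' p p)"
    using assms by simp
  also have "\<dots> = (if j = k then op_at S (i, l) F x else 0) - (if l = i then op_at S (k, j) F x else 0)"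
    by (cases "j = k"; cases "l = i")
      (simp_all add: t_def t'_def op_at_def sum_subtractf sum_negf cong: if_cong)
  finally show ?thesis .
qed

text \<open>The elements that annihilate all tensors form a two-sided ideal, which contains the
  defining relations and hence the ideal generated by them.\<close>

lemma act_gl_ideal:
  assumes "finite S" "a \<in> gl_ideal n"
  shows "act S a F = (\<lambda>x. 0)"
proof -
  define Z where "Z = {a \<in> tens n. \<forall>F. act S a F = (\<lambda>x. 0)}"
  interpret ring "tensor_gl n" by (rule tensor_ring)
  have inv: "\<ominus>\<^bsub>tensor_gl n\<^esub> b = - b" if "b \<in> tens n" for b
    by (rule minus_equality) (use that in \<open>auto simp: tens_uminus\<close>)
  have um: "- b \<in> Z" if "b \<in> Z" for b
  proof -
    have "act S (- b) F = (\<lambda>x. 0)" for F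
      using act_diff[of S 0 b F] that by (simp add: Z_def act_zero)
    then show ?thesis using that by (simp add: Z_def tens_uminus)
  qed
  have "ideal Z (tensor_gl n)"
  proof (rule idealI[OF tensor_ring])
    show "subgroup Z (add_monoid (tensor_gl n))"
    proof (rule group.subgroupI[OF abelian_group.a_group[OF abelian_group_axioms]])
      fix b assume "b \<in> Z"
      moreover then have "inv\<^bsub>add_monoid (tensor_gl n)\<^esub> b = - b"
        using inv[of b] by (simp add: Z_def a_inv_def)
      ultimately show "inv\<^bsub>add_monoid (tensor_gl n)\<^esub> b \<in> Z" using um by simp
    qed (auto simp: Z_def tens_add act_add act_zero intro!: exI[of _ 0])
  qed (auto simp: Z_def tens_mult act_mult act_null)
  moreover have "gl_relations n \<subseteq> Z"
  proof
    fix a assume a: "a \<in> gl_relations n"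
    then obtain i j k l where *: "a = letter i j * letter k l - letter k l * letter i j
        - ((if j = k then letter i l else 0) - (if l = i then letter k j else 0))"
      unfolding gl_relations_def by blast
    have "act S a F x = 0" for F x
      using op_at_commutator[OF assms(1), of i j k l F x]
      unfolding * by (auto simp: act_diff act_mult act_letter act_zero)
    then show "a \<in> Z" using gl_relations_tens a by (auto simp: Z_def)
  qed
  ultimately have "gl_ideal n \<subseteq> Z"
    unfolding gl_ideal_def by (rule genideal_minimal)
  then show ?thesis using assms by (auto simp: Z_def)
qed

text \<open>\<open>cnt u K w\<close> is the number of ways of matching the positions of \<open>u\<close> with \<open>K\<close> such that corresponding
  letters agree.\<close>

primrec cnt :: "'x list \<Rightarrow> 'k set \<Rightarrow> ('k \<Rightarrow> 'x) \<Rightarrow> nat" where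
  "cnt [] K w = (if K = {} then 1 else 0)"
| "cnt (x # u) K w = (\<Sum>k\<in>K. if w k = x then cnt u (K - {k}) w else 0)"

lemma cnt_length: "finite K \<Longrightarrow> length u \<noteq> card K \<Longrightarrow> cnt u K w = 0"
proof (induction u arbitrary: K)
  case (Cons x u)
  have "cnt u (K - {k}) w = 0" if "k \<in> K" for k
  proof (rule Cons.IH)
    have "card K > 0" using Cons.prems that by (auto simp: card_gt_0_iff)
    then show "length u \<noteq> card (K - {k})" using Cons.prems that by (simp add: card_Diff_singleton)
  qed (use Cons.prems in auto)
  then show ?case by (simp add: sum.neutral)
qed auto

lemma cnt_cong: "(\<And>k. k \<in> K \<Longrightarrow> w k = w' k) \<Longrightarrow> cnt u K w = cnt u K w'"
proof (induction u arbitrary: K)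
  case (Cons x u)
  then have "cnt u (K - {k}) w = cnt u (K - {k}) w'" if "k \<in> K" for k by blast
  then show ?case using Cons.prems by (auto intro!: sum.cong)
qed auto

lemma cnt_swap:
  assumes "finite K"
  shows "cnt (x # y # u) K w = cnt (y # x # u) K w"
proof -
  have *: "cnt (x # y # u) K w =
     (\<Sum>k\<in>K. \<Sum>l\<in>K. if w k = x \<and> w l = y \<and> k \<noteq> l then cnt u (K - {k} - {l}) w else 0)" for x y
  proof -
    have "(\<Sum>l\<in>K - {k}. if w l = y then cnt u (K - {k} - {l}) w else 0) =
        (\<Sum>l\<in>K. if w l = y \<and> k \<noteq> l then cnt u (K - {k} - {l}) w else 0)" for k
      using assms by (intro sum.mono_neutral_cong_left) auto
    then show ?thesis by (auto intro!: sum.cong)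
  qed
  have "K - {k} - {l} = K - {l} - {k}" for k l by auto
  then show ?thesis
    unfolding * by (subst sum.swap) (auto intro!: sum.cong)
qed

lemma cnt_move: "finite K \<Longrightarrow> cnt (a @ x # b) K w = cnt (x # a @ b) K w"
proof (induction a arbitrary: K)
  case (Cons y a)
  have "cnt ((y # a) @ x # b) K w = cnt (y # x # a @ b) K w"
    using Cons.IH[of "K - {_}"] Cons.prems by (auto simp del: cnt.simps simp add: cnt.simps(2)[of y] intro!: sum.cong)
  then show ?case using cnt_swap[OF Cons.prems] by simp
qed simp

lemma cnt_mset: "finite K \<Longrightarrow> mset u = mset u' \<Longrightarrow> cnt u K w = cnt u' K w"
proof (induction u arbitrary: u' K)
  case (Cons x u)
  then have "x \<in> set u'" by (metis list.set_intros(1) set_mset_mset)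
  then obtain a b where u': "u' = a @ x # b" by (metis split_list)
  then have "mset u = mset (a @ b)" using Cons.prems by simp
  then have "cnt u (K - {k}) w = cnt (a @ b) (K - {k}) w" for k
    using Cons by simp
  then show ?case unfolding u' cnt_move[OF Cons.prems(1)] by (auto intro!: sum.cong)
qed simp

lemma cnt_nonzero_mset: "finite K \<Longrightarrow> cnt u K w \<noteq> 0 \<Longrightarrow> mset u = image_mset w (mset_set K)"
proof (induction u arbitrary: K)
  case (Cons x u)
  then obtain k where k: "k \<in> K" "w k = x" "cnt u (K - {k}) w \<noteq> 0"
    by (auto split: if_splits)
  then have "mset u = image_mset w (mset_set (K - {k}))" using Cons by simp
  then show ?case using k Cons.prems(1) by (simp add: mset_set.remove)
qed (auto split: if_splits)

lemma cnt_pos: "finite K \<Longrightarrow> mset u = image_mset w (mset_set K) \<Longrightarrow> cnt u K w > 0"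
proof (induction u arbitrary: K)
  case (Cons x u)
  then have "x \<in># image_mset w (mset_set K)" by (metis list.set_intros(1) set_mset_mset)
  then obtain k where k: "k \<in> K" "w k = x" using Cons.prems(1) by auto
  then have "mset u = image_mset w (mset_set (K - {k}))"
    using Cons.prems by (simp add: mset_set.remove)
  then have "cnt u (K - {k}) w > 0" using Cons by simp
  then show ?case using k Cons.prems(1) by (auto intro!: sum_pos2)
qed (auto simp: mset_set_empty_iff)

text \<open>When \<open>w\<close> is injective, a letter determines the position it is matched with,
  so at most one matching exists.\<close>

lemma cnt_inj:
  assumes "finite K" "inj_on w K"
  shows "cnt u K w = (if mset u = mset_set (w ` K) then 1 else 0)"
  using assms
proof (induction u arbitrary: K)
  case Nil
  then show ?case by (auto simp: mset_set_empty_iff)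
next
  case (Cons x u)
  have *: "cnt u (K - {k}) w = (if mset u = mset_set (w ` (K - {k})) then 1 else 0)" for k
    using Cons by (intro Cons.IH) (auto intro: inj_on_subset)
  show ?case
  proof (cases "x \<in> w ` K")
    case True
    then obtain k where k: "k \<in> K" "w k = x" by auto
    have "cnt (x # u) K w = (\<Sum>l\<in>K. if l = k then cnt u (K - {k}) w else 0)"
      using k Cons.prems(2) by (auto simp: inj_on_def intro!: sum.cong)
    also have "\<dots> = cnt u (K - {k}) w" using k Cons.prems by simp
    finally have 1: "cnt (x # u) K w = cnt u (K - {k}) w" .
    have "w ` (K - {k}) = w ` K - {x}" using k Cons.prems(2) by (auto simp: inj_on_def)
    then have "mset_set (w ` K) = add_mset x (mset_set (w ` (K - {k})))"
      using mset_set.remove[of "w ` K" x] k Cons.prems(1) by auto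
    then show ?thesis unfolding 1 *[of k] by simp
  next
    case False
    then have "mset (x # u) \<noteq> mset_set (w ` K)" using Cons.prems(1)
      by (metis elem_mset_set finite_imageI list.set_intros(1) set_mset_mset)
    moreover have "cnt (x # u) K w = 0" using False by (auto intro!: sum.neutral)
    ultimately show ?thesis by simp
  qed
qed

section \<open>Decomposable tensors and their alternating evaluation\<close>

definition tensor_fun :: "'p set \<Rightarrow> ('p \<Rightarrow> nat option \<Rightarrow> complex) \<Rightarrow> ('p \<Rightarrow> nat option) \<Rightarrow> complex" where
  "tensor_fun S f x = (\<Prod>k\<in>S. f k (x k))"

text \<open>Leibniz rule: a matrix unit acts on one factor at a time.\<close>

lemma op_at_tensor_fun:
  assumes "finite S"
  shows "op_at S (i, j) (tensor_fun S f) =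
    (\<lambda>x. \<Sum>k\<in>S. tensor_fun S (f(k := (\<lambda>s. if s = Some i then f k (Some j) else 0))) x)"
proof
  fix x
  have "(if x k = Some i then tensor_fun S f (x(k := Some j)) else 0)
    = tensor_fun S (f(k := (\<lambda>s. if s = Some i then f k (Some j) else 0))) x" if "k \<in> S" for k
    using assms that unfolding tensor_fun_def by (auto simp: prod.remove[of S k] intro!: prod.cong)
  then show "op_at S (i, j) (tensor_fun S f) x =
    (\<Sum>k\<in>S. tensor_fun S (f(k := (\<lambda>s. if s = Some i then f k (Some j) else 0))) x)"
    unfolding op_at_def fst_conv snd_conv by (rule sum.cong[OF refl])
qed

text \<open>The tensor product over the positions \<open>k\<close> of the functionals "coordinate at
  \<open>Some (r k)\<close> minus coordinate at \<open>None\<close>", expanded; see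
  \<open>alt_eval_tensor_fun\<close>.\<close>

definition alt_eval :: "'p set \<Rightarrow> ('p \<Rightarrow> nat) \<Rightarrow> (('p \<Rightarrow> nat option) \<Rightarrow> complex) \<Rightarrow> complex" where
  "alt_eval S r G = (\<Sum>Z\<in>Pow S. (- 1) ^ card (S - Z) * G (\<lambda>k. if k \<in> Z then Some (r k) else None))"

lemma alt_eval_tensor_fun:
  assumes "finite S"
  shows "alt_eval S r (tensor_fun S f) = (\<Prod>k\<in>S. f k (Some (r k)) - f k None)"
proof -
  have "(\<Prod>k\<in>S. f k (Some (r k)) - f k None) = (\<Prod>k\<in>S. f k (Some (r k)) + - f k None)" by simp
  also have "\<dots> = (\<Sum>Z\<in>Pow S. (\<Prod>k\<in>Z. f k (Some (r k))) * (\<Prod>k\<in>S-Z. - f k None))"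
    by (rule prod_add[OF assms])
  also have "\<dots> = alt_eval S r (tensor_fun S f)"
    unfolding alt_eval_def
  proof (rule sum.cong)
    fix Z assume Z: "Z \<in> Pow S"
    have "tensor_fun S f (\<lambda>k. if k \<in> Z then Some (r k) else None) =
        (\<Prod>k\<in>Z. f k (Some (r k))) * (\<Prod>k\<in>S-Z. f k None)"
      unfolding tensor_fun_def using Z assms
      by (subst prod.subset_diff[of Z S]) (auto intro!: arg_cong2[where f="(*)"] prod.cong)
    then show "(\<Prod>k\<in>Z. f k (Some (r k))) * (\<Prod>k\<in>S-Z. - f k None) =
        (- 1) ^ card (S - Z) * tensor_fun S f (\<lambda>k. if k \<in> Z then Some (r k) else None)"
      by (simp add: prod_uminus)
  qed simp
  finally show ?thesis ..
qed

lemma alt_eval_sum: "alt_eval S r (\<lambda>x. \<Sum>i\<in>A. G i x) = (\<Sum>i\<in>A. alt_eval S r (G i))"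
  unfolding alt_eval_def by (simp add: sum_distrib_left) (rule sum.swap)

lemma alt_eval_lin: "alt_eval S r (\<lambda>x. lin (\<lambda>v. G v x) a) = lin (\<lambda>v. alt_eval S r (G v)) a"
  unfolding alt_eval_def by (simp add: complex_scale.ext_fun_sum lin_fun_mult)

text \<open>The trivial component of \<open>probe w k\<close> is chosen such that \<^const>\<open>alt_eval\<close> vanishes on it. Hence only
  words that act on every position contribute, and a word with exactly as many letters as there are
  positions has to match them bijectively.\<close>

definition probe :: "('p \<Rightarrow> nat \<times> nat) \<Rightarrow> 'p \<Rightarrow> nat option \<Rightarrow> complex" where
  "probe w k s = (if s = Some (snd (w k)) \<or> s = None \<and> fst (w k) = snd (w k) then 1 else 0)"

text \<open>\<open>K\<close> is the set of positions that still carry their probe; the factors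
  elsewhere are arbitrary, which is what makes the induction possible. The last letter of
  \<open>u\<close> acts first, hence \<open>rev u\<close>.\<close>

lemma alt_eval_ops:
  assumes "finite S" "K \<subseteq> S" "length u \<le> card K" "\<And>k. k \<in> K \<Longrightarrow> f k = probe w k"
  shows "alt_eval S (fst \<circ> w) (ops S u (tensor_fun S f)) =
    of_nat (cnt (rev u) K w) * (\<Prod>k\<in>S - K. f k (Some (fst (w k))) - f k None)"
  using assms(2-)
proof (induction u arbitrary: f K rule: rev_induct)
  case Nil
  show ?case
  proof (cases "K = {}")
    case False
    then obtain k where "k \<in> K" by auto
    \<comment> \<open>A probe on which no letter acts has equal values at
      \<open>Some (fst (w k))\<close> and at \<open>None\<close>, so its factor vanishes.\<close>
    then have "(\<Prod>k\<in>S. f k (Some (fst (w k))) - f k None) = 0"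
      using Nil assms(1) by (intro prod_zero) (auto intro!: bexI[of _ k] simp: probe_def)
    then show ?thesis using False by (simp add: alt_eval_tensor_fun[OF assms(1)])
  qed (simp add: alt_eval_tensor_fun[OF assms(1)])
next
  case (snoc e u)
  obtain i j where e: "e = (i, j)" by (cases e)
  have finK: "finite K" using snoc.prems(1) assms(1) by (rule finite_subset)
  define h where "h k = f(k := (\<lambda>s. if s = Some i then f k (Some j) else 0))" for k
  let ?P = "\<Prod>k\<in>S - K. f k (Some (fst (w k))) - f k None"
  have 1: "alt_eval S (fst \<circ> w) (ops S u (tensor_fun S (h k))) =
      (if w k = e then of_nat (cnt (rev u) (K - {k}) w) * ?P else 0)" if k: "k \<in> K" for k
  proof -
    have "alt_eval S (fst \<circ> w) (ops S u (tensor_fun S (h k))) = of_nat (cnt (rev u) (K - {k}) w) *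
       (\<Prod>l\<in>S - (K - {k}). h k l (Some (fst (w l))) - h k l None)"
      by (rule snoc.IH) (use snoc.prems k finK in \<open>auto simp: h_def\<close>)
    also have "S - (K - {k}) = insert k (S - K)" using k snoc.prems by auto
    also have "(\<Prod>l\<in>\<dots>. h k l (Some (fst (w l))) - h k l None) =
       (h k k (Some (fst (w k))) - h k k None) * ?P"
      using k assms(1) by (auto simp: h_def intro!: prod.cong)
    \<comment> \<open>After the letter \<open>(i, j)\<close> has acted the \<open>None\<close>
      component is zero, and the other one is 1 exactly if row and column of \<open>w k\<close> are
      \<open>i\<close> and \<open>j\<close>.\<close>
    also have "h k k (Some (fst (w k))) - h k k None = (if w k = e then 1 else 0)"
      using snoc.prems(3)[OF k] by (cases "w k") (auto simp: h_def e probe_def)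
    finally show ?thesis by (auto simp: o_def)
  qed
  \<comment> \<open>A letter spent outside \<open>K\<close> leaves fewer letters than positions in
    \<open>K\<close>, so no matching remains.\<close>
  have 2: "alt_eval S (fst \<circ> w) (ops S u (tensor_fun S (h k))) = 0" if k: "k \<in> S - K" for k
  proof -
    have "alt_eval S (fst \<circ> w) (ops S u (tensor_fun S (h k))) = of_nat (cnt (rev u) K w) *
       (\<Prod>l\<in>S - K. h k l (Some (fst (w l))) - h k l None)"
      by (rule snoc.IH) (use snoc.prems k finK in \<open>auto simp: h_def\<close>)
    also have "cnt (rev u) K w = 0" using snoc.prems by (intro cnt_length finK) auto
    finally show ?thesis by (simp add: o_def)
  qed
  have "alt_eval S (fst \<circ> w) (ops S (u @ [e]) (tensor_fun S f)) =
      (\<Sum>k\<in>S. alt_eval S (fst \<circ> w) (ops S u (tensor_fun S (h k))))"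
    by (simp add: ops_append e op_at_tensor_fun[OF assms(1)] ops_sum alt_eval_sum h_def)
  also have "\<dots> = (\<Sum>k\<in>K. alt_eval S (fst \<circ> w) (ops S u (tensor_fun S (h k))))"
    by (rule sum.mono_neutral_right) (use assms(1) snoc.prems 2 in auto)
  also have "\<dots> = of_nat (cnt (rev (u @ [e])) K w) * ?P"
    by (simp add: 1 sum_distrib_right if_distrib[of of_nat] if_distrib[of "\<lambda>x. x * _"] cong: sum.cong if_cong)
  finally show ?case .
qed

text \<open>For \<open>a\<close> of degree \<^term>\<open>card K\<close> this is the coefficient of the commutative monomial
  \<open>\<Prod>k\<in>K. w k\<close> in the leading symbol, multiplied by the factorials of the multiplicities of its letters.\<close>

definition symb :: "free_alg \<Rightarrow> 'k set \<Rightarrow> ('k \<Rightarrow> nat \<times> nat) \<Rightarrow> complex" where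
  "symb a K w = lin (\<lambda>u. of_nat (cnt (letters u) K w)) a"

text \<open>This makes the symbol independent of the representative. For degree at most
  \<open>card K\<close> the symbol is the alternating evaluation of the action on the tensor of
  probes, and the ideal acts by zero.\<close>

lemma symb_gl_ideal:
  assumes "finite K" "a \<in> gl_ideal n" "a \<in> tens_deg n (card K)"
  shows "symb a K w = 0"
proof -
  have "alt_eval K (fst \<circ> w) (act K a (tensor_fun K (probe w))) =
      lin (\<lambda>u. alt_eval K (fst \<circ> w) (ops K (letters u) (tensor_fun K (probe w)))) a"
    unfolding alt_eval_lin[symmetric] act_def ..
  also have "\<dots> = symb a K w"
    unfolding symb_def
  proof (rule lin_cong)
    fix u assume "u \<in> Poly_Mapping.keys a"
    then have "length (letters u) \<le> card K" using assms(3) by (auto simp: tens_deg_def)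
    then have "alt_eval K (fst \<circ> w) (ops K (letters u) (tensor_fun K (probe w))) =
        of_nat (cnt (rev (letters u)) K w)"
      using alt_eval_ops[OF assms(1), of K "letters u" "probe w" w] by simp
    also have "cnt (rev (letters u)) K w = cnt (letters u) K w"
      by (rule cnt_mset[OF assms(1)]) simp
    finally show "alt_eval K (fst \<circ> w) (ops K (letters u) (tensor_fun K (probe w))) =
        of_nat (cnt (letters u) K w)" .
  qed
  finally show ?thesis
    by (simp add: act_gl_ideal[OF assms(1,2)] alt_eval_def)
qed

section \<open>Invariance of the symbol\<close>

definition ad_letter :: "nat \<Rightarrow> nat \<Rightarrow> nat \<times> nat \<Rightarrow> free_alg" where
  "ad_letter i j x = (if j = fst x then letter i (snd x) else 0) - (if snd x = i then letter (fst x) j else 0)"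

primrec ad_word :: "nat \<Rightarrow> nat \<Rightarrow> (nat \<times> nat) list \<Rightarrow> free_alg" where
  "ad_word i j [] = 0"
| "ad_word i j (x # u) = ad_letter i j x * wmono u + letter (fst x) (snd x) * ad_word i j u"

lemma wmono_Cons': "wmono (x # u) = letter (fst x) (snd x) * wmono u"
  by (cases x) (simp add: wmono_Cons)

lemma ad_word_relI:
  assumes "i \<in> {1..n}" "j \<in> {1..n}" "set u \<subseteq> sq n"
  shows "letter i j * wmono u - wmono u * letter i j - ad_word i j u \<in> relI n"
  using assms(3)
proof (induction u)
  case (Cons x u)
  let ?x = "letter (fst x) (snd x)" and ?e = "letter i j"
  have "?e * ?x - ?x * ?e - ad_letter i j x \<in> relI n"
    unfolding ad_letter_def by (rule relI_relation) (use assms Cons.prems in auto)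
  then have "(?e * ?x - ?x * ?e - ad_letter i j x) * wmono u
      + ?x * (?e * wmono u - wmono u * ?e - ad_word i j u) \<in> relI n"
    using Cons by (intro relI_add relI_mult_left relI_mult_right) auto
  also have "(?e * ?x - ?x * ?e - ad_letter i j x) * wmono u
      + ?x * (?e * wmono u - wmono u * ?e - ad_word i j u)
      = ?e * wmono (x # u) - wmono (x # u) * ?e - ad_word i j (x # u)"
    by (simp add: wmono_Cons' algebra_simps)
  finally show ?case .
qed (simp add: wmono_Nil)

lemma ad_word_tens_deg:
  assumes "i \<in> {1..n}" "j \<in> {1..n}" "set u \<subseteq> sq n" "length u \<le> d"
  shows "ad_word i j u \<in> tens_deg n d"
  using assms(3,4)
proof (induction u arbitrary: d)
  case (Cons x u)
  have "ad_letter i j x \<in> tens_deg n 1"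
    unfolding ad_letter_def using assms(1,2) Cons.prems
    by (auto intro!: tens_deg_diff tens_deg_uminus letter_in_tens_deg)
  then have "ad_word i j (x # u) \<in> tens_deg n (1 + length u)"
    unfolding ad_word.simps using Cons
    by (intro tens_deg_add tens_deg_mult wmono_in_tens_deg letter_in_tens_deg) auto
  then show ?case using Cons.prems by (auto intro: tens_deg_mono)
qed simp

lemma cnt_upd_other: "q \<in> K \<Longrightarrow> cnt u (K - {q}) (w(q := y)) = cnt u (K - {q}) w"
  by (rule cnt_cong) auto

text \<open>The adjoint action is transposed from words to labels: replacing a row \<open>j\<close>
  of a letter by \<open>i\<close> before matching amounts to replacing the row \<open>i\<close> of a
  label by \<open>j\<close>, and similarly for columns.\<close>

lemma lin_cnt_ad_word:
  fixes w :: "'k \<Rightarrow> nat \<times> nat"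
  assumes "finite K"
  shows "lin (\<lambda>v. of_nat (cnt (letters v) K w)) (ad_word i j u) =
    (\<Sum>p\<in>K. if fst (w p) = i then of_nat (cnt u K (w(p := (j, snd (w p))))) else 0) -
    (\<Sum>p\<in>K. if snd (w p) = j then of_nat (cnt u K (w(p := (fst (w p), i)))) else 0)"
  using assms
proof (induction u arbitrary: K)
  case (Cons x u)
  obtain k l where x: "x = (k, l)" by (cases x)
  define A where "A p K = (if fst (w p) = i then (of_nat (cnt u K (w(p := (j, snd (w p))))) :: complex) else 0)" for p K
  define B where "B p K = (if snd (w p) = j then (of_nat (cnt u K (w(p := (fst (w p), i)))) :: complex) else 0)" for p K
  have "lin (\<lambda>v. of_nat (cnt (letters v) K w)) (letter k l * ad_word i j u) =
    (\<Sum>q\<in>K. if w q = (k, l) then lin (\<lambda>v. of_nat (cnt (letters v) (K - {q}) w)) (ad_word i j u) else 0)"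
    unfolding lin_letter_mult word.sel cnt.simps of_nat_sum complex_scale.ext_fun_sum
    by (intro sum.cong refl) simp
  also have "\<dots> = (\<Sum>q\<in>K. \<Sum>p\<in>K - {q}. if w q = (k, l) then A p (K - {q}) - B p (K - {q}) else 0)"
    using Cons by (intro sum.cong refl) (simp add: A_def B_def sum_subtractf)
  also have "\<dots> = (\<Sum>q\<in>K. \<Sum>p\<in>K. if w q = (k, l) \<and> p \<noteq> q then A p (K - {q}) - B p (K - {q}) else 0)"
    using Cons.prems by (intro sum.cong refl sum.mono_neutral_cong_left) auto
  also have "\<dots> = (\<Sum>p\<in>K. \<Sum>q\<in>K. if w q = (k, l) \<and> p \<noteq> q then A p (K - {q}) - B p (K - {q}) else 0)"
    by (rule sum.swap)
  finally have 1: "lin (\<lambda>v. of_nat (cnt (letters v) K w)) (letter k l * ad_word i j u) = \<dots>" .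
  \<comment> \<open>The matchings are split according to whether the first letter \<open>x\<close>
    is matched with the altered position \<open>p\<close>: if not, the induction hypothesis counts
    them; if so, they come from \<open>ad_letter i j x\<close>.\<close>
  have A: "(if fst (w p) = i then of_nat (cnt (x # u) K (w(p := (j, snd (w p))))) else 0) =
     (\<Sum>q\<in>K. if w q = (k, l) \<and> p \<noteq> q then A p (K - {q}) else 0) +
     (if j = k \<and> w p = (i, l) then of_nat (cnt u (K - {p}) w) else 0)" if p: "p \<in> K" for p
  proof (cases "fst (w p) = i")
    case True
    have "(of_nat (cnt (x # u) K (w(p := (j, snd (w p))))) :: complex) =
       (\<Sum>q\<in>K. if (w(p := (j, snd (w p)))) q = x then of_nat (cnt u (K - {q}) (w(p := (j, snd (w p))))) else 0)"
      by (auto simp: of_nat_sum intro!: sum.cong)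
    also have "\<dots> = (\<Sum>q\<in>K. (if w q = (k, l) \<and> p \<noteq> q then A p (K - {q}) else 0) +
       (if p = q then (if j = k \<and> w p = (i, l) then of_nat (cnt u (K - {p}) w) else 0) else 0))"
      using True p by (intro sum.cong refl) (auto simp: x A_def cnt_upd_other prod_eq_iff)
    finally show ?thesis using True Cons.prems p by (simp add: sum.distrib)
  next
    case False
    then have "(\<Sum>q\<in>K. if w q = (k, l) \<and> p \<noteq> q then A p (K - {q}) else 0) = 0"
      by (intro sum.neutral) (auto simp: A_def)
    with False show ?thesis by auto
  qed
  have B: "(if snd (w p) = j then of_nat (cnt (x # u) K (w(p := (fst (w p), i)))) else 0) =
     (\<Sum>q\<in>K. if w q = (k, l) \<and> p \<noteq> q then B p (K - {q}) else 0) +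
     (if l = i \<and> w p = (k, j) then of_nat (cnt u (K - {p}) w) else 0)" if p: "p \<in> K" for p
  proof (cases "snd (w p) = j")
    case True
    have "(of_nat (cnt (x # u) K (w(p := (fst (w p), i)))) :: complex) =
       (\<Sum>q\<in>K. if (w(p := (fst (w p), i))) q = x then of_nat (cnt u (K - {q}) (w(p := (fst (w p), i)))) else 0)"
      by (auto simp: of_nat_sum intro!: sum.cong)
    also have "\<dots> = (\<Sum>q\<in>K. (if w q = (k, l) \<and> p \<noteq> q then B p (K - {q}) else 0) +
       (if p = q then (if l = i \<and> w p = (k, j) then of_nat (cnt u (K - {p}) w) else 0) else 0))"
      using True p by (intro sum.cong refl) (auto simp: x B_def cnt_upd_other prod_eq_iff)
    finally show ?thesis using True Cons.prems p by (simp add: sum.distrib)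
  next
    case False
    then have "(\<Sum>q\<in>K. if w q = (k, l) \<and> p \<noteq> q then B p (K - {q}) else 0) = 0"
      by (intro sum.neutral) (auto simp: B_def)
    with False show ?thesis by auto
  qed
  have 2: "lin (\<lambda>v. of_nat (cnt (letters v) K w)) (letter a b * wmono u) =
     (\<Sum>p\<in>K. if w p = (a, b) then of_nat (cnt u (K - {p}) w) else 0)" for a b
    by (simp add: lin_letter_mult of_nat_sum if_distrib[of of_nat] cong: if_cong)
  have 3: "lin (\<lambda>v. of_nat (cnt (letters v) K w)) (ad_letter i j x * wmono u) =
     (\<Sum>p\<in>K. (if j = k \<and> w p = (i, l) then of_nat (cnt u (K - {p}) w) else 0) -
     (if l = i \<and> w p = (k, j) then of_nat (cnt u (K - {p}) w) else 0))"
    by (auto simp: ad_letter_def x left_diff_distrib complex_scale.ext_diff 2 sum_subtractf)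
  have 4: "(\<Sum>p\<in>K. if fst (w p) = i then of_nat (cnt (x # u) K (w(p := (j, snd (w p))))) else 0) =
    (\<Sum>p\<in>K. (\<Sum>q\<in>K. if w q = (k, l) \<and> p \<noteq> q then A p (K - {q}) else 0) +
     (if j = k \<and> w p = (i, l) then of_nat (cnt u (K - {p}) w) else 0))"
    by (rule sum.cong[OF refl A])
  have 5: "(\<Sum>p\<in>K. if snd (w p) = j then of_nat (cnt (x # u) K (w(p := (fst (w p), i)))) else 0) =
    (\<Sum>p\<in>K. (\<Sum>q\<in>K. if w q = (k, l) \<and> p \<noteq> q then B p (K - {q}) else 0) +
     (if l = i \<and> w p = (k, j) then of_nat (cnt u (K - {p}) w) else 0))"
    by (rule sum.cong[OF refl B])
  have 6: "(\<Sum>q\<in>K. if w q = (k, l) \<and> p \<noteq> q then A p (K - {q}) - B p (K - {q}) else 0) =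
      (\<Sum>q\<in>K. if w q = (k, l) \<and> p \<noteq> q then A p (K - {q}) else 0) -
      (\<Sum>q\<in>K. if w q = (k, l) \<and> p \<noteq> q then B p (K - {q}) else 0)" for p
    unfolding sum_subtractf[symmetric] by (intro sum.cong refl) auto
  have "lin (\<lambda>v. of_nat (cnt (letters v) K w)) (ad_word i j (x # u)) =
     lin (\<lambda>v. of_nat (cnt (letters v) K w)) (ad_letter i j x * wmono u) +
     lin (\<lambda>v. of_nat (cnt (letters v) K w)) (letter k l * ad_word i j u)"
    by (simp add: complex_scale.ext_add x)
  then show ?case unfolding 1 3 4 5 6 by (simp add: sum_subtractf sum.distrib)
next
  case Nil
  then show ?case by (cases "K = {}") (simp_all cong: if_cong)
qed

text \<open>Modulo the relations the commutator with \<open>letter i j\<close> equals the derivation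
  \<open>b\<close> of \<open>a\<close>, which has no longer words than \<open>a\<close>. If the
  commutator is in the ideal then so is \<open>b\<close>, hence its symbol vanishes; both sides are
  the two parts of that symbol.\<close>

lemma symb_invariant:
  assumes K: "finite K" and a: "a \<in> tens_deg n (card K)"
    and ij: "i \<in> {1..n}" "j \<in> {1..n}"
    and comm: "letter i j * a - a * letter i j \<in> relI n"
  shows "(\<Sum>p\<in>K. if fst (w p) = i then symb a K (w(p := (j, snd (w p)))) else 0) =
    (\<Sum>p\<in>K. if snd (w p) = j then symb a K (w(p := (fst (w p), i))) else 0)"
proof -
  define b where "b = ext (\<lambda>c x. of_complex c * x) (\<lambda>u. ad_word i j (letters u)) a"
  have keys: "set (letters u) \<subseteq> sq n" "length (letters u) \<le> card K" if "u \<in> Poly_Mapping.keys a" for u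
    using a that unfolding tens_deg_def tens_def by blast+
  have a_eq: "a = ext (\<lambda>c x. of_complex c * x) (\<lambda>u. wmono (letters u)) a"
    by (rule free_expansion)
  have e1: "letter i j * a = ext (\<lambda>c x. of_complex c * x) (\<lambda>u. letter i j * wmono (letters u)) a"
    by (subst a_eq) (auto simp: ext_def sum_distrib_left mult.assoc[symmetric]
      of_complex_commute[of _ "letter i j"] intro!: sum.cong)
  have e2: "a * letter i j = ext (\<lambda>c x. of_complex c * x) (\<lambda>u. wmono (letters u) * letter i j) a"
    by (subst a_eq) (simp add: ext_def sum_distrib_right mult.assoc)
  have "letter i j * a - a * letter i j - b =
     ext (\<lambda>c x. of_complex c * x) (\<lambda>u. letter i j * wmono (letters u) - wmono (letters u) * letter i j - ad_word i j (letters u)) a"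
    unfolding free_scale.ext_fun_diff e1 e2 b_def ..
  moreover have "\<dots> \<in> relI n"
    using keys ij by (intro relI_ext ad_word_relI) blast+
  ultimately have "letter i j * a - a * letter i j - b \<in> relI n" by simp
  from relI_diff[OF comm this] have "b \<in> relI n" by simp
  moreover have b: "b \<in> tens_deg n (card K)"
    unfolding b_def using keys ij by (intro tens_deg_ext ad_word_tens_deg) auto
  ultimately have "symb b K w = 0"
    using K by (intro symb_gl_ideal[where n=n]) (auto simp: gl_ideal_iff tens_degD)
  moreover have "symb b K w = lin (\<lambda>u. lin (\<lambda>v. of_nat (cnt (letters v) K w)) (ad_word i j (letters u))) a"
    unfolding symb_def b_def by (rule lin_ext)
  moreover have "\<dots> = (\<Sum>p\<in>K. if fst (w p) = i then symb a K (w(p := (j, snd (w p)))) else 0) -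
    (\<Sum>p\<in>K. if snd (w p) = j then symb a K (w(p := (fst (w p), i))) else 0)"
    unfolding lin_cnt_ad_word[OF K] complex_scale.ext_fun_diff complex_scale.ext_fun_sum symb_def
    by (intro arg_cong2[where f="(-)"] sum.cong refl) simp_all
  ultimately show ?thesis by simp
qed

section \<open>Congruence up to lower degree\<close>

definition low :: "nat \<Rightarrow> nat \<Rightarrow> free_alg \<Rightarrow> bool" where
  "low n d a \<longleftrightarrow> (\<exists>b \<in> tens_deg n d. a - b \<in> relI n)"

lemma low_tens_deg: "a \<in> tens_deg n d \<Longrightarrow> low n d a"
  unfolding low_def by (rule bexI[of _ a]) auto

lemma low_add:
  assumes "low n d a" "low n d b"
  shows "low n d (a + b)"
proof -
  obtain a' b' where "a' \<in> tens_deg n d" "a - a' \<in> relI n" "b' \<in> tens_deg n d" "b - b' \<in> relI n"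
    using assms by (auto simp: low_def)
  then show ?thesis unfolding low_def
    by (intro bexI[of _ "a' + b'"] tens_deg_add) (use relI_add[of "a - a'" n "b - b'"] in \<open>auto simp: algebra_simps\<close>)
qed

lemma low_sum: "(\<And>i. i \<in> A \<Longrightarrow> low n d (h i)) \<Longrightarrow> low n d (sum h A)"
  by (induction A rule: infinite_finite_induct) (auto simp: low_add low_tens_deg)

lemma low_mult_left:
  assumes "low n d a" "c \<in> tens_deg n e"
  shows "low n (e + d) (c * a)"
proof -
  obtain a' where "a' \<in> tens_deg n d" "a - a' \<in> relI n"
    using assms by (auto simp: low_def)
  then show ?thesis unfolding low_def
    by (intro bexI[of _ "c * a'"] tens_deg_mult assms)
      (use relI_mult_left[of "a - a'" n c] in \<open>auto simp: algebra_simps\<close>)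
qed

lemma low_relI: "a - b \<in> relI n \<Longrightarrow> low n d b \<Longrightarrow> low n d a"
  using relI_add[of "a - b" n] unfolding low_def by (metis add_diff_eq diff_add_cancel)

text \<open>Each exchange with a neighbour costs a commutator, which has one letter less.\<close>

lemma low_move:
  assumes "set (a @ x # b) \<subseteq> sq n"
  shows "low n (length (a @ b)) (wmono (a @ x # b) - wmono (x # a @ b))"
  using assms
proof (induction a)
  case (Cons y a)
  let ?x = "letter (fst x) (snd x)" and ?y = "letter (fst y) (snd y)"
  let ?z = "(if snd y = fst x then letter (fst y) (snd x) else 0) - (if snd x = fst y then letter (fst x) (snd y) else 0)"
  have "?y * ?x - ?x * ?y - ?z \<in> relI n"
    by (rule relI_relation) (use Cons.prems in auto)
  then have "(?y * ?x - ?x * ?y) * wmono (a @ b) - ?z * wmono (a @ b) \<in> relI n"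
    unfolding left_diff_distrib[symmetric] by (intro relI_mult_right) simp
  moreover have "low n (length (y # a @ b)) (?z * wmono (a @ b))"
    using Cons.prems
    by (intro low_tens_deg tens_deg_mult[where d=1 and e="length (a @ b)", THEN tens_deg_mono]
        tens_deg_diff wmono_in_tens_deg) (auto intro!: letter_in_tens_deg)
  ultimately have "low n (length (y # a @ b)) ((?y * ?x - ?x * ?y) * wmono (a @ b))"
    by (rule low_relI)
  moreover have "low n (1 + length (a @ b)) (?y * (wmono (a @ x # b) - wmono (x # a @ b)))"
    using Cons by (intro low_mult_left letter_in_tens_deg) auto
  ultimately have "low n (length (y # a @ b)) (?y * (wmono (a @ x # b) - wmono (x # a @ b)) +
     (?y * ?x - ?x * ?y) * wmono (a @ b))"
    by (intro low_add) auto
  also have "?y * (wmono (a @ x # b) - wmono (x # a @ b)) + (?y * ?x - ?x * ?y) * wmono (a @ b) =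
     wmono ((y # a) @ x # b) - wmono (x # (y # a) @ b)"
    by (simp add: wmono_Cons' algebra_simps)
  finally show ?case by simp
qed (simp add: low_tens_deg)

lemma low_mset:
  assumes "mset u = mset u'" "set u \<subseteq> sq n" "length u = Suc d"
  shows "low n d (wmono u - wmono u')"
  using assms
proof (induction u arbitrary: u' d)
  case (Cons x u)
  then have "x \<in> set u'" by (metis list.set_intros(1) set_mset_mset)
  then obtain a b where u': "u' = a @ x # b" by (metis split_list)
  then have m: "mset u = mset (a @ b)" using Cons.prems by simp
  have d: "d = length (a @ b)" using Cons.prems(3) mset_eq_length[OF m] by simp
  have ss: "set u' \<subseteq> sq n" using Cons.prems by (metis set_mset_mset)
  have 1: "low n d (- (wmono (a @ x # b) - wmono (x # a @ b)))"
    using low_mult_left[OF low_move of_int_in_tens(2)[of "-1" n 0]] ss d u' by simp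
  have "low n d (wmono (x # u) - wmono (x # a @ b))"
  proof (cases d)
    case 0
    then show ?thesis using Cons.prems d by (simp add: low_tens_deg)
  next
    case (Suc e)
    then have "low n (1 + e) (letter (fst x) (snd x) * (wmono u - wmono (a @ b)))"
      using Cons.prems m by (intro low_mult_left Cons.IH letter_in_tens_deg) auto
    then show ?thesis by (simp add: wmono_Cons' algebra_simps Suc)
  qed
  from low_add[OF this 1] show ?case by (simp add: u')
qed simp

text \<open>The words of top degree are grouped by their content. Up to lower degree each may be
  replaced by a fixed representative of its group, and the vanishing symbol says that the
  coefficients in a group add up to zero.\<close>

lemma low_of_symb_zero:
  assumes a: "a \<in> tens_deg n (Suc d)"
    and zero: "\<And>w. symb a {..<Suc d} w = 0"
  shows "low n d a"
proof -
  define rep where "rep M = (SOME u. mset u = M)" for M :: "(nat \<times> nat) multiset"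
  have rep: "mset (rep M) = M" for M
    unfolding rep_def by (rule someI_ex) (rule ex_mset)
  let ?k = "Poly_Mapping.keys a" and ?c = "\<lambda>w. of_complex (Poly_Mapping.lookup a w)"
  define T where "T = {w \<in> ?k. length (letters w) = Suc d}"
  have keys: "set (letters u) \<subseteq> sq n" "length (letters u) \<le> Suc d" if "u \<in> ?k" for u
    using a that unfolding tens_deg_def tens_def by blast+
  have fin: "finite T" by (simp add: T_def)
  have a_eq: "a = (\<Sum>w\<in>?k. ?c w * wmono (letters w))"
    using free_expansion[of a] by (simp add: ext_def)
  have inner: "(\<Sum>w\<in>{w\<in>T. mset (letters w) = M}. ?c w) = 0" if M: "M \<in> (\<lambda>w. mset (letters w)) ` T" for M
  proof -
    let ?w = "\<lambda>k. rep M ! k"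
    have len: "length (rep M) = Suc d"
      using M rep by (auto simp: T_def) (metis rep size_mset)
    have "map ((!) (rep M)) [0..<Suc d] = rep M" using len by (metis map_nth)
    then have im: "image_mset ?w (mset_set {..<Suc d}) = M"
      by (metis rep mset_map mset_upt atLeast0LessThan)
    \<comment> \<open>Labelling the positions by the representative itself, every word of content
      \<open>M\<close> has the same positive number \<open>N\<close> of matchings and every other
      word has none; the symbol is \<open>N\<close> times the sum of the coefficients.\<close>
    define N where "N = cnt (rep M) {..<Suc d} ?w"
    have "N > 0" unfolding N_def by (rule cnt_pos) (simp_all only: im rep finite_lessThan)
    moreover have "cnt u {..<Suc d} ?w = N" if "mset u = M" for u
      unfolding N_def by (rule cnt_mset) (simp_all only: that rep finite_lessThan)
    ultimately have N: "N > 0" "\<And>u. mset u = M \<Longrightarrow> cnt u {..<Suc d} ?w = N" by blast+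
    have "0 = symb a {..<Suc d} ?w" using zero by simp
    also have "\<dots> = (\<Sum>w\<in>?k. if w \<in> T \<and> mset (letters w) = M then Poly_Mapping.lookup a w * of_nat N else 0)"
      unfolding symb_def ext_def
    proof (intro sum.cong refl)
      fix w assume w: "w \<in> ?k"
      show "Poly_Mapping.lookup a w * of_nat (cnt (letters w) {..<Suc d} ?w) =
          (if w \<in> T \<and> mset (letters w) = M then Poly_Mapping.lookup a w * of_nat N else 0)"
      proof (cases "mset (letters w) = M")
        case True
        then have "length (letters w) = Suc d" using len rep by (metis size_mset)
        then show ?thesis using True N w by (simp add: T_def)
      next
        case False
        then have "cnt (letters w) {..<Suc d} ?w = 0"
          using cnt_nonzero_mset[of "{..<Suc d}" "letters w" ?w] im by auto
        then show ?thesis using False by simp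
      qed
    qed
    also have "\<dots> = (\<Sum>w\<in>{w\<in>T. mset (letters w) = M}. Poly_Mapping.lookup a w * of_nat N)"
      by (rule sum.mono_neutral_cong_right) (auto simp: T_def)
    also have "\<dots> = (\<Sum>w\<in>{w\<in>T. mset (letters w) = M}. Poly_Mapping.lookup a w) * of_nat N"
      by (simp add: sum_distrib_right)
    finally have "(\<Sum>w\<in>{w\<in>T. mset (letters w) = M}. Poly_Mapping.lookup a w) = 0" using N by simp
    moreover have "(\<Sum>w\<in>A. ?c w) = of_complex (\<Sum>w\<in>A. Poly_Mapping.lookup a w)" for A
      by (induction A rule: infinite_finite_induct) (auto simp: of_complex_add)
    ultimately show ?thesis by simp
  qed
  have "(\<Sum>w\<in>T. ?c w * wmono (rep (mset (letters w)))) =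
      (\<Sum>M\<in>(\<lambda>w. mset (letters w)) ` T. \<Sum>w\<in>{w\<in>T. mset (letters w) = M}. ?c w * wmono (rep (mset (letters w))))"
    by (rule sum.image_gen[OF fin])
  also have "\<dots> = (\<Sum>M\<in>(\<lambda>w. mset (letters w)) ` T. (\<Sum>w\<in>{w\<in>T. mset (letters w) = M}. ?c w) * wmono (rep M))"
    by (intro sum.cong refl) (auto simp: sum_distrib_right)
  also have "\<dots> = 0" by (intro sum.neutral) (simp add: inner)
  finally have rep0: "(\<Sum>w\<in>T. ?c w * wmono (rep (mset (letters w)))) = 0" .
  have "(\<Sum>w\<in>T. ?c w * wmono (letters w)) = (\<Sum>w\<in>T. ?c w * (wmono (letters w) - wmono (rep (mset (letters w)))))"
    by (simp add: right_diff_distrib sum_subtractf rep0)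
  also have "low n d \<dots>"
  proof (rule low_sum)
    fix w assume w: "w \<in> T"
    then have "low n d (wmono (letters w) - wmono (rep (mset (letters w))))"
      using keys by (intro low_mset) (auto simp: rep T_def)
    then show "low n d (?c w * (wmono (letters w) - wmono (rep (mset (letters w)))))"
      using low_mult_left[OF _ of_complex_in_tens_deg[of _ n 0]] by simp
  qed
  finally have 1: "low n d (\<Sum>w\<in>T. ?c w * wmono (letters w))" .
  have 2: "low n d (\<Sum>w\<in>?k - T. ?c w * wmono (letters w))"
  proof (rule low_sum)
    fix w assume w: "w \<in> ?k - T"
    then have "low n d (wmono (letters w))"
      using keys[of w] by (intro low_tens_deg wmono_in_tens_deg) (auto simp: T_def)
    then show "low n d (?c w * wmono (letters w))"
      using low_mult_left[OF _ of_complex_in_tens_deg[of _ n 0]] by simp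
  qed
  have "a = (\<Sum>w\<in>T. ?c w * wmono (letters w)) + (\<Sum>w\<in>?k - T. ?c w * wmono (letters w))"
    by (subst a_eq, subst sum.subset_diff[of T ?k]) (auto simp: T_def)
  then show ?thesis using low_add[OF 1 2] by simp
qed

section \<open>Reduction to permutation monomials\<close>

text \<open>The coefficient of the symbol at the squarefree monomial with set of variables
  \<open>P\<close>. All multiplicities are 1, so there are no factorials as in
  \<open>symb\<close>.\<close>

definition scf :: "free_alg \<Rightarrow> (nat \<times> nat) set \<Rightarrow> complex" where
  "scf a P = lin (\<lambda>u. if mset (letters u) = mset_set P then 1 else 0) a"

lemma symb_inj: "finite K \<Longrightarrow> inj_on w K \<Longrightarrow> symb a K w = scf a (w ` K)"
  by (simp add: symb_def scf_def cnt_inj if_distrib[of of_nat] cong: if_cong)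

lemma symb_id: "finite P \<Longrightarrow> symb a P (\<lambda>x. x) = scf a P"
  using symb_inj[of P "\<lambda>x. x" a] by simp

lemma symb_outside:
  assumes "finite K" "a \<in> tens n" "k \<in> K" "w k \<notin> sq n"
  shows "symb a K w = 0"
proof -
  have "symb a K w = lin (\<lambda>u. 0) a"
    unfolding symb_def
  proof (rule lin_cong)
    fix u assume "u \<in> Poly_Mapping.keys a"
    then have "set (letters u) \<subseteq> sq n" using assms(2) unfolding tens_def by blast
    then have "w k \<notin> set (letters u)" using assms by blast
    then have "mset (letters u) \<noteq> image_mset w (mset_set K)"
      using assms(1,3) by (metis finite_set_mset_mset_set image_eqI set_image_mset set_mset_mset)
    then have "cnt (letters u) K w = 0" using cnt_nonzero_mset[OF assms(1)] by blast
    then show "of_nat (cnt (letters u) K w) = 0" by simp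
  qed
  then show ?thesis by simp
qed

text \<open>Centrality is tested on the generators only; \<open>U_center_iff\<close> shows that this
  is enough.\<close>

definition central_free :: "nat \<Rightarrow> free_alg \<Rightarrow> bool" where
  "central_free n a \<longleftrightarrow> (\<forall>i\<in>{1..n}. \<forall>j\<in>{1..n}. letter i j * a - a * letter i j \<in> relI n)"

lemma central_free_add: "central_free n a \<Longrightarrow> central_free n b \<Longrightarrow> central_free n (a + b)"
  unfolding central_free_def distrib_left distrib_right add_diff_add by (blast intro: relI_add)

lemma central_free_uminus: "central_free n a \<Longrightarrow> central_free n (- a)"
  unfolding central_free_def mult_minus_left mult_minus_right minus_diff_minus by (blast intro: relI_uminus)

lemma central_free_diff: "central_free n a \<Longrightarrow> central_free n b \<Longrightarrow> central_free n (a - b)"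
  using central_free_add[of n a "- b"] central_free_uminus by simp

lemma central_free_of_complex: "central_free n (of_complex c)"
  by (simp add: central_free_def of_complex_commute)

lemma central_free_mult: 
  assumes "central_free n a" "central_free n b"
  shows "central_free n (a * b)"
  unfolding central_free_def
proof (intro ballI)
  fix i j assume *: "i \<in> {1..n}" "j \<in> {1..n}"
  have "letter i j * (a * b) - a * b * letter i j =
     (letter i j * a - a * letter i j) * b + a * (letter i j * b - b * letter i j)"
    by (simp add: algebra_simps)
  also have "\<dots> \<in> relI n"
    using assms * unfolding central_free_def by (intro relI_add relI_mult_left relI_mult_right) auto
  finally show "letter i j * (a * b) - a * b * letter i j \<in> relI n" .
qed

lemma central_free_relI: "a \<in> relI n \<Longrightarrow> central_free n a"
  by (simp add: central_free_def relI_diff relI_mult_left relI_mult_right)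

lemma symb_central:
  assumes "finite K" "a \<in> tens_deg n (card K)" "central_free n a" "i \<in> {1..n}" "j \<in> {1..n}"
  shows "(\<Sum>p\<in>K. if fst (w p) = i then symb a K (w(p := (j, snd (w p)))) else 0) =
    (\<Sum>p\<in>K. if snd (w p) = j then symb a K (w(p := (fst (w p), i))) else 0)"
  by (rule symb_invariant) (use assms in \<open>auto simp: central_free_def\<close>)

text \<open>A diagonal matrix unit multiplies a monomial by the number of occurrences of
  \<open>i\<close> as a row minus that as a column, and invariance forces this weight to be
  zero.\<close>

lemma symb_weight:
  assumes "finite K" "a \<in> tens_deg n (card K)" "central_free n a" "i \<in> {1..n}"
    and "card {p\<in>K. fst (w p) = i} \<noteq> card {p\<in>K. snd (w p) = i}"
  shows "symb a K w = 0"
proof -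
  have "(\<Sum>p\<in>K. if fst (w p) = i then symb a K (w(p := (i, snd (w p)))) else 0) =
     (\<Sum>p\<in>K. if fst (w p) = i then symb a K w else 0)"
    by (intro sum.cong refl if_cong arg_cong[where f="symb a K"]) (auto simp: prod_eq_iff)
  moreover have "(\<Sum>p\<in>K. if snd (w p) = i then symb a K (w(p := (fst (w p), i))) else 0) =
     (\<Sum>p\<in>K. if snd (w p) = i then symb a K w else 0)"
    by (intro sum.cong refl if_cong arg_cong[where f="symb a K"]) (auto simp: prod_eq_iff)
  ultimately have "of_nat (card {p\<in>K. fst (w p) = i}) * symb a K w = of_nat (card {p\<in>K. snd (w p) = i}) * symb a K w"
    using symb_central[OF assms(1-4,4), of w] assms(1) by (auto simp: sum.If_cases Int_def)
  then show ?thesis using assms(5) unfolding mult_cancel_right of_nat_eq_iff by blast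
qed

text \<open>\<open>P\<close> is the graph of a permutation of its row indices; these are the
  permutation monomials.\<close>

definition bal :: "(nat \<times> nat) set \<Rightarrow> bool" where
  "bal P \<longleftrightarrow> finite P \<and> inj_on fst P \<and> inj_on snd P \<and> fst ` P = snd ` P"

text \<open>Invariance under the matrix unit \<open>(i, N)\<close> with a fresh index \<open>N\<close> rewrites a coefficient in which the
  row index \<open>i\<close> is repeated as a sum of coefficients with more distinct row indices.\<close>

lemma symb_zero_of_scf_zero:
  fixes w :: "'k \<Rightarrow> nat \<times> nat"
  assumes K: "finite K" "card K < n" and a: "a \<in> tens_deg n (card K)" "central_free n a"
    and zero: "\<And>P. bal P \<Longrightarrow> P \<subseteq> sq n \<Longrightarrow> card P = card K \<Longrightarrow> scf a P = 0"
  shows "symb a K w = 0"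
\<comment> \<open>Induction on the number of missing row indices: the rewriting below always
  produces one more distinct row.\<close>
proof (induction "card K - card (fst ` w ` K)" arbitrary: w rule: less_induct)
  case less
  let ?row = "\<lambda>i. {p\<in>K. fst (w p) = i}" and ?col = "\<lambda>i. {p\<in>K. snd (w p) = i}"
  consider (out) "\<not> w ` K \<subseteq> sq n" | (weight) i where "i \<in> {1..n}" "card (?row i) \<noteq> card (?col i)"
    | (good) "w ` K \<subseteq> sq n" "\<And>i. i \<in> {1..n} \<Longrightarrow> card (?row i) = card (?col i)" by blast
  then show ?case
  proof cases
    case out
    then show ?thesis using symb_outside[OF K(1) tens_degD[OF a(1)]] by blast
  next
    case weight
    then show ?thesis using symb_weight[OF K(1) a] by blast
  next
    case good
    have row_in: "fst (w p) \<in> {1..n}" and col_in: "snd (w p) \<in> {1..n}" if "p \<in> K" for p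
      using good(1) that by (auto simp: image_subset_iff mem_Times_iff)
    have rows_cols: "fst ` w ` K = snd ` w ` K"
    proof -
      have "i \<in> fst ` w ` K \<longleftrightarrow> i \<in> snd ` w ` K" for i
      proof -
        have "i \<in> fst ` w ` K \<longleftrightarrow> i \<in> {1..n} \<and> ?row i \<noteq> {}" using row_in by auto
        moreover have "i \<in> snd ` w ` K \<longleftrightarrow> i \<in> {1..n} \<and> ?col i \<noteq> {}" using col_in by auto
        moreover have "?row i = {} \<longleftrightarrow> ?col i = {}" if "i \<in> {1..n}"
        proof -
          have f: "finite (?row i)" "finite (?col i)" using K(1) by simp_all
          show ?thesis unfolding card_0_eq[OF f(1), symmetric] card_0_eq[OF f(2), symmetric] good(2)[OF that] ..
        qed
        ultimately show ?thesis by blast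
      qed
      then show ?thesis by blast
    qed
    show ?thesis
    proof (cases "inj_on (\<lambda>p. fst (w p)) K")
      case True
      have injs: "inj_on (\<lambda>p. snd (w p)) K"
      proof (rule eq_card_imp_inj_on[OF K(1)])
        have "card ((\<lambda>p. snd (w p)) ` K) = card ((\<lambda>p. fst (w p)) ` K)"
          using rows_cols by (simp add: image_image)
        then show "card ((\<lambda>p. snd (w p)) ` K) = card K" using card_image[OF True] by simp
      qed
      have injw: "inj_on w K" using True by (auto simp: inj_on_def)
      have "bal (w ` K)" unfolding bal_def
        using K(1) True injs rows_cols by (auto simp: inj_on_def)
      then have "scf a (w ` K) = 0" using good(1) card_image[OF injw] by (intro zero) auto
      then show ?thesis using symb_inj[OF K(1) injw] by simp
    next
      case False
      then obtain p1 p2 where p12: "p1 \<in> K" "p2 \<in> K" "p1 \<noteq> p2" "fst (w p1) = fst (w p2)"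
        by (auto simp: inj_on_def)
      define i where "i = fst (w p1)"
      have i: "i \<in> {1..n}" using row_in p12 i_def by auto
      obtain q where q: "q \<in> K" "snd (w q) = i"
      proof -
        have "i \<in> snd ` w ` K" unfolding rows_cols[symmetric] i_def using p12(1) by blast
        then show ?thesis using that by auto
      qed
      have "card (fst ` w ` K) < card {1..n}"
        using K card_image_le[of K "\<lambda>p. fst (w p)"] by (simp add: image_image)
      then have "\<not> {1..n} \<subseteq> fst ` w ` K"
        using K(1) card_mono[of "fst ` w ` K" "{1..n}"] by auto
      then obtain N where N: "N \<in> {1..n}" "N \<notin> fst ` w ` K" by blast
      have Nrow: "fst (w p) \<noteq> N" and Ncol: "snd (w p) \<noteq> N" if "p \<in> K" for p
        using N(2) rows_cols that by blast+
      \<comment> \<open>In the invariance under \<open>(i, N)\<close> at \<open>v\<close>, only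
        \<open>q\<close> has column \<open>N\<close>, and restoring \<open>i\<close> there gives
        back \<open>w\<close>. The other side turns a row \<open>i\<close> into the fresh row
        \<open>N\<close>.\<close>
      define v where "v = w(q := (fst (w q), N))"
      have fstv: "fst (v p) = fst (w p)" for p by (simp add: v_def)
      have "(\<Sum>p\<in>K. if snd (v p) = N then symb a K (v(p := (fst (v p), i))) else 0) =
         (\<Sum>p\<in>K. if p = q then symb a K w else 0)"
      proof (intro sum.cong refl if_cong)
        fix p assume "p \<in> K"
        then show "(snd (v p) = N) = (p = q)" using Ncol by (auto simp: v_def)
      next
        fix p assume "p = q"
        then have "v(p := (fst (v p), i)) = w" using q by (auto simp: v_def prod_eq_iff)
        then show "symb a K (v(p := (fst (v p), i))) = symb a K w" by simp
      qed
      also have "\<dots> = symb a K w" using q K(1) by simp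
      finally have "symb a K w = (\<Sum>p\<in>K. if fst (v p) = i then symb a K (v(p := (N, snd (v p)))) else 0)"
        using symb_central[OF K(1) a i N(1), of v] by simp
      also have "\<dots> = 0"
      proof (intro sum.neutral ballI)
        fix p assume p: "p \<in> K"
        show "(if fst (v p) = i then symb a K (v(p := (N, snd (v p)))) else 0) = 0"
        proof (cases "fst (v p) = i")
          case True
          \<comment> \<open>A second position keeps the row \<open>i\<close>, so the row
            \<open>N\<close> is gained and none is lost.\<close>
          obtain p' where p': "p' \<in> K" "p' \<noteq> p" "fst (w p') = i"
            using p12 i_def by (cases "p1 = p") auto
          let ?v' = "v(p := (N, snd (v p)))"
          have "fst ` ?v' ` K = insert N (fst ` w ` K)"
          proof -
            have "fst ` ?v' ` K = (\<lambda>x. if x = p then N else fst (w x)) ` K"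
              unfolding image_image by (intro image_cong) (auto simp: fstv)
            also have "\<dots> = insert N (fst ` w ` K)"
            proof (intro equalityI subsetI)
              fix y assume "y \<in> insert N (fst ` w ` K)"
              then consider "y = N" | x where "x \<in> K" "y = fst (w x)" by auto
              then show "y \<in> (\<lambda>x. if x = p then N else fst (w x)) ` K"
              proof cases
                case 1
                then show ?thesis using p by (intro image_eqI[of _ _ p]) auto
              next
                case (2 x)
                then show ?thesis using p' True fstv
                  by (intro image_eqI[of _ _ "if x = p then p' else x"]) auto
              qed
            qed auto
            finally show ?thesis .
          qed
          then have "card (fst ` ?v' ` K) = Suc (card (fst ` w ` K))" using N(2) K(1) by simp
          moreover have "card (fst ` ?v' ` K) \<le> card K"
            using card_image_le[OF K(1), of "\<lambda>p. fst (?v' p)"] unfolding image_image .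
          ultimately have "symb a K ?v' = 0" by (intro less.hyps) auto
          then show ?thesis by simp
        qed simp
      qed
      finally show ?thesis .
    qed
  qed
qed

text \<open>The index \<open>x\<close> occurs once as a row, in \<open>p\<close>, and once as a
  column, in \<open>q\<close>. With the column in \<open>q\<close> already renamed to
  \<open>z\<close>, invariance under \<open>(x, z)\<close> has one term on each side: undoing this
  renaming gives \<open>P\<close>, and completing it gives the renamed set.\<close>

lemma scf_rename1:
  assumes P: "bal P" "P \<subseteq> sq n" and a: "a \<in> tens_deg n (card P)" "central_free n a"
    and xz: "x \<in> fst ` P" "z \<in> {1..n}" "z \<notin> fst ` P"
  shows "scf a (map_prod (id(x := z)) (id(x := z)) ` P) = scf a P"
proof -
  let ?f = "id(x := z)"
  have fin: "finite P" and i1: "inj_on fst P" and i2: "inj_on snd P" and fs: "fst ` P = snd ` P"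
    using P(1) by (auto simp: bal_def)
  obtain p where p: "p \<in> P" "fst p = x" using xz by auto
  obtain q where q: "q \<in> P" "snd q = x" using xz fs by auto
  have x: "x \<in> {1..n}" using xz(1) P(2) by auto
  have zcol: "snd y \<noteq> z" if "y \<in> P" for y using fs xz(3) that by force
  define v where "v = (\<lambda>y. y)(q := (fst q, z))"
  have "(\<Sum>y\<in>P. if snd (v y) = z then symb a P (v(y := (fst (v y), x))) else 0) =
      (\<Sum>y\<in>P. if y = q then symb a P (\<lambda>y. y) else 0)"
  proof (intro sum.cong refl if_cong)
    fix y assume "y \<in> P"
    then show "(snd (v y) = z) = (y = q)" using zcol by (auto simp: v_def)
  next
    fix y assume "y = q"
    then have "v(y := (fst (v y), x)) = (\<lambda>y. y)" using q by (auto simp: v_def prod_eq_iff)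
    then show "symb a P (v(y := (fst (v y), x))) = symb a P (\<lambda>y. y)" by simp
  qed
  also have "\<dots> = scf a P" using q fin symb_id[OF fin] by simp
  finally have 1: "(\<Sum>y\<in>P. if snd (v y) = z then symb a P (v(y := (fst (v y), x))) else 0) = scf a P" .
  have mp: "symb a P (v(p := (z, snd (v p)))) = symb a P (map_prod ?f ?f)"
    unfolding symb_def
  proof (intro lin_cong arg_cong[where f=of_nat] cnt_cong)
    fix k assume k: "k \<in> P"
    have "fst k = x \<longleftrightarrow> k = p" "snd k = x \<longleftrightarrow> k = q"
      using k p q i1 i2 by (auto simp: inj_on_def)
    then show "(v(p := (z, snd (v p)))) k = map_prod ?f ?f k"
      using p q by (auto simp: v_def prod_eq_iff)
  qed
  have injf: "inj_on (map_prod ?f ?f) P"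
  proof (rule inj_onI)
    fix k l assume kl: "k \<in> P" "l \<in> P" "map_prod ?f ?f k = map_prod ?f ?f l"
    then have "?f (fst k) = ?f (fst l)" by (metis fst_map_prod)
    moreover have "fst k \<noteq> z" "fst l \<noteq> z" using kl xz by auto
    ultimately have "fst k = fst l" by (auto split: if_splits)
    then show "k = l" using kl i1 by (auto simp: inj_on_def)
  qed
  have "(\<Sum>y\<in>P. if fst (v y) = x then symb a P (v(y := (z, snd (v y)))) else 0) =
      (\<Sum>y\<in>P. if y = p then symb a P (map_prod ?f ?f) else 0)"
  proof (intro sum.cong refl if_cong)
    fix y assume "y \<in> P"
    then show "(fst (v y) = x) = (y = p)" using p i1 by (auto simp: v_def inj_on_def)
  qed (use mp in simp)
  also have "\<dots> = scf a (map_prod ?f ?f ` P)" using p fin symb_inj[OF fin injf] by simp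
  finally show ?thesis
    using symb_central[OF fin a x xz(2), of v] 1 by simp
qed

lemma bal_rename:
  assumes "bal P" "inj_on h (fst ` P)"
  shows "bal (map_prod h h ` P)" "card (map_prod h h ` P) = card P"
proof -
  have *: "finite P" "inj_on fst P" "inj_on snd P" "fst ` P = snd ` P"
    using assms by (auto simp: bal_def)
  have 1: "inj_on (\<lambda>p. h (fst p)) P" using comp_inj_on[OF *(2) assms(2)] by (simp add: o_def)
  have 2: "inj_on (\<lambda>p. h (snd p)) P" using comp_inj_on[OF *(3), of h] assms(2) *(4) by (simp add: o_def)
  have "fst ` map_prod h h ` P = h ` fst ` P" "snd ` map_prod h h ` P = h ` snd ` P"
    by (simp_all add: image_image)
  moreover have "inj_on fst (map_prod h h ` P)" "inj_on snd (map_prod h h ` P)" "inj_on (map_prod h h) P"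
    using 1 2 by (auto intro!: inj_on_imageI simp: o_def intro: inj_on_imageI2[of fst "map_prod h h"])
  ultimately show "bal (map_prod h h ` P)" "card (map_prod h h ` P) = card P"
    using * by (auto simp: bal_def card_image)
qed

lemma bal_rename_sq:
  assumes "bal P" "h ` fst ` P \<subseteq> {1..n}"
  shows "map_prod h h ` P \<subseteq> sq n"
proof -
  have "fst ` P = snd ` P" using assms by (auto simp: bal_def)
  then have "h (snd p) \<in> {1..n}" "h (fst p) \<in> {1..n}" if "p \<in> P" for p
    using assms(2) that by blast+
  then show ?thesis by (auto simp: map_prod_def case_prod_unfold)
qed

lemma scf_rename_disjoint:
  assumes P: "bal P" "P \<subseteq> sq n" and a: "a \<in> tens_deg n (card P)" "central_free n a"
    and h: "inj_on h (fst ` P)" "h ` fst ` P \<subseteq> {1..n}" "h ` fst ` P \<inter> fst ` P = {}"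
  shows "scf a (map_prod h h ` P) = scf a P"
proof -
  define D where "D = fst ` P"
  let ?g = "\<lambda>E x. if x \<in> E then h x else x"
  have finD: "finite D" using P by (auto simp: bal_def D_def)
  have fD: "fst p \<in> D" and sD: "snd p \<in> D" if "p \<in> P" for p
    using P(1) that by (auto simp: bal_def D_def)
  have "D \<subseteq> {1..n}" using P(2) by (auto simp: D_def)
  then have Dn: "x \<in> {1..n}" and hn: "h x \<in> {1..n}" and hD: "h x \<notin> D" if "x \<in> D" for x
    using that h(2,3) unfolding D_def by blast+
  have hi: "x = y" if "h x = h y" "x \<in> D" "y \<in> D" for x y
    using inj_onD[OF h(1)[folded D_def] that] .
  have cong: "map_prod f f ` P = map_prod g g ` P" if "\<And>x. x \<in> D \<Longrightarrow> f x = g x" for f g :: "nat \<Rightarrow> nat"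
    by (intro image_cong refl) (simp add: map_prod_def case_prod_unfold that fD sD)
  have "scf a (map_prod (?g E) (?g E) ` P) = scf a P" if "finite E" "E \<subseteq> D" for E
    using that
  proof (induction E rule: finite_induct)
    case empty
    show ?case by (simp add: map_prod_def case_prod_unfold)
  next
    case (insert x E)
    define Q where "Q = map_prod (?g E) (?g E) ` P"
    have xD: "x \<in> D" and ED: "y \<in> E \<Longrightarrow> y \<in> D" for y using insert.prems by auto
    have inj: "inj_on (?g E) D"
      by (rule inj_onI) (use hi hD ED in \<open>metis (full_types)\<close>)
    have fQ: "fst ` Q = ?g E ` D" unfolding Q_def D_def image_image fst_map_prod ..
    have bQ: "bal Q" "card Q = card P" using bal_rename[OF P(1)] inj by (auto simp: Q_def D_def)
    have "?g E ` D \<subseteq> {1..n}" using Dn hn by auto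
    then have Qs: "Q \<subseteq> sq n"
      unfolding Q_def D_def by (rule bal_rename_sq[OF P(1)])
    have hx: "h x \<notin> ?g E ` D"
      using hi[OF _ xD] hD[OF xD] insert.hyps(2) ED by (auto split: if_splits)
    have "x \<in> fst ` Q" unfolding fQ using xD insert.hyps(2) by (intro image_eqI[of _ _ x]) auto
    then have "scf a (map_prod (id(x := h x)) (id(x := h x)) ` Q) = scf a Q"
      using bQ Qs a hn[OF xD] hx by (intro scf_rename1[of Q n]) (auto simp: fQ)
    moreover have "map_prod (id(x := h x)) (id(x := h x)) ` Q =
        map_prod (id(x := h x) \<circ> ?g E) (id(x := h x) \<circ> ?g E) ` P"
      unfolding Q_def image_image map_prod.compositionality ..
    moreover have "\<dots> = map_prod (?g (insert x E)) (?g (insert x E)) ` P"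
      by (rule cong) (use insert.hyps(2) hD xD in auto)
    moreover have "scf a Q = scf a P" unfolding Q_def by (rule insert.IH) (use insert.prems in auto)
    ultimately show ?case by simp
  qed
  from this[OF finD order.refl] show ?thesis
    using cong[of "?g D" h] by simp
qed

text \<open>Renaming to indices disjoint from the old and the new ones first; this is where the stable range
  is used.\<close>

lemma scf_rename:
  assumes P: "bal P" "P \<subseteq> sq n" and a: "a \<in> tens_deg n (card P)" "central_free n a"
    and h: "inj_on h (fst ` P)" "h ` fst ` P \<subseteq> {1..n}" and n: "3 * card P \<le> n"
  shows "scf a (map_prod h h ` P) = scf a P"
proof -
  let ?D = "fst ` P"
  have fin: "finite ?D" using P by (auto simp: bal_def)
  have cD: "card ?D = card P" using P by (auto simp: bal_def card_image)
  have sub: "?D \<subseteq> {1..n}" using P(2) by auto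
  have "card (?D \<union> h ` ?D) \<le> 2 * card P"
    using card_Un_le[of ?D "h ` ?D"] card_image_le[OF fin, of h] cD by simp
  then have "card P \<le> card ({1..n} - (?D \<union> h ` ?D))"
    using n sub h(2) fin by (subst card_Diff_subset) auto
  \<comment> \<open>Old and new indices together are at most \<open>2 * card P\<close>, so
    \<open>3 * card P \<le> n\<close> leaves enough for \<open>Z\<close>.\<close>
  then obtain Z where Z: "Z \<subseteq> {1..n} - (?D \<union> h ` ?D)" "card Z = card P"
    by (metis obtain_subset_with_card_n)
  then have "finite Z" using finite_subset by fastforce
  then obtain g where g: "bij_betw g ?D Z"
    using fin cD Z(2) finite_same_card_bij by metis
  have gi: "inj_on g ?D" "g ` ?D = Z" using g by (auto simp: bij_betw_def)
  define Q where "Q = map_prod g g ` P"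
  have fQ: "fst ` Q = Z" unfolding Q_def image_image fst_map_prod by (simp flip: gi(2) add: image_image)
  have Q: "bal Q" "card Q = card P" using bal_rename[OF P(1) gi(1)] by (auto simp: Q_def)
  have Qs: "Q \<subseteq> sq n" unfolding Q_def by (rule bal_rename_sq[OF P(1)]) (use gi Z in auto)
  have 1: "scf a Q = scf a P"
    unfolding Q_def by (rule scf_rename_disjoint[OF P a gi(1)]) (use gi Z in auto)
  let ?k = "h \<circ> inv_into ?D g"
  have bi: "bij_betw (inv_into ?D g) Z ?D" by (rule bij_betw_inv_into[OF g])
  then have b2: "inj_on (inv_into ?D g) Z" "inv_into ?D g ` Z = ?D"
    unfolding bij_betw_def by blast+
  have ki: "?k ` Z = h ` ?D" unfolding image_comp[symmetric] b2(2) ..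
  have kj: "inj_on ?k Z" by (rule comp_inj_on[OF b2(1)]) (use h(1) b2(2) in simp)
  have "scf a (map_prod ?k ?k ` Q) = scf a Q"
  proof (rule scf_rename_disjoint[OF Q(1) Qs])
    show "?k ` fst ` Q \<subseteq> {1..n}" unfolding fQ ki by (rule h(2))
    show "?k ` fst ` Q \<inter> fst ` Q = {}" unfolding fQ ki using Z by blast
  qed (use kj Q a in \<open>simp_all only: fQ\<close>)
  moreover have "map_prod ?k ?k ` Q = map_prod h h ` P"
  proof -
    have k: "?k (g x) = h x" if "x \<in> ?D" for x using that gi by simp
    have "map_prod ?k ?k (map_prod g g p) = map_prod h h p" if "p \<in> P" for p
    proof -
      have "fst p \<in> ?D" "snd p \<in> ?D" using P(1) that by (auto simp: bal_def)
      then show ?thesis by (simp only: k map_prod_def case_prod_unfold fst_conv snd_conv)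
    qed
    then show ?thesis unfolding Q_def image_image by (intro image_cong refl) auto
  qed
  ultimately show ?thesis using 1 by simp
qed

section \<open>Cycle types\<close>

text \<open>Each entry is paired with its cyclic successor, which for distinct entries is the graph
  of the cyclic permutation \<open>c\<close> on its own support; a list of length 1 gives a diagonal
  pair.\<close>

definition cyc :: "nat list \<Rightarrow> (nat \<times> nat) set" where
  "cyc c = set (zip c (rotate1 c))"

definition cycs :: "nat list list \<Rightarrow> (nat \<times> nat) set" where
  "cycs cs = (\<Union>c\<in>set cs. cyc c)"

lemma cycs_Nil [simp]: "cycs [] = {}"
  and cycs_Cons [simp]: "cycs (c # cs) = cyc c \<union> cycs cs"
  by (simp_all add: cycs_def)

lemma cyc_eq:
  assumes "distinct c"
  shows "cyc c = (\<lambda>x. (x, cycle_of_list c x)) ` set c"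
proof -
  have "rotate1 c = map (cycle_of_list c) c"
    using cyclic_rotation[OF assms, of 1] by simp
  then show ?thesis
    by (simp add: cyc_def zip_map2 zip_same_conv_map image_image)
qed

lemma bal_graph:
  assumes "p permutes D" "finite D"
  shows "bal ((\<lambda>x. (x, p x)) ` D)" "fst ` (\<lambda>x. (x, p x)) ` D = D" "card ((\<lambda>x. (x, p x)) ` D) = card D"
proof -
  show 1: "fst ` (\<lambda>x. (x, p x)) ` D = D" by (simp add: image_image)
  have "snd ` (\<lambda>x. (x, p x)) ` D = D" using permutes_image[OF assms(1)] by (simp add: image_image)
  with 1 show "bal ((\<lambda>x. (x, p x)) ` D)"
    using assms(2) permutes_inj_on[OF assms(1), of D]
    by (auto simp: bal_def intro!: inj_on_imageI simp: o_def)
  show "card ((\<lambda>x. (x, p x)) ` D) = card D" by (intro card_image inj_onI) auto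
qed

lemma bal_Un:
  assumes "bal A" "bal B" "fst ` A \<inter> fst ` B = {}"
  shows "bal (A \<union> B)" "card (A \<union> B) = card A + card B"
proof -
  have d: "A \<inter> B = {}" "fst ` (A - B) \<inter> fst ` (B - A) = {}" using assms(3) by blast+
  have "snd ` A \<inter> snd ` B = {}" using assms by (simp add: bal_def)
  then have "snd ` (A - B) \<inter> snd ` (B - A) = {}" by blast
  then show "bal (A \<union> B)" using assms d by (simp add: bal_def inj_on_Un image_Un)
  show "card (A \<union> B) = card A + card B" using assms d by (simp add: bal_def card_Un_disjoint)
qed

lemma bal_cyc:
  assumes "distinct c"
  shows "bal (cyc c)" "fst ` cyc c = set c" "card (cyc c) = length c"
  unfolding cyc_eq[OF assms] using bal_graph[OF cycle_permutes[of c]] assms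
  by (simp_all add: distinct_card)

lemma bal_cycs:
  assumes "distinct (concat cs)"
  shows "bal (cycs cs) \<and> fst ` cycs cs = set (concat cs) \<and> card (cycs cs) = length (concat cs)"
  using assms
proof (induction cs)
  case (Cons c cs)
  then have IH: "bal (cycs cs)" "fst ` cycs cs = set (concat cs)" "card (cycs cs) = length (concat cs)"
    and c: "distinct c" "set c \<inter> set (concat cs) = {}" by simp_all
  have "fst ` cyc c \<inter> fst ` cycs cs = {}" using IH(2) bal_cyc(2)[OF c(1)] c(2) by simp
  then show ?case using bal_Un[OF bal_cyc(1)[OF c(1)] IH(1)] IH bal_cyc[OF c(1)]
    by (simp only: cycs_Cons image_Un concat.simps set_append length_append simp_thms)
qed (simp add: bal_def)

lemma cycle_decomp_permutes: "cycle_decomp D p \<Longrightarrow> p permutes D"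
proof (induction rule: cycle_decomp.induct)
  case (comp I p c)
  then show ?case
    by (intro permutes_compose permutes_subset[OF cycle_permutes] permutes_subset[OF comp.IH]) auto
qed (rule permutes_id)

lemma cycs_of_cycle_decomp:
  assumes "cycle_decomp D p"
  shows "\<exists>cs. [] \<notin> set cs \<and> distinct (concat cs) \<and> set (concat cs) = D \<and> (\<lambda>x. (x, p x)) ` D = cycs cs"
  using assms
proof (induction rule: cycle_decomp.induct)
  case empty
  show ?case by (rule exI[of _ "[]"]) simp
next
  case (comp I p c)
  then obtain cs where cs: "[] \<notin> set cs" "distinct (concat cs)" "set (concat cs) = I"
    "(\<lambda>x. (x, p x)) ` I = cycs cs" by blast
  have p: "p permutes I" by (rule cycle_decomp_permutes[OF comp.hyps(1)])
  have "(cycle_of_list c \<circ> p) x = cycle_of_list c x" if "x \<in> set c" for x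
  proof -
    have "x \<notin> I" using that comp.hyps(3) by blast
    then show ?thesis by (simp add: permutes_not_in[OF p])
  qed
  moreover have "(cycle_of_list c \<circ> p) x = p x" if "x \<in> I" for x
  proof -
    have "p x \<in> I" using that permutes_in_image[OF p] by blast
    then show ?thesis using comp.hyps(3) id_outside_supp[of "p x" c] by auto
  qed
  ultimately have "(\<lambda>x. (x, (cycle_of_list c \<circ> p) x)) ` (set c \<union> I) = cyc c \<union> cycs cs"
    unfolding image_Un cs(4)[symmetric] cyc_eq[OF comp.hyps(2)]
    by (intro arg_cong2[where f="(\<union>)"] image_cong refl) simp_all
  then show ?case
  proof (cases "c = []")
    \<comment> \<open>\<open>cycle_decomp\<close> admits empty cycles. They are dropped, because the
      length of the list is later used as the number of cycles.\<close>
    case True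
    then show ?thesis using cs \<open>_ = cyc c \<union> cycs cs\<close>
      by (intro exI[of _ cs]) (simp add: cyc_def)
  next
    case False
    then show ?thesis using cs comp.hyps(2,3) \<open>_ = cyc c \<union> cycs cs\<close>
      by (intro exI[of _ "c # cs"]) simp
  qed
qed

text \<open>The pairs of \<open>P\<close> define a permutation of the row indices, which has a cycle
  decomposition; fixed points appear as cycles of length 1.\<close>

lemma bal_imp_cycs:
  assumes "bal P"
  obtains cs where "[] \<notin> set cs" "distinct (concat cs)" "set (concat cs) = fst ` P" "P = cycs cs"
proof -
  let ?D = "fst ` P"
  have P: "finite P" "inj_on fst P" "inj_on snd P" "?D = snd ` P" using assms by (auto simp: bal_def)
  define p where "p = (\<lambda>x. if x \<in> ?D then snd (inv_into P fst x) else x)"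
  have p_fst: "p (fst y) = snd y" if "y \<in> P" for y
    using that P(2) by (simp add: p_def)
  have graph: "(\<lambda>x. (x, p x)) ` ?D = P"
    unfolding image_image using p_fst by (simp cong: image_cong)
  have "p ` ?D = ?D" unfolding image_image using p_fst P(4) by (simp cong: image_cong)
  then have "bij_betw p ?D ?D"
    using P(1) by (simp add: bij_betw_def eq_card_imp_inj_on)
  then have "p permutes ?D"
    by (rule bij_imp_permutes) (simp add: p_def)
  from cycle_decomposition[OF this] P(1) have "cycle_decomp ?D p" by simp
  from cycs_of_cycle_decomp[OF this] show ?thesis using that graph by metis
qed

lemma cycs_map: "cycs (map (map h) cs) = map_prod h h ` cycs cs"
proof -
  have "cyc (map h c) = map_prod h h ` cyc c" for c
    by (simp add: cyc_def rotate1_map zip_map_map map_prod_def)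
  then show ?thesis by (simp add: cycs_def image_UN)
qed

lemma cycs_mset: "mset cs = mset cs' \<Longrightarrow> cycs cs = cycs cs'"
  unfolding cycs_def by (metis set_mset_mset)

lemma mset_map_reorder: "mset (map f xs) = mset ys \<Longrightarrow> \<exists>zs. mset zs = mset xs \<and> map f zs = ys"
proof (induction ys arbitrary: xs)
  case (Cons y ys)
  then have "y \<in> f ` set xs" by (metis list.set_intros(1) list.set_map set_mset_mset)
  then obtain x where x: "x \<in> set xs" "f x = y" by auto
  then have m: "mset xs = add_mset x (mset (remove1 x xs))" by simp
  then have "mset (map f (remove1 x xs)) = mset ys"
  proof -
    have "mset (map f xs) = add_mset y (mset (map f (remove1 x xs)))"
      unfolding mset_map by (subst m) (simp add: x(2))
    then show ?thesis using Cons.prems by simp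
  qed
  from Cons.IH[OF this] obtain zs where "mset zs = mset (remove1 x xs)" "map f zs = ys" by blast
  then have "mset (x # zs) = mset xs" "map f (x # zs) = y # ys"
    using x(2) unfolding m by simp_all
  then show ?case by (intro exI[of _ "x # zs"] conjI)
qed auto

lemma ex_map_eq: "length xs = length ys \<Longrightarrow> distinct xs \<Longrightarrow> \<exists>h. map h xs = ys"
proof (induction xs ys rule: list_induct2)
  case (Cons x xs y ys)
  then obtain h where "map h xs = ys" by auto
  then show ?case using Cons.prems by (intro exI[of _ "h(x := y)"]) (auto simp: map_fun_upd)
qed simp

text \<open>After reordering the cycles, the lengths agree one by one. Then a single map
  \<open>h\<close> carries the concatenated list to the other one entry by entry, and it is a
  renaming in the sense of \<open>scf_rename\<close>.\<close>

lemma scf_type: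
  assumes a: "a \<in> tens_deg n d" "central_free n a" and n: "3 * d \<le> n"
    and cs: "distinct (concat cs)" "set (concat cs) \<subseteq> {1..n}" "length (concat cs) = d"
    and cs': "distinct (concat cs')" "set (concat cs') \<subseteq> {1..n}"
    and type: "mset (map length cs) = mset (map length cs')"
  shows "scf a (cycs cs) = scf a (cycs cs')"
proof -
  obtain zs where zs: "mset zs = mset cs" "map length zs = map length cs'"
    using mset_map_reorder[OF type] by blast
  have mc: "mset (concat zs) = mset (concat cs)"
    using zs(1) by (simp add: mset_concat)
       (metis mset_map sum_mset_sum_list)
  then have zd: "distinct (concat zs)" and zset: "set (concat zs) = set (concat cs)"
    using cs(1) by (metis mset_eq_imp_distinct_iff, metis mset_eq_setD)
  have len: "length (concat zs) = length (concat cs')"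
    using zs(2) by (simp add: length_concat)
  obtain h where h: "map h (concat zs) = concat cs'"
    using ex_map_eq[OF len zd] by blast
  have "concat (map (map h) zs) = concat cs'" using h by (simp add: map_concat)
  moreover have "length (map (map h) zs) = length cs'" using zs(2) by (metis length_map)
  moreover have "\<forall>(x, y) \<in> set (zip (map (map h) zs) cs'). length x = length y"
    using arg_cong[OF zs(2), of length] zs(2) by (auto simp: set_zip list_eq_iff_nth_eq)
  ultimately have "map (map h) zs = cs'" by (rule concat_injective)
  then have eq: "cycs cs' = map_prod h h ` cycs cs"
    using cycs_map[of h zs] cycs_mset[OF zs(1)] by simp
  have b: "bal (cycs cs)" "fst ` cycs cs = set (concat zs)" "card (cycs cs) = d"
    using bal_cycs[OF cs(1)] zset cs(3) by auto
  have hset: "h ` set (concat zs) = set (concat cs')" using h by (metis list.set_map)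
  have hinj: "inj_on h (set (concat zs))" using h cs'(1) by (metis distinct_map)
  have "cycs cs \<subseteq> sq n"
    using bal_rename_sq[OF b(1), of id n] cs(2) b(2) zset by (simp add: map_prod_def)
  then have "scf a (map_prod h h ` cycs cs) = scf a (cycs cs)"
    by (intro scf_rename[OF b(1)]) (use b a n hset hinj cs' in auto)
  then show ?thesis using eq by simp
qed

text \<open>If a pair of the cycle is in \<open>S\<close>, its column is also a row of
  \<open>S\<close>, and injectivity of \<open>fst\<close> makes the pair with that row the next one
  of the cycle. Walking around reaches all of them.\<close>

lemma cycle_in_closed:
  assumes d: "distinct c" and S: "fst ` S = snd ` S" "inj_on fst (S \<union> cyc c)" "S \<inter> cyc c \<noteq> {}"
  shows "cyc c \<subseteq> S"
proof -
  let ?f = "cycle_of_list c"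
  have step: "(?f x, ?f (?f x)) \<in> S" if "x \<in> set c" "(x, ?f x) \<in> S" for x
  proof -
    have fx: "?f x \<in> set c" using that(1) cycle_permutes[of c] by (simp add: permutes_in_image)
    have "?f x \<in> snd ` S" using that(2) by force
    then obtain y where y: "y \<in> S" "fst y = ?f x" unfolding S(1)[symmetric] by auto
    have "(?f x, ?f (?f x)) \<in> cyc c" unfolding cyc_eq[OF d] using fx by blast
    then have "y = (?f x, ?f (?f x))" using S(2) y by (auto simp: inj_on_def)
    then show ?thesis using y by simp
  qed
  obtain x where x: "x \<in> set c" "(x, ?f x) \<in> S" using S(3) unfolding cyc_eq[OF d] by blast
  have it: "(?f ^^ m) x \<in> set c \<and> ((?f ^^ m) x, ?f ((?f ^^ m) x)) \<in> S" for m
  proof (induction m)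
    case (Suc m)
    then show ?case using step cycle_permutes[of c] by (simp add: permutes_in_image)
  qed (use x in simp)
  obtain i where i: "i < length c" "c ! i = x" using x(1) by (metis in_set_conv_nth)
  show ?thesis
  proof
    fix z assume "z \<in> cyc c"
    then obtain y where y: "y \<in> set c" "z = (y, ?f y)" unfolding cyc_eq[OF d] by blast
    obtain l where l: "l < length c" "c ! l = y" using y(1) by (metis in_set_conv_nth)
    \<comment> \<open>The number of steps from position \<open>i\<close> to position
      \<open>l\<close>, with a full turn added to stay within the natural numbers.\<close>
    let ?m = "l + length c - i"
    have "(?f ^^ ?m) x = map (?f ^^ ?m) c ! i" using i by simp
    also have "\<dots> = rotate ?m c ! i" by (simp only: cyclic_rotation[OF d])
    also have "\<dots> = c ! ((?m + i) mod length c)" using i by (simp only: nth_rotate)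
    also have "(?m + i) mod length c = l" using i l by simp
    finally show "z \<in> S" using it[of ?m] y l by simp
  qed
qed

text \<open>Applied to the part of a permutation monomial that is contributed by one factor of a
  product: a cycle that meets \<open>S\<close> is contained in it, so both parts consist of whole
  cycles.\<close>

lemma cycs_split:
  assumes cs: "distinct (concat cs)" and S: "S \<subseteq> cycs cs" "fst ` S = snd ` S"
  shows "S = cycs (filter (\<lambda>c. cyc c \<subseteq> S) cs)"
    and "cycs cs - S = cycs (filter (\<lambda>c. \<not> cyc c \<subseteq> S) cs)"
proof -
  have inj: "inj_on fst (cycs cs)" using bal_cycs[OF cs] by (simp add: bal_def)
  have *: "cyc c \<subseteq> S \<or> S \<inter> cyc c = {}" if "c \<in> set cs" for c
  proof (cases "S \<inter> cyc c = {}")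
    case False
    have "S \<union> cyc c \<subseteq> cycs cs" using S(1) that by (auto simp: cycs_def)
    then have "inj_on fst (S \<union> cyc c)" by (rule inj_on_subset[OF inj])
    moreover have "distinct c" using cs that by (simp add: distinct_concat_iff)
    ultimately show ?thesis using cycle_in_closed S(2) False by blast
  qed simp
  show "S = cycs (filter (\<lambda>c. cyc c \<subseteq> S) cs)"
    using * S(1) unfolding cycs_def by fastforce
  show "cycs cs - S = cycs (filter (\<lambda>c. \<not> cyc c \<subseteq> S) cs)"
    using * unfolding cycs_def by fastforce
qed

section \<open>Squarefree coefficients of sums and products\<close>

lemma scf_diff: "scf (a - b) P = scf a P - scf b P"
  and scf_sum: "scf (sum h A) P = (\<Sum>i\<in>A. scf (h i) P)"
  and scf_of_complex_mult: "scf (of_complex c * a) P = c * scf a P"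
  by (simp_all add: scf_def complex_scale.ext_diff complex_scale.ext_sum lin_of_complex_mult)

lemma lin_fun_mult_right: "lin (\<lambda>w. g w * c) a = lin g a * c"
  by (simp add: ext_def sum_distrib_right mult.assoc)

lemma mset_set_of_submset:
  assumes "M \<subseteq># mset_set P"
  shows "M = mset_set (set_mset M)"
proof (rule multiset_eqI)
  fix x
  have le: "count M x \<le> 1"
    by (rule order_trans[OF mset_subset_eq_count[OF assms]]) (simp add: count_mset_set')
  show "count M x = count (mset_set (set_mset M)) x"
  proof (cases "x \<in># M")
    case True
    then have "count M x = 1" using le count_greater_eq_one_iff[of M x] by (intro antisym) blast+
    then show ?thesis using True by simp
  next
    case False
    then show ?thesis by (simp add: count_mset_set' not_in_iff)
  qed
qed

text \<open>The degree bounds force two words with joint content \<open>P\<close> to have lengths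
  \<open>p\<close> and \<open>q\<close>. As \<open>P\<close> has no repetitions, the letters of the
  first word form the only \<open>S\<close> that contributes.\<close>

lemma scf_mult:
  assumes P: "finite P" "card P = p + q" and a: "a \<in> tens_deg n p" and b: "b \<in> tens_deg n q"
  shows "scf (a * b) P = (\<Sum>S\<in>{S. S \<subseteq> P \<and> card S = p}. scf a S * scf b (P - S))"
proof -
  let ?I = "{S. S \<subseteq> P \<and> card S = p}"
  let ?d = "\<lambda>u S. if mset (letters u) = mset_set S then (1::complex) else 0"
  have finI: "finite ?I" using P(1) by simp
  have key: "?d (u + v) P = (\<Sum>S\<in>?I. ?d u S * ?d v (P - S))"
    if "length (letters u) \<le> p" "length (letters v) \<le> q" for u v
  proof (cases "mset (letters (u + v)) = mset_set P")
    case True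
    let ?u = "mset (letters u)" and ?v = "mset (letters v)"
    have uv: "?u + ?v = mset_set P" using True by (simp add: plus_word_def)
    have sub: "?u \<subseteq># mset_set P" unfolding uv[symmetric] by simp
    have uP: "set (letters u) \<subseteq> P" using set_mset_mono[OF sub] P(1) by simp
    have u: "?u = mset_set (set (letters u))"
      using mset_set_of_submset[OF sub] by simp
    have "length (letters u) + length (letters v) = p + q"
      using arg_cong[OF uv, of size] P by simp
    then have "length (letters u) = p" using that by simp
    then have U: "set (letters u) \<in> ?I" using uP arg_cong[OF u, of size] by simp
    have v: "?v = mset_set (P - set (letters u))"
    proof -
      have "mset_set P = mset_set (set (letters u)) + mset_set (P - set (letters u))"
        using P(1) uP by (metis Diff_disjoint Diff_partition finite_Diff finite_set mset_set_Union)
      then show ?thesis using uv u by (metis add_left_cancel)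
    qed
    have "(\<Sum>S\<in>?I. ?d u S * ?d v (P - S)) = (\<Sum>S\<in>?I. if S = set (letters u) then 1 else 0)"
    proof (intro sum.cong refl)
      fix S assume "S \<in> ?I"
      then have "finite S" using P(1) finite_subset by auto
      then have "?u = mset_set S \<longleftrightarrow> S = set (letters u)"
        using u by (metis finite_set_mset_mset_set set_mset_mset)
      then show "?d u S * ?d v (P - S) = (if S = set (letters u) then 1 else 0)" using v by auto
    qed
    also have "\<dots> = 1" using finI U by simp
    finally show ?thesis using True by simp
  next
    case False
    have "?d u S * ?d v (P - S) = 0" if "S \<in> ?I" for S
    proof -
      have "mset_set S + mset_set (P - S) = mset_set P"
        using that P(1) by (metis (no_types, lifting) Diff_disjoint Diff_partition finite_Diff finite_subset mem_Collect_eq mset_set_Union)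
      then show ?thesis using False by (auto simp: plus_word_def)
    qed
    then have "(\<Sum>S\<in>?I. ?d u S * ?d v (P - S)) = 0" by (rule sum.neutral[OF ballI])
    then show ?thesis using False by simp
  qed
  have "scf (a * b) P = lin (\<lambda>u. lin (\<lambda>v. \<Sum>S\<in>?I. ?d u S * ?d v (P - S)) b) a"
    unfolding scf_def complex_scale.ext_mult
    using a b by (intro lin_cong key) (auto simp: tens_deg_def)
  also have "\<dots> = (\<Sum>S\<in>?I. scf a S * scf b (P - S))"
    unfolding complex_scale.ext_fun_sum lin_fun_mult scf_def
    by (intro sum.cong refl lin_fun_mult_right)
  finally show ?thesis .
qed

section \<open>Symbols of the Capelli elements\<close>

text \<open>The increasing enumeration of \<open>I\<close>, with arguments counted from 1.\<close>

definition enum :: "nat set \<Rightarrow> nat \<Rightarrow> nat" where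
  "enum I a = sorted_list_of_set I ! (a - 1)"

definition capelli_free :: "nat \<Rightarrow> nat \<Rightarrow> free_alg" where
  "capelli_free n k = (\<Sum>I | I \<subseteq> {1..n} \<and> card I = k.
     cdet k (\<lambda>a b. letter (enum I a) (enum I b) + (if a = b then of_nat (k - a) else 0)))"

lemma capelli_H_eq: "capelli_H n k = U_class n (capelli_free n k)"
  by (simp add: capelli_H_def capelli_free_def enum_def Let_def)

lemma enum_bij:
  assumes "finite I" "card I = k"
  shows "bij_betw (enum I) {1..k} I"
proof -
  let ?xs = "sorted_list_of_set I"
  have "bij_betw (\<lambda>a. a - 1) {1..k} {..<k}"
    by (rule bij_betw_byWitness[where f'=Suc]) auto
  moreover have "bij_betw ((!) ?xs) {..<k} I"
    using assms by (intro bij_betw_nth) auto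
  ultimately have "bij_betw ((!) ?xs \<circ> (\<lambda>a. a - 1)) {1..k} I" by (rule bij_betw_trans)
  moreover have "(!) ?xs \<circ> (\<lambda>a. a - 1) = enum I" by (simp add: enum_def fun_eq_iff)
  ultimately show ?thesis by simp
qed

lemma enum_less:
  assumes "finite I" "card I = k" "1 \<le> a" "a < b" "b \<le> k"
  shows "enum I a < enum I b"
  unfolding enum_def using assms
  by (intro sorted_wrt_nth_less[OF strict_sorted_list_of_set]) auto

lemma enum_in: "finite I \<Longrightarrow> card I = k \<Longrightarrow> a \<in> {1..k} \<Longrightarrow> enum I a \<in> I"
  using enum_bij[of I k] by (auto simp: bij_betw_def)

lemma capelli_free_tens_deg: "capelli_free n k \<in> tens_deg n k"
  unfolding capelli_free_def cdet_def
proof (intro tens_deg_sum)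
  fix I p assume I: "I \<in> {I. I \<subseteq> {1..n} \<and> card I = k}" and p: "p \<in> {p. p permutes {1..k}}"
  have fin: "finite I" using I finite_subset by auto
  let ?A = "\<lambda>a b. letter (enum I a) (enum I b) + (if a = b then of_nat (k - a) else 0)"
  have "?A (p j) j \<in> tens_deg n 1" if "j \<in> set [1..<Suc k]" for j
  proof -
    have "j \<in> {1..k}" "p j \<in> {1..k}" using p that permutes_in_image[of p "{1..k}" j] by auto
    then have "enum I (p j) \<in> I" "enum I j \<in> I" using enum_in[OF fin, of k] I by simp_all
    then have "enum I (p j) \<in> {1..n}" "enum I j \<in> {1..n}" using I by blast+
    then show ?thesis by (intro tens_deg_add letter_in_tens_deg) auto
  qed
  then have "(\<Prod>j\<leftarrow>[1..<Suc k]. ?A (p j) j) \<in> tens_deg n (length (map (\<lambda>j. ?A (p j) j) [1..<Suc k]))"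
    by (intro tens_deg_prod_list) (auto simp del: upt_Suc)
  then have "(\<Prod>j\<leftarrow>[1..<Suc k]. ?A (p j) j) \<in> tens_deg n k"
    by (simp only: length_map length_upt diff_Suc_1)
  then show "of_int (sign p) * (\<Prod>j\<leftarrow>[1..<Suc k]. ?A (p j) j) \<in> tens_deg n k"
    using tens_deg_mult[OF of_int_in_tens(2)[of "sign p" n 0]] unfolding add_0 by blast
qed

text \<open>Every factor contributes at most one letter, so fewer factors than the size of
  \<open>M\<close> cannot produce the content \<open>M\<close>.\<close>

lemma lin_prod_small:
  "length es < size M \<Longrightarrow>
   lin (\<lambda>u. if mset (letters u) = M then 1 else 0) (prod_list (map (\<lambda>x. letter (r x) (c x) + of_complex (z x)) es)) = 0"
proof (induction es arbitrary: M)
  case Nil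
  then show ?case by (auto simp: wmono_Nil[symmetric] simp del: size_eq_0_iff_empty)
next
  case (Cons x es)
  let ?R = "prod_list (map (\<lambda>x. letter (r x) (c x) + of_complex (z x)) es)"
  have "(\<lambda>w. if mset (letters (Word ((r x, c x) # letters w))) = M then 1 else (0::complex)) =
     (\<lambda>w. if (r x, c x) \<in># M then (if mset (letters w) = M - {#(r x, c x)#} then 1 else 0) else 0)"
    by (auto simp: fun_eq_iff intro: union_single_eq_member)
  then have "lin (\<lambda>u. if mset (letters u) = M then 1 else 0) (letter (r x) (c x) * ?R) =
      (if (r x, c x) \<in># M then lin (\<lambda>u. if mset (letters u) = M - {#(r x, c x)#} then 1 else 0) ?R else 0)"
    unfolding lin_letter_mult by simp
  also have "\<dots> = 0" using Cons by (simp add: size_Diff_singleton)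
  finally show ?case using Cons by (simp add: distrib_right complex_scale.ext_add lin_of_complex_mult)
qed

text \<open>With exactly as many factors as letters in \<open>M\<close>, choosing a scalar in some
  factor leaves too few letters; only the product of the letters counts.\<close>

lemma lin_prod_top:
  "length es = size M \<Longrightarrow>
   lin (\<lambda>u. if mset (letters u) = M then 1 else 0) (prod_list (map (\<lambda>x. letter (r x) (c x) + of_complex (z x)) es))
   = (if mset (map (\<lambda>x. (r x, c x)) es) = M then 1 else 0)"
proof (induction es arbitrary: M)
  case Nil
  then show ?case by (auto simp: wmono_Nil[symmetric])
next
  case (Cons x es)
  let ?R = "prod_list (map (\<lambda>x. letter (r x) (c x) + of_complex (z x)) es)"
  have "(\<lambda>w. if mset (letters (Word ((r x, c x) # letters w))) = M then 1 else (0::complex)) =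
     (\<lambda>w. if (r x, c x) \<in># M then (if mset (letters w) = M - {#(r x, c x)#} then 1 else 0) else 0)"
    by (auto simp: fun_eq_iff intro: union_single_eq_member)
  then have "lin (\<lambda>u. if mset (letters u) = M then 1 else 0) (letter (r x) (c x) * ?R) =
      (if (r x, c x) \<in># M then lin (\<lambda>u. if mset (letters u) = M - {#(r x, c x)#} then 1 else 0) ?R else 0)"
    unfolding lin_letter_mult by simp
  also have "\<dots> = (if (r x, c x) \<in># M then (if mset (map (\<lambda>x. (r x, c x)) es) = M - {#(r x, c x)#} then 1 else 0) else 0)"
    using Cons.IH[of "M - {#(r x, c x)#}"] Cons.prems by (simp add: size_Diff_singleton)
  also have "\<dots> = (if mset (map (\<lambda>x. (r x, c x)) (x # es)) = M then 1 else 0)" by auto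
  finally show ?case using Cons.prems
    by (simp add: distrib_right complex_scale.ext_add lin_of_complex_mult lin_prod_small)
qed

lemma of_complex_of_int: "of_complex (of_int k) = of_int k"
  by (cases k) (simp_all add: of_complex_uminus of_complex_of_nat del: of_nat_Suc)

text \<open>The diagonal shifts are of lower degree, so in the top degree the Capelli element is the
  sum of the commutative principal minors.\<close>

lemma scf_capelli_free:
  assumes S: "finite S" "card S = k"
  shows "scf (capelli_free n k) S = (\<Sum>I | I \<subseteq> {1..n} \<and> card I = k. \<Sum>p | p permutes {1..k}.
     if (\<lambda>j. (enum I (p j), enum I j)) ` {1..k} = S then of_int (sign p) else 0)"
  unfolding capelli_free_def cdet_def scf_sum
proof (intro sum.cong refl)
  fix I p assume I: "I \<in> {I. I \<subseteq> {1..n} \<and> card I = k}" and p: "p \<in> {p. p permutes {1..k}}"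
  have fin: "finite I" using I finite_subset by auto
  let ?A = "\<lambda>a b. letter (enum I a) (enum I b) + (if a = b then of_nat (k - a) else 0)"
  let ?e = "\<lambda>j. (enum I (p j), enum I j)"
  have A: "?A (p j) j = letter (enum I (p j)) (enum I j) + of_complex (if p j = j then of_nat (k - p j) else 0)" for j
    by (simp add: of_complex_of_nat)
  have ei: "inj_on (enum I) {1..k}"
    using enum_bij[OF fin, of k] I by (simp add: bij_betw_def)
  have K: "set [1..<Suc k] = {1..k}"
    by (simp only: set_upt atLeastLessThanSuc_atLeastAtMost)
  have "inj_on ?e {1..k}"
    by (rule inj_onI) (use inj_onD[OF ei] in blast)
  then have "distinct (map ?e [1..<Suc k])" by (simp only: distinct_map distinct_upt K simp_thms)
  from mset_set_set[OF this] have "mset (map ?e [1..<Suc k]) = mset_set (?e ` {1..k})"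
    by (simp only: set_map K)
  moreover have "mset_set (?e ` {1..k}) = mset_set S \<longleftrightarrow> ?e ` {1..k} = S"
    using S(1) by (intro mset_set_eq_iff) simp_all
  ultimately have e: "mset (map ?e [1..<Suc k]) = mset_set S \<longleftrightarrow> ?e ` {1..k} = S" by (simp only:)
  have "scf (\<Prod>j\<leftarrow>[1..<Suc k]. ?A (p j) j) S = (if mset (map ?e [1..<Suc k]) = mset_set S then 1 else 0)"
    unfolding A scf_def by (rule lin_prod_top) (use S in \<open>simp del: upt_Suc\<close>)
  then show "scf (of_int (sign p) * (\<Prod>j\<leftarrow>[1..<Suc k]. ?A (p j) j)) S =
     (if ?e ` {1..k} = S then of_int (sign p) else 0)"
    unfolding of_complex_of_int[symmetric] scf_of_complex_mult e by simp
qed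

lemma scf_capelli_unbalanced:
  assumes S: "finite S" "card S = k" "fst ` S \<noteq> snd ` S"
  shows "scf (capelli_free n k) S = 0"
  unfolding scf_capelli_free[OF S(1,2)]
proof (intro sum.neutral ballI)
  fix I p assume p: "p \<in> {p. p permutes {1..k}}"
  have "(\<lambda>j. (enum I (p j), enum I j)) ` {1..k} \<noteq> S"
  proof
    assume eq: "(\<lambda>j. (enum I (p j), enum I j)) ` {1..k} = S"
    have "fst ` S = enum I ` p ` {1..k}" unfolding eq[symmetric] by (simp add: image_image)
    moreover have "snd ` S = enum I ` {1..k}" unfolding eq[symmetric] by (simp add: image_image)
    ultimately show False using S(3) p permutes_image[of p "{1..k}"] by simp
  qed
  then show "(if (\<lambda>j. (enum I (p j), enum I j)) ` {1..k} = S then of_int (sign p) else (0::complex)) = 0"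
    by simp
qed

text \<open>Exactly one term of one minor has this monomial: \<open>I\<close> must be the set of
  columns, and the permutation can be read off from the pairs. The coefficient is therefore a
  sign.\<close>

lemma scf_capelli_balanced:
  assumes S: "bal S" "card S = k" "S \<subseteq> sq n"
  shows "scf (capelli_free n k) S \<noteq> 0"
proof -
  define D where "D = snd ` S"
  have finS: "finite S" and i1: "inj_on fst S" and i2: "inj_on snd S" and fD: "fst ` S = D"
    using S by (auto simp: bal_def D_def)
  have D: "finite D" "card D = k" "D \<subseteq> {1..n}"
    using S finS i2 by (auto simp: D_def card_image)
  let ?i = "enum D"
  let ?K = "{1..k}"
  have i: "bij_betw ?i ?K D" by (rule enum_bij[OF D(1,2)])
  have i_inj: "inj_on ?i ?K" and i_im: "?i ` ?K = D" using i by (auto simp: bij_betw_def)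
  \<comment> \<open>\<open>s\<close> sends the column of a pair to its row; \<open>p0\<close> is the
    same permutation expressed through positions in \<open>D\<close>.\<close>
  define s where "s = fst \<circ> inv_into S snd"
  have s_snd: "s (snd y) = fst y" if "y \<in> S" for y using that i2 by (simp add: s_def)
  have "bij_betw snd S D" "bij_betw fst S D" using i1 i2 fD by (auto simp: bij_betw_def D_def)
  then have s: "bij_betw s D D" unfolding s_def by (intro bij_betw_trans[OF bij_betw_inv_into])
  define p0 where "p0 j = (if j \<in> ?K then inv_into ?K ?i (s (?i j)) else j)" for j
  have "bij_betw (inv_into ?K ?i \<circ> (s \<circ> ?i)) ?K ?K"
    by (intro bij_betw_trans[OF bij_betw_trans[OF i s] bij_betw_inv_into[OF i]])
  then have "bij_betw p0 ?K ?K" by (rule bij_betw_cong[THEN iffD1, rotated]) (simp add: p0_def)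
  then have p0: "p0 permutes ?K" by (rule bij_imp_permutes) (simp add: p0_def del: atLeastAtMost_iff)
  have sD: "s x \<in> D" if "x \<in> D" for x using s that by (auto simp: bij_betw_def)
  have ip0: "?i (p0 j) = s (?i j)" if "j \<in> ?K" for j
  proof -
    have "?i j \<in> D" using that i_im by blast
    then have "s (?i j) \<in> ?i ` ?K" using sD i_im by blast
    then show ?thesis by (simp only: p0_def that if_True f_inv_into_f)
  qed
  have Ssub: "(s y, y) \<in> S" if "y \<in> D" for y
  proof -
    have "y \<in> snd ` S" using that unfolding D_def .
    then obtain z where z: "z \<in> S" "y = snd z" by (rule imageE)
    then show ?thesis using s_snd[of z] by simp
  qed
  have ex: "(\<lambda>j. (?i (p0 j), ?i j)) ` ?K = S"
  proof -
    have "(\<lambda>j. (?i (p0 j), ?i j)) ` ?K = (\<lambda>y. (s y, y)) ` ?i ` ?K"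
      unfolding image_image using ip0 by (intro image_cong) auto
    also have "\<dots> = (\<lambda>y. (s y, y)) ` snd ` S" unfolding i_im unfolding D_def ..
    also have "\<dots> = S" unfolding image_image using s_snd by (simp cong: image_cong)
    finally show ?thesis .
  qed
  have uniq: "p = p0" if p: "p permutes ?K" "(\<lambda>j. (?i (p j), ?i j)) ` ?K = S" for p
  proof
    fix j show "p j = p0 j"
    proof (cases "j \<in> ?K")
      case True
      then have "(?i (p j), ?i j) \<in> S" unfolding p(2)[symmetric] by (rule imageI)
      then have "?i (p j) = s (?i j)" using s_snd by fastforce
      then have "?i (p j) = ?i (p0 j)" using ip0[OF True] by simp
      moreover have "p j \<in> ?K" "p0 j \<in> ?K" using True p(1) p0 by (simp_all only: permutes_in_image)
      ultimately show ?thesis by (rule inj_onD[OF i_inj])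
    next
      case False
      then show ?thesis using permutes_not_in[OF p(1)] permutes_not_in[OF p0] by simp
    qed
  qed
  have "scf (capelli_free n k) S = (\<Sum>I | I \<subseteq> {1..n} \<and> card I = k. \<Sum>p | p permutes ?K.
     if I = D \<and> p = p0 then of_int (sign p0) else 0)"
    unfolding scf_capelli_free[OF finS S(2)]
  proof (intro sum.cong refl)
    fix I p assume I: "I \<in> {I. I \<subseteq> {1..n} \<and> card I = k}" and p: "p \<in> {p. p permutes ?K}"
    have imp: "I = D \<and> p = p0" if eq: "(\<lambda>j. (enum I (p j), enum I j)) ` ?K = S"
    proof -
      have "finite I" using I finite_subset by auto
      then have "enum I ` ?K = I" using enum_bij[of I k] I by (auto simp: bij_betw_def)
      moreover have "snd ` S = enum I ` ?K" unfolding eq[symmetric] by (simp add: image_image)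
      ultimately have ID: "I = D" by (simp add: D_def)
      have "p = p0" by (rule uniq) (use p eq ID in simp_all)
      with ID show ?thesis ..
    qed
    show "(if (\<lambda>j. (enum I (p j), enum I j)) ` ?K = S then of_int (sign p) else 0) =
        (if I = D \<and> p = p0 then of_int (sign p0) else (0::complex))"
    proof (cases "I = D \<and> p = p0")
      case True
      then show ?thesis by (simp only: ex simp_thms if_True)
    next
      case False
      then have "(\<lambda>j. (enum I (p j), enum I j)) ` ?K \<noteq> S" by (rule contrapos_nn) (rule imp)
      with False show ?thesis by (simp only: if_False)
    qed
  qed
  also have "\<dots> = (\<Sum>I | I \<subseteq> {1..n} \<and> card I = k. if I = D then of_int (sign p0) else 0)"
  proof (intro sum.cong refl)
    fix I
    show "(\<Sum>p | p permutes ?K. if I = D \<and> p = p0 then of_int (sign p0) else 0) =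
        (if I = D then of_int (sign p0) else (0::complex))"
      using p0 by (cases "I = D") (simp_all add: finite_permutations del: atLeastAtMost_iff)
  qed
  also have "\<dots> = of_int (sign p0)"
    using D by (simp add: sum.delta)
  finally show ?thesis by (simp add: sign_def)
qed

section \<open>Products of Capelli elements at permutation monomials\<close>

definition capelli_prod :: "nat \<Rightarrow> nat list \<Rightarrow> free_alg" where
  "capelli_prod n ks = prod_list (map (capelli_free n) ks)"

lemma capelli_prod_simps [simp]:
  "capelli_prod n [] = 1" "capelli_prod n (k # ks) = capelli_free n k * capelli_prod n ks"
  by (simp_all add: capelli_prod_def)

lemma capelli_prod_tens_deg: "capelli_prod n ks \<in> tens_deg n (sum_list ks)"
  by (induction ks) (auto intro: tens_deg_mult capelli_free_tens_deg)

lemma distinct_concat_filter: "distinct (concat cs) \<Longrightarrow> distinct (concat (filter Q cs))"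
  by (induction cs) auto

text \<open>A factor has a nonzero coefficient only at a set with equal rows and columns, that is, a
  union of cycles, and this union is nonempty because the degree of the factor is positive. So each
  factor uses up at least one cycle.\<close>

lemma scf_capelli_prod_small:
  assumes "distinct (concat cs)" "length (concat cs) = sum_list ks" "0 \<notin> set ks" "length cs < length ks"
  shows "scf (capelli_prod n ks) (cycs cs) = 0"
  using assms
proof (induction ks arbitrary: cs)
  case (Cons k ks)
  let ?P = "cycs cs"
  have P: "finite ?P" "card ?P = k + sum_list ks" using bal_cycs[OF Cons.prems(1)] Cons.prems(2)
    by (auto simp: bal_def)
  have "scf (capelli_free n k) S * scf (capelli_prod n ks) (?P - S) = 0" if S: "S \<subseteq> ?P" "card S = k" for S
  proof (cases "fst ` S = snd ` S")
    case False
    have "finite S" using S P finite_subset by blast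
    then show ?thesis using scf_capelli_unbalanced[OF _ S(2) False] by simp
  next
    case True
    let ?cs1 = "filter (\<lambda>c. cyc c \<subseteq> S) cs" and ?cs2 = "filter (\<lambda>c. \<not> cyc c \<subseteq> S) cs"
    have sp: "S = cycs ?cs1" "?P - S = cycs ?cs2" using cycs_split[OF Cons.prems(1) S(1) True] .
    have "S \<noteq> {}" using S(2) Cons.prems(3) by auto
    then have "?cs1 \<noteq> []" using sp(1) cycs_Nil by metis
    then have "length ?cs2 < length cs"
      using sum_length_filter_compl[of "\<lambda>c. cyc c \<subseteq> S" cs] by (metis length_greater_0_conv less_add_same_cancel2)
    moreover have "card (?P - S) = sum_list ks" using P S by (simp add: card_Diff_subset finite_subset)
    moreover have "distinct (concat ?cs2)" by (rule distinct_concat_filter[OF Cons.prems(1)])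
    ultimately have "scf (capelli_prod n ks) (cycs ?cs2) = 0"
      using bal_cycs[of ?cs2] sp(2) Cons.prems by (intro Cons.IH) auto
    then show ?thesis using sp(2) by simp
  qed
  then have "(\<Sum>S | S \<subseteq> ?P \<and> card S = k. scf (capelli_free n k) S * scf (capelli_prod n ks) (?P - S)) = 0"
    by (intro sum.neutral) blast
  then show ?case
    by (simp only: capelli_prod_simps scf_mult[OF P capelli_free_tens_deg capelli_prod_tens_deg])
qed simp

lemma Un_Diff_of_image_disjoint: "f ` A \<inter> f ` B = {} \<Longrightarrow> A \<union> B - A = B"
  by blast

text \<open>With as many cycles as factors, every factor takes exactly one cycle, of length equal to
  its degree. \<open>N\<close> counts the possible assignments; being a natural number, it admits no
  cancellation. \<open>\<epsilon> k\<close> is the common coefficient at cycles of length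
  \<open>k\<close>.\<close>

lemma scf_capelli_prod_equal:
  assumes "distinct (concat cs)" "length (concat cs) = sum_list ks" "0 \<notin> set ks" "length cs = length ks"
    and "[] \<notin> set cs" "set (concat cs) \<subseteq> {1..n}"
    and "\<And>k c. k \<in> set ks \<Longrightarrow> distinct c \<Longrightarrow> length c = k \<Longrightarrow> set c \<subseteq> {1..n} \<Longrightarrow>
      scf (capelli_free n k) (cyc c) = \<epsilon> k"
  shows "\<exists>N::nat. scf (capelli_prod n ks) (cycs cs) = prod_list (map \<epsilon> ks) * of_nat N \<and>
    (N > 0 \<longleftrightarrow> mset (map length cs) = mset ks)"
  using assms
proof (induction ks arbitrary: cs)
  case Nil
  then show ?case
    by (intro exI[of _ 1]) (simp add: scf_def one_poly_mapping.transfer flip: wmono_Nil)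
next
  case (Cons k ks)
  let ?P = "cycs cs"
  have P: "finite ?P" "card ?P = k + sum_list ks" using bal_cycs[OF Cons.prems(1)] Cons.prems(2)
    by (auto simp: bal_def)
  define F where "F S = scf (capelli_free n k) S * scf (capelli_prod n ks) (?P - S)" for S
  \<comment> \<open>The cycles that the first factor can take.\<close>
  define C where "C = {c \<in> set cs. length c = k}"
  have finC: "finite C" by (simp add: C_def)
  have c_props: "distinct c" "c \<noteq> []" "set c \<subseteq> {1..n}" if "c \<in> set cs" for c
    using that Cons.prems(1,5,6) by (auto simp: distinct_concat_iff)
  \<comment> \<open>Any other \<open>S\<close> is either unbalanced or consists of at least two
    cycles, and then too few cycles remain for the other factors.\<close>
  have zero: "F S = 0" if S: "S \<subseteq> ?P" "card S = k" "S \<notin> cyc ` C" for S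
  proof (cases "fst ` S = snd ` S")
    case False
    have "finite S" using S P finite_subset by blast
    then show ?thesis unfolding F_def using scf_capelli_unbalanced[OF _ S(2) False] by simp
  next
    case True
    let ?cs1 = "filter (\<lambda>c. cyc c \<subseteq> S) cs" and ?cs2 = "filter (\<lambda>c. \<not> cyc c \<subseteq> S) cs"
    have sp: "S = cycs ?cs1" "?P - S = cycs ?cs2" using cycs_split[OF Cons.prems(1) S(1) True] .
    have ne: "S \<noteq> {}" using S(2) Cons.prems(3) by auto
    have "length ?cs1 \<noteq> 1"
    proof
      assume "length ?cs1 = 1"
      then obtain c where c: "?cs1 = [c]" by (metis One_nat_def length_0_conv length_Suc_conv)
      have "c \<in> set ?cs1" unfolding c by simp
      then have "c \<in> set cs" by simp
      moreover have "S = cyc c" using sp(1) unfolding c by simp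
      ultimately show False using S(2,3) bal_cyc(3)[OF c_props(1)] by (auto simp: C_def)
    qed
    moreover have "?cs1 \<noteq> []" using sp(1) ne cycs_Nil by metis
    then have "length ?cs1 \<noteq> 0" by simp
    ultimately have "length ?cs2 < length ks"
      using sum_length_filter_compl[of "\<lambda>c. cyc c \<subseteq> S" cs] Cons.prems(4)[unfolded list.size] by linarith
    moreover have "card (?P - S) = sum_list ks" using P S by (simp add: card_Diff_subset finite_subset)
    moreover have "distinct (concat ?cs2)" by (rule distinct_concat_filter[OF Cons.prems(1)])
    ultimately have "scf (capelli_prod n ks) (cycs ?cs2) = 0"
      using bal_cycs[of ?cs2] sp(2) Cons.prems(3) by (intro scf_capelli_prod_small) auto
    then show ?thesis unfolding F_def using sp(2) by simp
  qed
  have rem: "mset (map length cs) = add_mset (length c) (mset (map length (remove1 c cs)))"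
    "distinct (concat (c # remove1 c cs))" "cycs cs = cyc c \<union> cycs (remove1 c cs)"
    "set (concat (remove1 c cs)) \<subseteq> set (concat cs)" "[] \<notin> set (remove1 c cs)"
    "length (concat cs) = length c + length (concat (remove1 c cs))"
    if "c \<in> set cs" for c
  proof -
    have m: "mset cs = mset (c # remove1 c cs)" using that by simp
    show "mset (map length cs) = add_mset (length c) (mset (map length (remove1 c cs)))"
      unfolding mset_map m by simp
    have mc: "mset (concat cs) = mset (concat (c # remove1 c cs))"
      unfolding mset_concat by (metis m mset_map sum_mset_sum_list)
    show "distinct (concat (c # remove1 c cs))"
      using Cons.prems(1) mc by (metis mset_eq_imp_distinct_iff)
    show "cycs cs = cyc c \<union> cycs (remove1 c cs)" using cycs_mset[OF m] by simp
    show "set (concat (remove1 c cs)) \<subseteq> set (concat cs)"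
      using mset_eq_setD[OF mc] by simp
    show "[] \<notin> set (remove1 c cs)" using Cons.prems(5) notin_set_remove1 by metis
    show "length (concat cs) = length c + length (concat (remove1 c cs))"
      using mset_eq_length[OF mc] by simp
  qed
  \<comment> \<open>In general \<open>cyc\<close> does not distinguish rotations of a list; here
    distinct members of \<open>cs\<close> are nonempty and disjoint.\<close>
  have inj: "inj_on cyc C"
  proof (rule inj_onI)
    fix c c' assume cc: "c \<in> C" "c' \<in> C" "cyc c = cyc c'"
    have cs: "c \<in> set cs" "c' \<in> set cs" using cc by (auto simp: C_def)
    have "set c = set c'" using bal_cyc(2)[OF c_props(1)] cs cc(3) by metis
    moreover have "set c \<inter> set c' = {}" if "c \<noteq> c'"
    proof -
      have "c' \<in> set (remove1 c cs)" using cs that by simp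
      then show ?thesis using rem(2)[OF cs(1)] by auto
    qed
    ultimately show "c = c'" using c_props(2)[OF cs(1)] by (metis Int_absorb set_empty)
  qed
  have "\<exists>N::nat. F (cyc c) = prod_list (map \<epsilon> (k # ks)) * of_nat N \<and>
     (N > 0 \<longleftrightarrow> mset (map length (remove1 c cs)) = mset ks)" if c: "c \<in> C" for c
  proof -
    have cs: "c \<in> set cs" "length c = k" using c by (auto simp: C_def)
    note r = rem[OF cs(1)]
    have "fst ` cyc c \<inter> fst ` cycs (remove1 c cs) = {}"
      using bal_cyc(2)[of c] bal_cycs[of "remove1 c cs"] r(2) by simp
    then have diff: "?P - cyc c = cycs (remove1 c cs)" unfolding r(3) by (rule Un_Diff_of_image_disjoint)
    have "\<exists>N::nat. scf (capelli_prod n ks) (cycs (remove1 c cs)) = prod_list (map \<epsilon> ks) * of_nat N \<and>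
      (N > 0 \<longleftrightarrow> mset (map length (remove1 c cs)) = mset ks)"
    proof (rule Cons.IH)
      show "distinct (concat (remove1 c cs))" using r(2) by simp
      show "length (concat (remove1 c cs)) = sum_list ks" using r(6) cs(2) Cons.prems(2) by simp
      show "length (remove1 c cs) = length ks" using Cons.prems(4) cs(1) by (simp add: length_remove1)
      show "set (concat (remove1 c cs)) \<subseteq> {1..n}" using r(4) Cons.prems(6) by (rule order_trans)
    qed (use Cons.prems r(5) in simp_all)
    then obtain N :: nat where N: "scf (capelli_prod n ks) (cycs (remove1 c cs)) = prod_list (map \<epsilon> ks) * of_nat N"
      "N > 0 \<longleftrightarrow> mset (map length (remove1 c cs)) = mset ks" by (elim exE conjE)
    have "scf (capelli_free n k) (cyc c) = \<epsilon> k"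
      using Cons.prems(7)[of k c] c_props[OF cs(1)] cs(2) by simp
    then show ?thesis using N by (intro exI[of _ N]) (simp add: F_def diff)
  qed
  then obtain N :: "nat list \<Rightarrow> nat" where N: "\<And>c. c \<in> C \<Longrightarrow> F (cyc c) = prod_list (map \<epsilon> (k # ks)) * of_nat (N c)"
    "\<And>c. c \<in> C \<Longrightarrow> N c > 0 \<longleftrightarrow> mset (map length (remove1 c cs)) = mset ks" by metis
  have sub: "cyc ` C \<subseteq> {S. S \<subseteq> ?P \<and> card S = k}"
    using bal_cyc(3)[OF c_props(1)] by (auto simp: C_def cycs_def)
  have "scf (capelli_prod n (k # ks)) ?P = (\<Sum>S | S \<subseteq> ?P \<and> card S = k. F S)"
    by (simp add: scf_mult[OF P capelli_free_tens_deg capelli_prod_tens_deg] F_def)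
  also have "\<dots> = (\<Sum>S\<in>cyc ` C. F S)"
    using P(1) sub zero by (intro sum.mono_neutral_right) auto
  also have "\<dots> = (\<Sum>c\<in>C. F (cyc c))" by (simp add: sum.reindex[OF inj])
  also have "\<dots> = prod_list (map \<epsilon> (k # ks)) * of_nat (\<Sum>c\<in>C. N c)"
    by (simp add: N(1) sum_distrib_left)
  finally have 1: "scf (capelli_prod n (k # ks)) ?P = \<dots>" .
  have "(\<Sum>c\<in>C. N c) > 0 \<longleftrightarrow> (\<exists>c\<in>C. N c > 0)"
    using finC by (metis gr_zeroI not_gr_zero sum_eq_0_iff)
  also have "\<dots> \<longleftrightarrow> mset (map length cs) = mset (k # ks)"
  proof
    assume "\<exists>c\<in>C. N c > 0"
    then obtain c where c: "c \<in> C" "N c > 0" by (rule bexE)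
    then have "mset (map length (remove1 c cs)) = mset ks" using N(2)[OF c(1)] by simp
    with c show "mset (map length cs) = mset (k # ks)" using rem(1)[of c] by (simp add: C_def)
  next
    assume eq: "mset (map length cs) = mset (k # ks)"
    then have "k \<in> set (map length cs)" by (metis list.set_intros(1) mset_eq_setD)
    then obtain c where c: "c \<in> C" by (auto simp: C_def)
    then have "mset (map length (remove1 c cs)) = mset ks"
      using rem(1)[of c] eq by (simp add: C_def)
    then have "N c > 0" using N(2)[OF c] by simp
    with c show "\<exists>c\<in>C. N c > 0" by (intro bexI)
  qed
  finally show ?case using 1 by (intro exI conjI)
qed

section \<open>Generators of the center\<close>

text \<open>A polynomial in the Capelli elements is represented by its values at all levels at once.\<close>

inductive_set capelli_families :: "nat \<Rightarrow> (nat \<Rightarrow> free_alg) set" for m :: nat where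
  const: "(\<lambda>n. of_complex c) \<in> capelli_families m"
| gen: "k \<in> {1..m} \<Longrightarrow> (\<lambda>n. capelli_free n k) \<in> capelli_families m"
| add: "A \<in> capelli_families m \<Longrightarrow> B \<in> capelli_families m \<Longrightarrow> (\<lambda>n. A n + B n) \<in> capelli_families m"
| mult: "A \<in> capelli_families m \<Longrightarrow> B \<in> capelli_families m \<Longrightarrow> (\<lambda>n. A n * B n) \<in> capelli_families m"

lemma capelli_families_tens: "A \<in> capelli_families m \<Longrightarrow> A n \<in> tens n"
  by (induction rule: capelli_families.induct)
    (auto simp: tens_add tens_mult capelli_free_tens_deg[THEN tens_degD])

lemma capelli_families_prod:
  "set ks \<subseteq> {1..m} \<Longrightarrow> (\<lambda>n. capelli_prod n ks) \<in> capelli_families m"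
proof (induction ks)
  case Nil
  show ?case using capelli_families.const[of 1 m] by simp
next
  case (Cons k ks)
  then have "(\<lambda>n. capelli_free n k) \<in> capelli_families m" "(\<lambda>n. capelli_prod n ks) \<in> capelli_families m"
    by (auto intro: capelli_families.gen)
  from capelli_families.mult[OF this] show ?case by simp
qed

lemma capelli_families_central:
  assumes "A \<in> capelli_families m" "\<And>k. k \<in> {1..m} \<Longrightarrow> central_free n (capelli_free n k)"
  shows "central_free n (A n)"
  using assms(1)
  by (induction rule: capelli_families.induct)
    (auto simp: central_free_of_complex central_free_add central_free_mult assms(2))

section \<open>Elimination of cycle types\<close>

definition vanishes :: "nat \<Rightarrow> free_alg \<Rightarrow> nat multiset \<Rightarrow> bool" where
  "vanishes n b M \<longleftrightarrow> (\<forall>cs. [] \<notin> set cs \<and> distinct (concat cs) \<and> set (concat cs) \<subseteq> {1..n} \<and>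
     mset (map length cs) = M \<longrightarrow> scf b (cycs cs) = 0)"

lemma vanishesD:
  "vanishes n b M \<Longrightarrow> [] \<notin> set cs \<Longrightarrow> distinct (concat cs) \<Longrightarrow> set (concat cs) \<subseteq> {1..n} \<Longrightarrow>
     mset (map length cs) = M \<Longrightarrow> scf b (cycs cs) = 0"
  by (simp add: vanishes_def)

definition part_type :: "nat \<Rightarrow> nat multiset \<Rightarrow> bool" where
  "part_type d M \<longleftrightarrow> \<Sum>\<^sub># M = d \<and> 0 \<notin># M"

lemma size_le_sum_mset: "0 \<notin># M \<Longrightarrow> size M \<le> \<Sum>\<^sub># (M :: nat multiset)"
  by (induction M) auto

lemma mem_le_sum_mset: "k \<in># M \<Longrightarrow> k \<le> \<Sum>\<^sub># (M :: nat multiset)"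
  by (induction M) auto

lemma finite_part_type: "finite {M. part_type d M}"
proof (rule finite_subset)
  show "{M. part_type d M} \<subseteq> mset ` {xs. set xs \<subseteq> {..d} \<and> length xs \<le> d}"
  proof
    fix M assume "M \<in> {M. part_type d M}"
    then have M: "\<Sum>\<^sub># M = d" "0 \<notin># M" by (auto simp: part_type_def)
    obtain xs where xs: "mset xs = M" using ex_mset by blast
    have "set xs \<subseteq> {..d}" using mem_le_sum_mset[of _ M] M(1) xs by auto
    moreover have "length xs \<le> d" using size_le_sum_mset[OF M(2)] M(1) xs by auto
    ultimately show "M \<in> mset ` {xs. set xs \<subseteq> {..d} \<and> length xs \<le> d}" using xs by auto
  qed
  show "finite (mset ` {xs. set xs \<subseteq> {..d} \<and> length xs \<le> d})"
    by (intro finite_imageI finite_lists_length_le) simp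
qed

lemma length_concat_sum_mset: "length (concat cs) = \<Sum>\<^sub># (mset (map length cs))"
  by (induction cs) auto

context
  fixes n d :: nat
  assumes n: "3 * d \<le> n"
    and central: "\<And>k. k \<in> {1..n} \<Longrightarrow> central_free n (capelli_free n k)"
begin

text \<open>Supplies the function \<open>\<epsilon>\<close> of
  \<open>scf_capelli_prod_equal\<close>: \<open>scf_type\<close> compares all cycles of length
  \<open>k\<close> with the reference cycle \<open>[1..<Suc k]\<close>.\<close>

lemma single_cycle:
  assumes "k \<in> {1..d}" "distinct c" "length c = k" "set c \<subseteq> {1..n}"
  shows "scf (capelli_free n k) (cyc c) = scf (capelli_free n k) (cyc [1..<Suc k])"
    and "scf (capelli_free n k) (cyc c) \<noteq> 0"
proof -
  have "scf (capelli_free n k) (cycs [c]) = scf (capelli_free n k) (cycs [[1..<Suc k]])"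
  proof (rule scf_type[OF capelli_free_tens_deg])
    show "central_free n (capelli_free n k)" using assms n by (intro central) auto
    show "set (concat [[1..<Suc k]]) \<subseteq> {1..n}" using assms n by auto
  qed (use assms n in \<open>simp_all del: upt_Suc\<close>)
  then show "scf (capelli_free n k) (cyc c) = scf (capelli_free n k) (cyc [1..<Suc k])"
    by (simp del: upt_Suc)
  have "cyc c \<subseteq> sq n"
    using bal_rename_sq[OF bal_cyc(1)[OF assms(2)], of id n] bal_cyc(2)[OF assms(2)] assms(4)
    by (simp add: map_prod_def)
  then show "scf (capelli_free n k) (cyc c) \<noteq> 0"
    using bal_cyc[OF assms(2)] assms(3) by (intro scf_capelli_balanced) auto
qed

text \<open>Triangularity with respect to the number of cycles. For fewer cycles than factors the
  coefficient is zero by \<open>scf_capelli_prod_small\<close>; for equal numbers it is a product of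
  nonzero signs times a count that is positive for the matching type only.\<close>

lemma scf_capelli_prod_type:
  assumes ks: "mset ks = M" "part_type d M"
    and cs: "[] \<notin> set cs" "distinct (concat cs)" "set (concat cs) \<subseteq> {1..n}" "mset (map length cs) = M'"
    and M': "part_type d M'" "size M' \<le> size M"
  shows "scf (capelli_prod n ks) (cycs cs) \<noteq> 0 \<longleftrightarrow> M' = M"
proof -
  have sum: "sum_list ks = d" "0 \<notin> set ks" "length (concat cs) = d"
    using ks cs(4) M'(1) length_concat_sum_mset[of cs]
    by (auto simp: part_type_def sum_mset_sum_list)
  have kd: "k \<in> {1..d}" if "k \<in> set ks" for k
  proof -
    have "k \<noteq> 0" using that sum(2) by metis
    moreover have "k \<le> d" using member_le_sum_list[OF that] sum(1) by simp
    ultimately show ?thesis by simp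
  qed
  have len: "length cs = size M'" "length ks = size M" using cs(4) ks(1) by auto
  show ?thesis
  proof (cases "length cs < length ks")
    case True
    then show ?thesis using scf_capelli_prod_small[OF cs(2), of ks n] sum len by auto
  next
    case False
    then have "length cs = length ks" using M'(2) len by simp
    let ?e = "\<lambda>k. scf (capelli_free n k) (cyc [1..<Suc k])"
    obtain N :: nat where N: "scf (capelli_prod n ks) (cycs cs) = prod_list (map ?e ks) * of_nat N"
      "N > 0 \<longleftrightarrow> mset (map length cs) = mset ks"
      using scf_capelli_prod_equal[OF cs(2), of ks n ?e] sum \<open>length cs = length ks\<close> cs single_cycle(1)[OF kd]
      by auto
    have "?e k \<noteq> 0" if "k \<in> set ks" for k
      using kd[OF that] n by (intro single_cycle(2)) auto
    then have "prod_list (map ?e ks) \<noteq> 0" by (auto simp: prod_list_zero_iff)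
    then show ?thesis using N ks(1) cs(4) by auto
  qed
qed

text \<open>One scalar works for all permutation monomials of type \<open>M\<close> at once, since
  the coefficients of both central elements depend on the type alone.\<close>

lemma eliminate_type:
  assumes b: "b \<in> tens_deg n d" "central_free n b" and M: "part_type d M"
  obtains ks c where "set ks \<subseteq> {1..n}" "sum_list ks = d" "mset ks = M"
    "vanishes n (b - of_complex c * capelli_prod n ks) M"
proof -
  obtain ks where ks: "mset ks = M" using ex_mset by blast
  have s: "sum_list ks = d" using ks M by (auto simp: part_type_def sum_mset_sum_list)
  have "k \<in> {1..n}" if "k \<in> set ks" for k
    using member_le_sum_list[OF that] s n that ks M by (cases k) (auto simp: part_type_def)
  then have ksn: "set ks \<subseteq> {1..n}" by blast
  show ?thesis
  proof (cases "vanishes n b M")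
    case True
    then show ?thesis using that[of ks 0] ksn s ks by simp
  next
    case False
    then obtain cs where cs: "[] \<notin> set cs" "distinct (concat cs)" "set (concat cs) \<subseteq> {1..n}"
      "mset (map length cs) = M" unfolding vanishes_def by blast
    let ?c = "scf b (cycs cs) / scf (capelli_prod n ks) (cycs cs)"
    have nz: "scf (capelli_prod n ks) (cycs cs) \<noteq> 0"
      using scf_capelli_prod_type[OF ks M cs M] by simp
    have pc: "capelli_prod n ks \<in> tens_deg n d" "central_free n (capelli_prod n ks)"
      using capelli_prod_tens_deg[of n ks] s
        capelli_families_central[OF capelli_families_prod[OF ksn] central] by auto
    have "vanishes n (b - of_complex ?c * capelli_prod n ks) M"
      unfolding vanishes_def
    proof (intro allI impI)
      fix cs' assume cs': "[] \<notin> set cs' \<and> distinct (concat cs') \<and> set (concat cs') \<subseteq> {1..n} \<and>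
        mset (map length cs') = M"
      have "length (concat cs') = d" using cs' M length_concat_sum_mset[of cs'] by (simp add: part_type_def)
      then have eq: "scf a (cycs cs') = scf a (cycs cs)" if "a \<in> tens_deg n d" "central_free n a" for a
        using scf_type[OF that n, of cs' cs] cs cs' by simp
      show "scf (b - of_complex ?c * capelli_prod n ks) (cycs cs') = 0"
        using nz by (simp add: scf_diff scf_of_complex_mult eq[OF b] eq[OF pc])
    qed
    then show ?thesis using that[of ks ?c] ksn s ks by simp
  qed
qed

text \<open>By triangularity, subtracting a multiple of the product for \<open>M\<close> does not
  disturb other types with at most as many parts.\<close>

lemma vanishes_keep:
  assumes "vanishes n b M'" "part_type d M'" "part_type d M" "mset ks = M" "M' \<noteq> M" "size M' \<le> size M"
  shows "vanishes n (b - of_complex c * capelli_prod n ks) M'"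
  unfolding vanishes_def
proof (intro allI impI)
  fix cs assume cs: "[] \<notin> set cs \<and> distinct (concat cs) \<and> set (concat cs) \<subseteq> {1..n} \<and>
    mset (map length cs) = M'"
  then have "scf (capelli_prod n ks) (cycs cs) = 0"
    using scf_capelli_prod_type[OF assms(4,3), of cs M'] assms by auto
  moreover have "scf b (cycs cs) = 0" using vanishesD[OF assms(1)] cs by blast
  ultimately show "scf (b - of_complex c * capelli_prod n ks) (cycs cs) = 0"
    by (simp add: scf_diff scf_of_complex_mult)
qed

text \<open>Types are treated by increasing number of parts, and those with the same number of parts
  in any order; \<open>vanishes_keep\<close> protects what has been achieved.\<close>

lemma eliminate_all:
  assumes a: "a \<in> tens_deg n d" "central_free n a" and d: "d \<ge> 1"
  shows "\<exists>Q\<in>capelli_families n. Q n \<in> tens_deg n d \<and>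
    (\<forall>M. part_type d M \<and> size M \<le> l \<longrightarrow> vanishes n (a - Q n) M)"
proof (induction l)
  case 0
  \<comment> \<open>Only the empty partition has no parts, and its sum is not
    \<open>d\<close>.\<close>
  have "\<not> (part_type d M \<and> size M \<le> 0)" for M using d by (auto simp: part_type_def)
  then show ?case using capelli_families.const[of 0 n] by (intro bexI[of _ "\<lambda>n. of_complex 0"]) auto
next
  case (Suc l)
  have "\<exists>Q\<in>capelli_families n. Q n \<in> tens_deg n d \<and>
    (\<forall>M. part_type d M \<and> size M \<le> l \<longrightarrow> vanishes n (a - Q n) M) \<and> (\<forall>M\<in>X. vanishes n (a - Q n) M)"
    if "finite X" "X \<subseteq> {M. part_type d M \<and> size M = Suc l}" for X
    using that
  proof (induction X rule: finite_induct)
    case empty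
    then show ?case using Suc.IH by simp
  next
    case (insert M X)
    then obtain Q where Q: "Q \<in> capelli_families n" "Q n \<in> tens_deg n d"
      "\<And>M. part_type d M \<Longrightarrow> size M \<le> l \<Longrightarrow> vanishes n (a - Q n) M"
      "\<And>M. M \<in> X \<Longrightarrow> vanishes n (a - Q n) M" by auto
    have M: "part_type d M" "size M = Suc l" using insert.prems by auto
    have b: "a - Q n \<in> tens_deg n d" "central_free n (a - Q n)"
      using a Q capelli_families_central[OF Q(1) central]
      by (auto intro: tens_deg_diff central_free_diff)
    obtain ks c where ks: "set ks \<subseteq> {1..n}" "sum_list ks = d" "mset ks = M"
      "vanishes n (a - Q n - of_complex c * capelli_prod n ks) M"
      using eliminate_type[OF b M(1)] by blast
    define Q' where "Q' = (\<lambda>n. Q n + of_complex c * capelli_prod n ks)"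
    have "Q' \<in> capelli_families n" unfolding Q'_def
      by (intro capelli_families.add capelli_families.mult capelli_families.const capelli_families_prod Q(1) ks(1))
    moreover have "Q' n \<in> tens_deg n d" unfolding Q'_def
      using tens_deg_mult[OF of_complex_in_tens_deg[of c n 0] capelli_prod_tens_deg[of n ks]] Q(2) ks(2)
      by (intro tens_deg_add) simp_all
    moreover have eq: "a - Q' n = a - Q n - of_complex c * capelli_prod n ks" by (simp add: Q'_def)
    moreover have "vanishes n (a - Q' n) M'"
      if "part_type d M'" "size M' \<le> l" for M'
      unfolding eq using that M by (intro vanishes_keep[OF Q(3) _ M(1) ks(3)]) auto
    moreover have "vanishes n (a - Q' n) M'" if "M' \<in> insert M X" for M'
    proof (cases "M' = M")
      case True
      show ?thesis unfolding eq True by (rule ks(4))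
    next
      case False
      then have M': "M' \<in> X" using that by simp
      then have "part_type d M'" "size M' = Suc l" using insert.prems by auto
      then show ?thesis unfolding eq using False M by (intro vanishes_keep[OF Q(4)[OF M'] _ M(1) ks(3)]) auto
    qed
    ultimately show ?case by blast
  qed
  from this[of "{M. part_type d M \<and> size M = Suc l}"]
  obtain Q where Q: "Q \<in> capelli_families n" "Q n \<in> tens_deg n d"
    "\<And>M. part_type d M \<Longrightarrow> size M \<le> l \<Longrightarrow> vanishes n (a - Q n) M"
    "\<And>M. part_type d M \<Longrightarrow> size M = Suc l \<Longrightarrow> vanishes n (a - Q n) M"
    using finite_part_type[of d] by auto
  then show ?case by (intro bexI[of _ Q]) (auto simp: le_Suc_eq)
qed

text \<open>Once the coefficients of all cycle types vanish, \<open>symb_zero_of_scf_zero\<close>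
  gives a vanishing symbol and \<open>low_of_symb_zero\<close> a representative of smaller
  degree.\<close>

lemma reduce_degree:
  assumes a: "a \<in> tens_deg n d" "central_free n a" and d: "d = Suc e"
  obtains Q where "Q \<in> capelli_families n" "low n e (a - Q n)"
proof -
  obtain Q where Q: "Q \<in> capelli_families n" "Q n \<in> tens_deg n d"
    "\<And>M. part_type d M \<Longrightarrow> size M \<le> d \<Longrightarrow> vanishes n (a - Q n) M"
    using eliminate_all[OF a, of d] d by auto
  have b: "a - Q n \<in> tens_deg n d" "central_free n (a - Q n)"
    using a Q capelli_families_central[OF Q(1) central]
    by (auto intro: tens_deg_diff central_free_diff)
  have zero: "scf (a - Q n) P = 0" if P: "bal P" "P \<subseteq> sq n" "card P = d" for P
  proof -
    obtain cs where cs: "[] \<notin> set cs" "distinct (concat cs)" "set (concat cs) = fst ` P" "P = cycs cs"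
      using bal_imp_cycs[OF P(1)] .
    have len: "length (concat cs) = d" using bal_cycs[OF cs(2)] cs(4) P(3) by simp
    have t: "part_type d (mset (map length cs))"
      unfolding part_type_def length_concat_sum_mset[symmetric] using cs(1) len by auto
    have "size (mset (map length cs)) \<le> d"
      using size_le_sum_mset[of "mset (map length cs)"] t unfolding part_type_def by simp
    moreover have "set (concat cs) \<subseteq> {1..n}" unfolding cs(3) using P(2) by auto
    ultimately show ?thesis using vanishesD[OF Q(3)[OF t] cs(1,2)] cs(4) by simp
  qed
  have "symb (a - Q n) {..<Suc e} w = 0" for w
    by (rule symb_zero_of_scf_zero[of _ n]) (use n d b zero in auto)
  then have "low n e (a - Q n)"
    using b d by (intro low_of_symb_zero) simp_all
  then show ?thesis using that Q(1) by blast
qed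

end

theorem center_generated:
  assumes "3 * d \<le> n" "\<And>k. k \<in> {1..n} \<Longrightarrow> central_free n (capelli_free n k)"
    and "a \<in> tens_deg n d" "central_free n a"
  shows "\<exists>Q\<in>capelli_families n. a - Q n \<in> relI n"
  using assms(1,3,4)
proof (induction d arbitrary: a)
  case 0
  \<comment> \<open>Degree 0 leaves only the empty word, which is the \<open>0\<close> of the
    additive monoid of words.\<close>
  have "a = of_complex (Poly_Mapping.lookup a 0)"
  proof (rule poly_mapping_eqI)
    fix w
    show "Poly_Mapping.lookup a w = Poly_Mapping.lookup (of_complex (Poly_Mapping.lookup a 0)) w"
    proof (cases "w \<in> Poly_Mapping.keys a")
      case True
      then have "letters w = []" using 0 unfolding tens_deg_def by auto
      then have "w = 0" by (cases w) (simp add: zero_word_def)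
      then show ?thesis by (simp add: of_complex_def)
    next
      case False
      then show ?thesis by (auto simp: of_complex_def lookup_single when_def in_keys_iff)
    qed
  qed
  then have "a - of_complex (Poly_Mapping.lookup a 0) \<in> relI n" by simp
  then show ?case by (rule bexI[OF _ capelli_families.const])
next
  case (Suc d)
  obtain Q where Q: "Q \<in> capelli_families n" "low n d (a - Q n)"
    using reduce_degree[OF Suc.prems(1) assms(2) Suc.prems(2,3) refl] .
  then obtain b where b: "b \<in> tens_deg n d" "a - Q n - b \<in> relI n" by (auto simp: low_def)
  \<comment> \<open>The remainder \<open>b\<close> is a central element minus an element of the
    ideal, which keeps it central modulo the relations.\<close>
  have "central_free n (a - Q n - (a - Q n - b))"
    using assms(2)
    by (intro central_free_diff Suc.prems(3) capelli_families_central[OF Q(1)] central_free_relI[OF b(2)])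
  moreover have "a - Q n - (a - Q n - b) = b" by simp
  ultimately have "central_free n b" by (simp only:)
  then obtain R where R: "R \<in> capelli_families n" "b - R n \<in> relI n"
    using Suc.IH[OF _ b(1)] Suc.prems(1) by auto
  have "(a - Q n - b) + (b - R n) \<in> relI n" by (rule relI_add[OF b(2) R(2)])
  then show ?case
    by (intro bexI[OF _ capelli_families.add[OF Q(1) R(1)]]) (simp add: algebra_simps)
qed

section \<open>Column determinants\<close>

text \<open>A permutation and its composite with the transposition have opposite signs and equal
  values of \<open>f\<close>, so they cancel in pairs.\<close>

lemma sum_sign_swap_zero:
  fixes f :: "('a \<Rightarrow> 'a) \<Rightarrow> 'b::ring_1"
  assumes S: "finite S" "p \<in> S" "q \<in> S" "p \<noteq> q"
    and f: "\<And>\<sigma>. \<sigma> permutes S \<Longrightarrow> f (transpose p q \<circ> \<sigma>) = f \<sigma>"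
  shows "(\<Sum>\<sigma> | \<sigma> permutes S. of_int (sign \<sigma>) * f \<sigma>) = 0"
proof -
  let ?t = "transpose p q"
  let ?P = "{\<sigma>. \<sigma> permutes S}"
  have fin: "finite ?P" by (rule finite_permutations[OF S(1)])
  have t: "?t permutes S" using S by (simp add: permutes_swap_id)
  have tt: "?t \<circ> \<sigma> \<in> ?P" if "\<sigma> \<in> ?P" for \<sigma> using that t by (simp add: permutes_compose)
  have ev: "evenperm (?t \<circ> \<sigma>) \<longleftrightarrow> \<not> evenperm \<sigma>" if "\<sigma> \<in> ?P" for \<sigma>
  proof -
    have "permutation \<sigma>" "permutation ?t" using that S(1) t permutation_permutes by blast+
    then show ?thesis using S(4) by (simp add: evenperm_comp evenperm_swap)
  qed
  have inv: "?t \<circ> (?t \<circ> \<sigma>) = \<sigma>" for \<sigma> by (simp add: comp_assoc[symmetric])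
  have "(\<Sum>\<sigma>\<in>{\<sigma>\<in>?P. \<not> evenperm \<sigma>}. f \<sigma>) = (\<Sum>\<sigma>\<in>{\<sigma>\<in>?P. evenperm \<sigma>}. f \<sigma>)"
    by (rule sum.reindex_bij_witness[where i = "(\<circ>) ?t" and j = "(\<circ>) ?t"])
      (use tt ev inv f in auto)
  moreover have "(\<Sum>\<sigma>\<in>?P. of_int (sign \<sigma>) * f \<sigma>) =
      (\<Sum>\<sigma>\<in>{\<sigma>\<in>?P. evenperm \<sigma>}. f \<sigma>) - (\<Sum>\<sigma>\<in>{\<sigma>\<in>?P. \<not> evenperm \<sigma>}. f \<sigma>)"
  proof -
    have "(\<Sum>\<sigma>\<in>?P. of_int (sign \<sigma>) * f \<sigma>) = (\<Sum>\<sigma>\<in>?P. if evenperm \<sigma> then f \<sigma> else - f \<sigma>)"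
      by (intro sum.cong refl) (simp add: sign_def)
    also have "\<dots> = (\<Sum>\<sigma>\<in>?P \<inter> {\<sigma>. evenperm \<sigma>}. f \<sigma>) + (\<Sum>\<sigma>\<in>?P \<inter> - {\<sigma>. evenperm \<sigma>}. - f \<sigma>)"
      by (rule sum.If_cases[OF fin])
    finally show ?thesis by (simp add: sum_negf Int_def)
  qed
  ultimately show ?thesis by simp
qed

text \<open>The test \<open>p = q\<close> compares the index labels, while the shift depends only on
  the position \<open>b\<close> of the column. In this form rows and columns may be relabelled or
  repeated without losing the exchange relations.\<close>

definition col_entry :: "nat \<Rightarrow> nat \<Rightarrow> nat \<Rightarrow> nat \<Rightarrow> free_alg" where
  "col_entry k p q b = letter p q + (if p = q then of_nat (k - b) else 0)"

definition col_det :: "nat \<Rightarrow> (nat \<Rightarrow> nat) \<Rightarrow> (nat \<Rightarrow> nat) \<Rightarrow> free_alg" where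
  "col_det k r c = (\<Sum>\<sigma> | \<sigma> permutes {1..k}. of_int (sign \<sigma>) * (\<Prod>b\<leftarrow>[1..<Suc k]. col_entry k (r (\<sigma> b)) (c b) b))"

lemma set_upt_Suc: "set [1..<Suc k] = {1..k}"
  by (simp only: set_upt atLeastLessThanSuc_atLeastAtMost)

lemma capelli_free_top: "capelli_free n n = col_det n (\<lambda>a. a) (\<lambda>a. a)"
proof -
  have I: "{I. I \<subseteq> {1..n} \<and> card I = n} = {{1..n}}"
    using card_subset_eq[of "{1..n}"] by auto
  have e: "enum {1..n} a = a" if "a \<in> {1..n}" for a
  proof -
    have "sorted_list_of_set {1..n} = [1..<Suc n]"
      by (metis atLeastLessThanSuc_atLeastAtMost sorted_list_of_set_range)
    then show ?thesis using that by (simp add: enum_def nth_append del: upt_Suc)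
  qed
  have "capelli_free n n = cdet n (\<lambda>a b. letter (enum {1..n} a) (enum {1..n} b) + (if a = b then of_nat (n - a) else 0))"
    unfolding capelli_free_def I by simp
  also have "\<dots> = col_det n (\<lambda>a. a) (\<lambda>a. a)"
    unfolding cdet_def col_det_def
  proof (intro sum.cong refl arg_cong2[where f="(*)"] arg_cong[where f=prod_list] map_cong)
    fix \<sigma> b assume "\<sigma> \<in> {\<sigma>. \<sigma> permutes {1..n}}" "b \<in> set [1..<Suc n]"
    then have "b \<in> {1..n}" "\<sigma> b \<in> {1..n}" unfolding set_upt_Suc by (simp_all only: mem_Collect_eq permutes_in_image)
    then show "letter (enum {1..n} (\<sigma> b)) (enum {1..n} b) + (if \<sigma> b = b then of_nat (n - \<sigma> b) else 0) =
      col_entry n (\<sigma> b) b b" by (simp only: e col_entry_def cong: if_cong)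
  qed
  finally show ?thesis .
qed

text \<open>The factors stay in column order and only row labels are permuted, so the cancellation
  is exact and needs no commutation.\<close>

lemma col_det_row_repeat:
  assumes "p \<in> {1..k}" "q \<in> {1..k}" "p \<noteq> q" "r p = r q"
  shows "col_det k r c = 0"
  unfolding col_det_def
proof (rule sum_sign_swap_zero[OF _ assms(1-3)])
  fix \<sigma> :: "nat \<Rightarrow> nat"
  have "r (transpose p q x) = r x" for x using assms(4) by (simp add: transpose_def)
  then show "(\<Prod>b\<leftarrow>[1..<Suc k]. col_entry k (r ((transpose p q \<circ> \<sigma>) b)) (c b) b) =
    (\<Prod>b\<leftarrow>[1..<Suc k]. col_entry k (r (\<sigma> b)) (c b) b)" by (simp only: o_apply)
qed simp

text \<open>The shifts of adjacent columns differ by one, and this difference compensates the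
  commutators of the letters: the expression is the sum of two defining relations.\<close>

lemma col_entry_exchange:
  assumes "p \<in> {1..n}" "q \<in> {1..n}" "x \<in> {1..n}" "y \<in> {1..n}" "b < k"
  shows "col_entry k p x b * col_entry k q y (Suc b) - col_entry k q x b * col_entry k p y (Suc b)
     + (col_entry k p y b * col_entry k q x (Suc b) - col_entry k q y b * col_entry k p x (Suc b)) \<in> relI n"
proof -
  obtain u where u: "k - b = Suc u" "k - Suc b = u" using assms(5) by (metis Suc_diff_Suc)
  let ?R1 = "letter p x * letter q y - letter q y * letter p x -
     ((if x = q then letter p y else 0) - (if y = p then letter q x else 0))"
  let ?R2 = "letter p y * letter q x - letter q x * letter p y -
     ((if y = q then letter p x else 0) - (if x = p then letter q y else 0))"
  have "?R1 + ?R2 \<in> relI n"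
    by (intro relI_add relI_relation assms)
  also have "?R1 + ?R2 = col_entry k p x b * col_entry k q y (Suc b) - col_entry k q x b * col_entry k p y (Suc b)
     + (col_entry k p y b * col_entry k q x (Suc b) - col_entry k q y b * col_entry k p x (Suc b))"
  proof -
    have comm: "of_nat u * letter a b = letter a b * of_nat u" for a b
      using of_complex_commute[of "of_nat u" "letter a b"] by (simp add: of_complex_of_nat)
    show ?thesis unfolding col_entry_def u
      by (cases "p = x"; cases "q = y"; cases "q = x"; cases "p = y") (simp_all add: algebra_simps comm)
  qed
  finally show ?thesis .
qed

lemma relI_half: "a + a \<in> relI n \<Longrightarrow> a \<in> relI n"
proof -
  assume "a + a \<in> relI n"
  then have "of_complex (1 / 2) * (a + a) \<in> relI n" by (rule relI_mult_left)
  moreover have "of_complex (1 / 2) * (a + a) = of_complex (1 / 2 + 1 / 2) * a"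
    unfolding of_complex_add by (simp add: algebra_simps)
  ultimately show ?thesis by simp
qed

text \<open>Composing the permutation with the transposition of the adjacent columns reverses its
  sign. Hence twice the sum is a signed sum of exchange relations
  \<open>X \<sigma> - X (\<sigma> \<circ> ?t)\<close>, each standing between a prefix and a suffix
  of unchanged factors.\<close>

lemma col_det_swap:
  assumes b: "1 \<le> b" "b < k" and r: "r ` {1..k} \<subseteq> {1..n}" and c: "c ` {1..k} \<subseteq> {1..n}"
  shows "col_det k r c + col_det k r (c \<circ> transpose b (Suc b)) \<in> relI n"
proof -
  let ?t = "transpose b (Suc b)"
  let ?P = "{\<sigma>. \<sigma> permutes {1..k}}"
  define T where "T \<sigma> c = (\<Prod>b\<leftarrow>[1..<Suc k]. col_entry k (r (\<sigma> b)) (c b) b)" for \<sigma> c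
  define X where "X \<sigma> = T \<sigma> c + T \<sigma> (c \<circ> ?t)" for \<sigma>
  have t: "?t permutes {1..k}" using b by (simp add: permutes_swap_id)
  have split: "[1..<Suc k] = [1..<b] @ b # Suc b # [Suc (Suc b)..<Suc k]"
    using b by (metis (no_types, opaque_lifting) Suc_leI Suc_le_eq Suc_lessD le_SucI le_add_diff_inverse less_Suc_eq_le upt_add_eq_append upt_conv_Cons)
  have X: "X \<sigma> - X (\<sigma> \<circ> ?t) \<in> relI n" if \<sigma>: "\<sigma> \<in> ?P" for \<sigma>
  proof -
    let ?pre = "\<Prod>b\<leftarrow>[1..<b]. col_entry k (r (\<sigma> b)) (c b) b"
    let ?suf = "\<Prod>b\<leftarrow>[Suc (Suc b)..<Suc k]. col_entry k (r (\<sigma> b)) (c b) b"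
    let ?p = "r (\<sigma> b)" and ?q = "r (\<sigma> (Suc b))" and ?x = "c b" and ?y = "c (Suc b)"
    have pre: "(\<Prod>b\<leftarrow>[1..<b]. col_entry k (r (\<sigma>' b)) (c' b) b) = ?pre"
      and suf: "(\<Prod>b\<leftarrow>[Suc (Suc b)..<Suc k]. col_entry k (r (\<sigma>' b)) (c' b) b) = ?suf"
      if "\<sigma>' \<in> {\<sigma>, \<sigma> \<circ> ?t}" "c' \<in> {c, c \<circ> ?t}" for \<sigma>' c'
      using that by (auto intro!: arg_cong[where f=prod_list] map_cong simp: transpose_def simp del: upt_Suc)
    have T: "T \<sigma>' c' = ?pre * (col_entry k (r (\<sigma>' b)) (c' b) b * col_entry k (r (\<sigma>' (Suc b))) (c' (Suc b)) (Suc b)) * ?suf"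
      if "\<sigma>' \<in> {\<sigma>, \<sigma> \<circ> ?t}" "c' \<in> {c, c \<circ> ?t}" for \<sigma>' c'
      unfolding T_def split map_append list.map prod_list.append prod_list.Cons pre[OF that] suf[OF that]
      by (simp only: mult.assoc)
    have "X \<sigma> - X (\<sigma> \<circ> ?t) = ?pre * (col_entry k ?p ?x b * col_entry k ?q ?y (Suc b) - col_entry k ?q ?x b * col_entry k ?p ?y (Suc b)
     + (col_entry k ?p ?y b * col_entry k ?q ?x (Suc b) - col_entry k ?q ?y b * col_entry k ?p ?x (Suc b))) * ?suf"
      unfolding X_def using T[of \<sigma> c] T[of "\<sigma> \<circ> ?t" c] T[of \<sigma> "c \<circ> ?t"] T[of "\<sigma> \<circ> ?t" "c \<circ> ?t"]
      by (simp add: algebra_simps)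
    moreover have "\<dots> \<in> relI n"
    proof -
      have in_k: "b \<in> {1..k}" "Suc b \<in> {1..k}" using b by auto
      moreover from in_k have "\<sigma> b \<in> {1..k}" "\<sigma> (Suc b) \<in> {1..k}"
        using \<sigma> by (simp_all only: mem_Collect_eq permutes_in_image)
      ultimately have "?p \<in> {1..n}" "?q \<in> {1..n}" "?x \<in> {1..n}" "?y \<in> {1..n}"
        by (simp_all only: subsetD[OF r imageI] subsetD[OF c imageI])
      then show ?thesis
        by (intro relI_mult_right[OF relI_mult_left[OF col_entry_exchange]] b(2))
    qed
    ultimately show ?thesis by simp
  qed
  have sum: "col_det k r c + col_det k r (c \<circ> ?t) = (\<Sum>\<sigma>\<in>?P. of_int (sign \<sigma>) * X \<sigma>)"
    unfolding col_det_def X_def T_def by (simp only: distrib_left sum.distrib)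
  have "(\<Sum>\<sigma>\<in>?P. of_int (sign \<sigma>) * X \<sigma>) = (\<Sum>\<sigma>\<in>?P. of_int (sign (\<sigma> \<circ> ?t)) * X (\<sigma> \<circ> ?t))"
    by (rule sum_permutations_compose_right[OF t])
  also have "\<dots> = - (\<Sum>\<sigma>\<in>?P. of_int (sign \<sigma>) * X (\<sigma> \<circ> ?t))"
    unfolding sum_negf[symmetric]
  proof (intro sum.cong refl)
    fix \<sigma> assume "\<sigma> \<in> ?P"
    then have "permutation \<sigma>" "permutation ?t"
      using t unfolding permutation_permutes by (auto intro: exI[of _ "{1..k}"] simp del: atLeastAtMost_iff)
    then have "sign (\<sigma> \<circ> ?t) = - sign \<sigma>" by (simp add: sign_compose sign_swap_id)
    then show "of_int (sign (\<sigma> \<circ> ?t)) * X (\<sigma> \<circ> ?t) = - (of_int (sign \<sigma>) * X (\<sigma> \<circ> ?t))" by simp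
  qed
  finally have neg: "(\<Sum>\<sigma>\<in>?P. of_int (sign \<sigma>) * X \<sigma>) = \<dots>" .
  have "(\<Sum>\<sigma>\<in>?P. of_int (sign \<sigma>) * X \<sigma>) + (\<Sum>\<sigma>\<in>?P. of_int (sign \<sigma>) * X \<sigma>) =
      (\<Sum>\<sigma>\<in>?P. of_int (sign \<sigma>) * (X \<sigma> - X (\<sigma> \<circ> ?t)))"
    by (subst (2) neg) (simp only: right_diff_distrib sum_subtractf add_uminus_conv_diff)
  also have "\<dots> \<in> relI n" by (intro relI_sum relI_mult_left X)
  finally show ?thesis unfolding sum by (rule relI_half)
qed

text \<open>The column \<open>q\<close> is moved to the left by adjacent exchanges until it stands
  next to \<open>p\<close>. Exchanging two equal neighbours then puts twice the determinant into the
  ideal.\<close>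

lemma col_det_col_repeat:
  assumes "p \<in> {1..k}" "q \<in> {1..k}" "p < q" "c p = c q"
    and r: "r ` {1..k} \<subseteq> {1..n}" and c: "c ` {1..k} \<subseteq> {1..n}"
  shows "col_det k r c \<in> relI n"
  using assms(2-4) c
proof (induction "q - p" arbitrary: q c rule: less_induct)
  case less
  obtain b where b: "q = Suc b" using less.prems(2) by (cases q) auto
  have bk: "1 \<le> b" "b < k" using less.prems b assms(1) by auto
  let ?c = "c \<circ> transpose b (Suc b)"
  note sw = col_det_swap[OF bk r less.prems(4)]
  show ?case
  proof (cases "b = p")
    case True
    then have "?c = c" using less.prems(3) b by (auto simp: fun_eq_iff transpose_def)
    then show ?thesis using sw by (intro relI_half[of "col_det k r c"]) simp
  next
    case False
    then have pb: "p < b" using less.prems(2) b by simp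
    have "?c ` {1..k} \<subseteq> c ` {1..k}" using bk by (auto simp: transpose_def)
    then have "col_det k r ?c \<in> relI n"
      using pb b bk less.prems by (intro less.hyps[of b]) (auto simp: transpose_def)
    from relI_diff[OF sw this] show ?thesis by simp
  qed
qed

lemma prod_list_zero_mem: "0 \<in> set xs \<Longrightarrow> prod_list xs = (0 :: 'a :: semiring_1)"
  by (induction xs) auto

text \<open>Leibniz rule modulo the relations. The parts \<open>B\<close> and \<open>C\<close> are
  kept apart because they will stand for a changed row and a changed column.\<close>

lemma derivation_prod_list:
  assumes "distinct xs" "\<And>x. x \<in> set xs \<Longrightarrow> e * A x - A x * e - (B x - C x) \<in> relI n"
  shows "e * prod_list (map A xs) - prod_list (map A xs) * e -
    ((\<Sum>y\<in>set xs. prod_list (map (A(y := B y)) xs)) - (\<Sum>y\<in>set xs. prod_list (map (A(y := C y)) xs))) \<in> relI n"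
  using assms
proof (induction xs)
  case (Cons x xs)
  let ?R = "prod_list (map A xs)"
  have out: "map (A(x := z)) xs = map A xs" for z using Cons.prems(1) by (auto intro: map_cong)
  have S: "(\<Sum>y\<in>set (x # xs). prod_list (map (A(y := D y)) (x # xs))) =
      D x * ?R + A x * (\<Sum>y\<in>set xs. prod_list (map (A(y := D y)) xs))" for D
  proof -
    have "(\<Sum>y\<in>set (x # xs). prod_list (map (A(y := D y)) (x # xs))) =
       prod_list (map (A(x := D x)) (x # xs)) + (\<Sum>y\<in>set xs. prod_list (map (A(y := D y)) (x # xs)))"
      using Cons.prems(1) by simp
    also have "(\<Sum>y\<in>set xs. prod_list (map (A(y := D y)) (x # xs))) =
        (\<Sum>y\<in>set xs. A x * prod_list (map (A(y := D y)) xs))"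
      using Cons.prems(1) by (intro sum.cong refl) auto
    also have "prod_list (map (A(x := D x)) (x # xs)) = D x * ?R"
      by (simp only: list.map fun_upd_same out prod_list.Cons)
    finally show ?thesis unfolding sum_distrib_left .
  qed
  have "(e * A x - A x * e - (B x - C x)) * ?R + A x * (e * ?R - ?R * e -
    ((\<Sum>y\<in>set xs. prod_list (map (A(y := B y)) xs)) - (\<Sum>y\<in>set xs. prod_list (map (A(y := C y)) xs)))) \<in> relI n"
  proof (rule relI_add[OF relI_mult_right relI_mult_left])
    show "e * ?R - ?R * e - ((\<Sum>y\<in>set xs. prod_list (map (A(y := B y)) xs)) -
      (\<Sum>y\<in>set xs. prod_list (map (A(y := C y)) xs))) \<in> relI n"
      by (rule Cons.IH) (use Cons.prems in simp_all)
  qed (use Cons.prems in simp)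
  moreover have "(e * a - a * e - (b - c)) * R + a * (e * R - R * e - (sb - sc)) =
      e * (a * R) - a * R * e - ((b * R + a * sb) - (c * R + a * sc))" for a b c R sb sc :: free_alg
    by (simp add: algebra_simps)
  ultimately show ?case unfolding S unfolding list.map prod_list.Cons by (simp only:)
qed simp

text \<open>The scalar shifts are central on the left. On the right they occur only if both
  \<open>p = j\<close> and \<open>q = i\<close>, and then they cancel, so the relation for letters
  carries over to entries.\<close>

lemma col_entry_commutator:
  assumes "i \<in> {1..n}" "j \<in> {1..n}" "p \<in> {1..n}" "q \<in> {1..n}"
  shows "letter i j * col_entry k p q b - col_entry k p q b * letter i j -
    ((if p = j then col_entry k i q b else 0) - (if q = i then col_entry k p j b else 0)) \<in> relI n"
proof -
  have comm: "of_nat u * letter a b = letter a b * of_nat u" for a b u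
    using of_complex_commute[of "of_nat u" "letter a b"] by (simp add: of_complex_of_nat)
  have "letter i j * col_entry k p q b - col_entry k p q b * letter i j -
    ((if p = j then col_entry k i q b else 0) - (if q = i then col_entry k p j b else 0)) =
    letter i j * letter p q - letter p q * letter i j - ((if j = p then letter i q else 0) - (if q = i then letter p j else 0))"
    unfolding col_entry_def
    by (cases "p = q"; cases "p = j"; cases "q = i") (simp_all add: algebra_simps comm)
  then show ?thesis using relI_relation[OF assms] by simp
qed

lemma col_det_commutator:
  assumes ij: "i \<in> {1..n}" "j \<in> {1..n}" and r: "r ` {1..k} \<subseteq> {1..n}" and c: "c ` {1..k} \<subseteq> {1..n}"
  shows "letter i j * col_det k r c - col_det k r c * letter i j -
    ((\<Sum>a\<in>{1..k}. if r a = j then col_det k (r(a := i)) c else 0) -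
     (\<Sum>b\<in>{1..k}. if c b = i then col_det k r (c(b := j)) else 0)) \<in> relI n"
proof -
  let ?P = "{\<sigma>. \<sigma> permutes {1..k}}"
  define T where "T \<sigma> r c = (\<Prod>b\<leftarrow>[1..<Suc k]. col_entry k (r (\<sigma> b)) (c b) b)" for \<sigma> r c :: "nat \<Rightarrow> nat"
  have cd: "col_det k r c = (\<Sum>\<sigma>\<in>?P. of_int (sign \<sigma>) * T \<sigma> r c)" for r c
    by (simp only: col_det_def T_def)
  have sgn: "a * (of_int (sign \<sigma>) * b) = of_int (sign \<sigma>) * (a * b)" for a b :: free_alg and \<sigma> :: "nat \<Rightarrow> nat"
    by (simp add: sign_def)
  have main: "letter i j * T \<sigma> r c - T \<sigma> r c * letter i j -
     ((\<Sum>a\<in>{1..k}. if r a = j then T \<sigma> (r(a := i)) c else 0) -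
      (\<Sum>b\<in>{1..k}. if c b = i then T \<sigma> r (c(b := j)) else 0)) \<in> relI n" if \<sigma>: "\<sigma> \<in> ?P" for \<sigma>
  proof -
    have s: "\<sigma> permutes {1..k}" using \<sigma> by simp
    let ?A = "\<lambda>b. col_entry k (r (\<sigma> b)) (c b) b"
    let ?B = "\<lambda>b. if r (\<sigma> b) = j then col_entry k i (c b) b else 0"
    let ?C = "\<lambda>b. if c b = i then col_entry k (r (\<sigma> b)) j b else 0"
    have "letter i j * prod_list (map ?A [1..<Suc k]) - prod_list (map ?A [1..<Suc k]) * letter i j -
      ((\<Sum>y\<in>set [1..<Suc k]. prod_list (map (?A(y := ?B y)) [1..<Suc k])) -
       (\<Sum>y\<in>set [1..<Suc k]. prod_list (map (?A(y := ?C y)) [1..<Suc k]))) \<in> relI n"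
    proof (rule derivation_prod_list)
      fix b assume "b \<in> set [1..<Suc k]"
      then have b: "b \<in> {1..k}" unfolding set_upt_Suc .
      then have "\<sigma> b \<in> {1..k}" using s by (simp only: permutes_in_image)
      then have "r (\<sigma> b) \<in> {1..n}" "c b \<in> {1..n}" using b r c by blast+
      then show "letter i j * ?A b - ?A b * letter i j - (?B b - ?C b) \<in> relI n"
        by (rule col_entry_commutator[OF ij])
    qed simp
    moreover have "(\<Sum>y\<in>set [1..<Suc k]. prod_list (map (?A(y := ?B y)) [1..<Suc k])) =
        (\<Sum>a\<in>{1..k}. if r a = j then T \<sigma> (r(a := i)) c else 0)"
    proof -
      have "(\<Sum>y\<in>{1..k}. prod_list (map (?A(y := ?B y)) [1..<Suc k])) =
          (\<Sum>y\<in>{1..k}. if r (\<sigma> y) = j then T \<sigma> (r(\<sigma> y := i)) c else 0)"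
      proof (intro sum.cong refl)
        fix y assume y: "y \<in> {1..k}"
        show "prod_list (map (?A(y := ?B y)) [1..<Suc k]) = (if r (\<sigma> y) = j then T \<sigma> (r(\<sigma> y := i)) c else 0)"
        proof (cases "r (\<sigma> y) = j")
          case True
          have "\<sigma> b = \<sigma> y \<longleftrightarrow> b = y" for b using permutes_inj[OF s] by (auto dest: injD)
          then have "map (?A(y := ?B y)) [1..<Suc k] = map (\<lambda>b. col_entry k ((r(\<sigma> y := i)) (\<sigma> b)) (c b) b) [1..<Suc k]"
            using True by (intro map_cong refl) auto
          then show ?thesis using True by (simp only: T_def if_True simp_thms)
        next
          case False
          have "0 \<in> set (map (?A(y := ?B y)) [1..<Suc k])"
            unfolding set_map set_upt_Suc using y False by (intro image_eqI[of _ _ y]) simp_all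
          then show ?thesis using False prod_list_zero_mem by (simp only: if_False)
        qed
      qed
      \<comment> \<open>The sum over columns \<open>y\<close> is reindexed by the row position
        \<open>\<sigma> y\<close>.\<close>
      also have "\<dots> = (\<Sum>a\<in>{1..k}. if r a = j then T \<sigma> (r(a := i)) c else 0)"
        using sum.permute[OF s, of "\<lambda>a. if r a = j then T \<sigma> (r(a := i)) c else 0"] by (simp only: o_def)
      finally show ?thesis unfolding set_upt_Suc .
    qed
    moreover have "(\<Sum>y\<in>set [1..<Suc k]. prod_list (map (?A(y := ?C y)) [1..<Suc k])) =
        (\<Sum>b\<in>{1..k}. if c b = i then T \<sigma> r (c(b := j)) else 0)"
      unfolding set_upt_Suc
    proof (intro sum.cong refl)
      fix y assume y: "y \<in> {1..k}"
      show "prod_list (map (?A(y := ?C y)) [1..<Suc k]) = (if c y = i then T \<sigma> r (c(y := j)) else 0)"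
      proof (cases "c y = i")
        case True
        then have "map (?A(y := ?C y)) [1..<Suc k] = map (\<lambda>b. col_entry k (r (\<sigma> b)) ((c(y := j)) b) b) [1..<Suc k]"
          by (intro map_cong refl) auto
        then show ?thesis using True by (simp only: T_def if_True simp_thms)
      next
        case False
        have "0 \<in> set (map (?A(y := ?C y)) [1..<Suc k])"
          unfolding set_map set_upt_Suc using y False by (intro image_eqI[of _ _ y]) simp_all
        then show ?thesis using False prod_list_zero_mem by (simp only: if_False)
      qed
    qed
    ultimately show ?thesis unfolding T_def by (simp only:)
  qed
  have R: "(\<Sum>a\<in>{1..k}. if r a = j then col_det k (r(a := i)) c else 0) =
     (\<Sum>\<sigma>\<in>?P. of_int (sign \<sigma>) * (\<Sum>a\<in>{1..k}. if r a = j then T \<sigma> (r(a := i)) c else 0))"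
    unfolding sum_distrib_left cd by (subst sum.swap) (auto intro!: sum.cong)
  have C: "(\<Sum>b\<in>{1..k}. if c b = i then col_det k r (c(b := j)) else 0) =
     (\<Sum>\<sigma>\<in>?P. of_int (sign \<sigma>) * (\<Sum>b\<in>{1..k}. if c b = i then T \<sigma> r (c(b := j)) else 0))"
    unfolding sum_distrib_left cd by (subst sum.swap) (auto intro!: sum.cong)
  have "letter i j * col_det k r c - col_det k r c * letter i j -
    ((\<Sum>a\<in>{1..k}. if r a = j then col_det k (r(a := i)) c else 0) -
     (\<Sum>b\<in>{1..k}. if c b = i then col_det k r (c(b := j)) else 0)) =
    (\<Sum>\<sigma>\<in>?P. of_int (sign \<sigma>) * (letter i j * T \<sigma> r c - T \<sigma> r c * letter i j -
     ((\<Sum>a\<in>{1..k}. if r a = j then T \<sigma> (r(a := i)) c else 0) -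
      (\<Sum>b\<in>{1..k}. if c b = i then T \<sigma> r (c(b := j)) else 0))))"
    unfolding R C unfolding cd
    by (simp only: sum_distrib_left[of "letter i j"] sum_distrib_right sgn right_diff_distrib sum_subtractf mult.assoc)
  also have "\<dots> \<in> relI n" by (intro relI_sum relI_mult_left main)
  finally show ?thesis .
qed

text \<open>For \<open>i \<noteq> j\<close> the commutator replaces a row or a column by one that is
  already present, and both determinants vanish modulo the relations; for \<open>i = j\<close> the
  two terms cancel.\<close>

theorem capelli_free_top_central: "central_free n (capelli_free n n)"
  unfolding central_free_def
proof (intro ballI)
  fix i j assume ij: "i \<in> {1..n}" "j \<in> {1..n}"
  let ?id = "\<lambda>a::nat. a"
  let ?rhs = "col_det n (?id(j := i)) ?id - col_det n ?id (?id(i := j))"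
  have "letter i j * col_det n ?id ?id - col_det n ?id ?id * letter i j -
    ((\<Sum>a\<in>{1..n}. if a = j then col_det n (?id(a := i)) ?id else 0) -
     (\<Sum>b\<in>{1..n}. if b = i then col_det n ?id (?id(b := j)) else 0)) \<in> relI n"
    using col_det_commutator[OF ij, of ?id n ?id] by simp
  then have 1: "letter i j * col_det n ?id ?id - col_det n ?id ?id * letter i j - ?rhs \<in> relI n"
    using ij by simp
  have 2: "?rhs \<in> relI n"
  proof (cases "i = j")
    case True
    then have "?id(j := i) = ?id" "?id(i := j) = ?id" by auto
    then show ?thesis by simp
  next
    case False
    have "col_det n (?id(j := i)) ?id = 0"
      using False ij by (intro col_det_row_repeat[of i n j]) auto
    moreover have "col_det n ?id (?id(i := j)) \<in> relI n"
    proof (cases "i < j")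
      case True
      then show ?thesis using ij by (intro col_det_col_repeat[of i n j]) auto
    next
      case False
      then show ?thesis using ij \<open>i \<noteq> j\<close> by (intro col_det_col_repeat[of j n i]) auto
    qed
    ultimately show ?thesis by (simp add: relI_uminus)
  qed
  from relI_add[OF 1 2] show "letter i j * capelli_free n n - capelli_free n n * letter i j \<in> relI n"
    by (simp add: capelli_free_top)
qed

section \<open>Eigenvalues on highest weight vectors\<close>

text \<open>The shifted elementary symmetric polynomial. The \<open>a\<close>-th smallest of
  \<open>k\<close> indices has \<open>k - a\<close> larger ones, which is the diagonal shift of the
  Capelli element.\<close>

definition shifted_elem :: "nat \<Rightarrow> nat \<Rightarrow> (nat \<Rightarrow> complex) \<Rightarrow> complex" where
  "shifted_elem n k x = (\<Sum>I | I \<subseteq> {1..n} \<and> card I = k. \<Prod>i\<in>I. x i + of_nat (card {j\<in>I. i < j}))"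

lemma polynomials_sum: "(\<And>i. i \<in> A \<Longrightarrow> h i \<in> polynomials n) \<Longrightarrow> (\<lambda>x. \<Sum>i\<in>A. h i x) \<in> polynomials n"
  by (induction A rule: infinite_finite_induct) (auto intro: polynomials.const polynomials.add)

lemma polynomials_prod: "(\<And>i. i \<in> A \<Longrightarrow> h i \<in> polynomials n) \<Longrightarrow> (\<lambda>x. \<Prod>i\<in>A. h i x) \<in> polynomials n"
  by (induction A rule: infinite_finite_induct) (auto intro: polynomials.const polynomials.mult)

lemma shifted_elem_polynomial: "shifted_elem n k \<in> polynomials n"
proof -
  have "(\<lambda>x. \<Sum>I | I \<subseteq> {1..n} \<and> card I = k. \<Prod>i\<in>I. x i + of_nat (card {j\<in>I. i < j})) \<in> polynomials n"
    by (intro polynomials_sum polynomials_prod polynomials.add polynomials.const polynomials.coord) auto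
  then show ?thesis by (simp add: shifted_elem_def[abs_def])
qed

lemma sum_Pow_insert:
  assumes "finite X" "a \<notin> X"
  shows "(\<Sum>I\<in>Pow (insert a X). F I) = (\<Sum>I\<in>Pow X. F I + F (insert a I))"
proof -
  have inj: "inj_on (insert a) (Pow X)" using assms(2) by (auto simp: inj_on_def)
  have "(\<Sum>I\<in>Pow (insert a X). F I) = (\<Sum>I\<in>Pow X. F I) + (\<Sum>I\<in>insert a ` Pow X. F I)"
    unfolding Pow_insert using assms by (intro sum.union_disjoint) auto
  then show ?thesis by (simp add: sum.reindex[OF inj] sum.distrib)
qed

text \<open>The subsets are grouped by their part \<open>J\<close> outside \<open>i\<close> and
  \<open>i + 1\<close>. The substitution preserves the sum of the terms that contain exactly one of
  the two, and it interchanges the factors \<open>x i + G + 1\<close> and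
  \<open>x (i + 1) + G\<close> of the term that contains both.\<close>

lemma shifted_elem_swap:
  assumes i: "i \<in> {1..<n}"
  shows "shifted_elem n k x = shifted_elem n k (x(i := x (i + 1) - 1, i + 1 := x i + 1))"
proof -
  let ?y = "x(i := x (i + 1) - 1, i + 1 := x i + 1)"
  define X where "X = {1..n} - {i, Suc i}"
  have X: "finite X" "i \<notin> X" "Suc i \<notin> X" "{1..n} = insert i (insert (Suc i) X)"
    using i by (auto simp: X_def)
  define F where "F x I = (if card I = k then \<Prod>i\<in>I. x i + of_nat (card {j\<in>I. i < j}) else (0::complex))"
    for x :: "nat \<Rightarrow> complex" and I
  have s: "shifted_elem n k x = (\<Sum>J\<in>Pow X. F x J + F x (insert i J) + F x (insert (Suc i) J) + F x (insert i (insert (Suc i) J)))" for x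
  proof -
    have "shifted_elem n k x = (\<Sum>I\<in>Pow {1..n}. F x I)"
      unfolding shifted_elem_def F_def by (rule sum.mono_neutral_cong_left) auto
    also have "\<dots> = (\<Sum>J\<in>Pow (insert (Suc i) X). F x J + F x (insert i J))"
      unfolding X(4) using X by (intro sum_Pow_insert) auto
    also have "\<dots> = (\<Sum>J\<in>Pow X. F x J + F x (insert i J) + (F x (insert (Suc i) J) + F x (insert i (insert (Suc i) J))))"
      using X by (intro sum_Pow_insert) auto
    finally show ?thesis by (simp add: algebra_simps)
  qed
  have "F x J + F x (insert i J) + F x (insert (Suc i) J) + F x (insert i (insert (Suc i) J)) =
      F ?y J + F ?y (insert i J) + F ?y (insert (Suc i) J) + F ?y (insert i (insert (Suc i) J))" if "J \<in> Pow X" for J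
  proof -
    have J: "finite J" "i \<notin> J" "Suc i \<notin> J" using that X finite_subset by auto
    \<comment> \<open>Contribution of \<open>J\<close> when \<open>m\<close> of the indices
      \<open>i\<close>, \<open>i + 1\<close> are added: they count as larger exactly for the
      elements below \<open>i\<close>.\<close>
    define R where "R m = (\<Prod>j\<in>J. x j + of_nat (card {l\<in>J. j < l} + (if j < i then m else 0)))" for m
    define G where "G = (of_nat (card {l\<in>J. i < l}) :: complex)"
    have gr: "{l\<in>J. Suc i < l} = {l\<in>J. i < l}" proof -
      have "Suc i < l \<longleftrightarrow> i < l" if "l \<in> J" for l using J(3) that by (cases "l = Suc i") auto
      then show ?thesis by blast
    qed
    have c: "{l \<in> insert i J. j < l} = (if j < i then insert i {l\<in>J. j < l} else {l\<in>J. j < l})"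
      "{l \<in> insert (Suc i) J. j < l} = (if j < Suc i then insert (Suc i) {l\<in>J. j < l} else {l\<in>J. j < l})"
      "{l \<in> insert i (insert (Suc i) J). j < l} = (if j < i then insert i (insert (Suc i) {l\<in>J. j < l})
         else if j < Suc i then insert (Suc i) {l\<in>J. j < l} else {l\<in>J. j < l})" for j
      by auto
    have P: "(\<Prod>j\<in>J. z j + of_nat (card {l\<in>J. j < l})) = R 0"
      "(\<Prod>j\<in>J. z j + of_nat (card {l\<in>insert i J. j < l})) = R 1"
      "(\<Prod>j\<in>J. z j + of_nat (card {l\<in>insert (Suc i) J. j < l})) = R 1"
      "(\<Prod>j\<in>J. z j + of_nat (card {l\<in>insert i (insert (Suc i) J). j < l})) = R 2"
      if "z \<in> {x, ?y}" for z
    proof -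
      have z: "z j = x j" if "j \<in> J" for j using \<open>z \<in> {x, ?y}\<close> J that by auto
      have ji: "j < Suc i \<longleftrightarrow> j < i" if "j \<in> J" for j using J that by (auto simp: less_Suc_eq)
      show "(\<Prod>j\<in>J. z j + of_nat (card {l\<in>J. j < l})) = R 0"
        unfolding R_def by (intro prod.cong refl) (simp add: z)
      show "(\<Prod>j\<in>J. z j + of_nat (card {l\<in>insert i J. j < l})) = R 1"
        unfolding R_def c using J by (intro prod.cong refl) (simp add: z)
      show "(\<Prod>j\<in>J. z j + of_nat (card {l\<in>insert (Suc i) J. j < l})) = R 1"
        unfolding R_def c using J by (intro prod.cong refl) (simp add: z ji)
      show "(\<Prod>j\<in>J. z j + of_nat (card {l\<in>insert i (insert (Suc i) J). j < l})) = R 2"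
        unfolding R_def c using J by (intro prod.cong refl) (simp add: z ji)
    qed
    have F: "F z J = (if card J = k then R 0 else 0)"
      "F z (insert i J) = (if Suc (card J) = k then (z i + G) * R 1 else 0)"
      "F z (insert (Suc i) J) = (if Suc (card J) = k then (z (Suc i) + G) * R 1 else 0)"
      "F z (insert i (insert (Suc i) J)) = (if Suc (Suc (card J)) = k then (z i + (G + 1)) * ((z (Suc i) + G) * R 2) else 0)"
      if "z \<in> {x, ?y}" for z
    proof -
      have e: "{l\<in>insert i J. i < l} = {l\<in>J. i < l}" "{l\<in>insert (Suc i) J. Suc i < l} = {l\<in>J. i < l}"
        "{l\<in>insert i (insert (Suc i) J). i < l} = insert (Suc i) {l\<in>J. i < l}"
        "{l\<in>insert i (insert (Suc i) J). Suc i < l} = {l\<in>J. i < l}"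
        by auto (use gr in blast)+
      have n: "i \<notin> insert (Suc i) J" "finite (insert (Suc i) J)" "Suc i \<notin> {l\<in>J. i < l}" "finite {l\<in>J. i < l}"
        using J by auto
      have cd: "card (insert i J) = Suc (card J)" "card (insert (Suc i) J) = Suc (card J)"
        "card (insert i (insert (Suc i) J)) = Suc (Suc (card J))"
        "(of_nat (card (insert (Suc i) {l\<in>J. i < l})) :: complex) = G + 1"
        using J n by (simp_all add: G_def)
      show "F z J = (if card J = k then R 0 else 0)"
        unfolding F_def P[OF that] ..
      show "F z (insert i J) = (if Suc (card J) = k then (z i + G) * R 1 else 0)"
        unfolding F_def cd prod.insert[OF J(1,2)] P[OF that] e G_def ..
      show "F z (insert (Suc i) J) = (if Suc (card J) = k then (z (Suc i) + G) * R 1 else 0)"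
        unfolding F_def cd prod.insert[OF J(1,3)] P[OF that] e G_def ..
      show "F z (insert i (insert (Suc i) J)) = (if Suc (Suc (card J)) = k then (z i + (G + 1)) * ((z (Suc i) + G) * R 2) else 0)"
        unfolding F_def cd prod.insert[OF n(2,1)] prod.insert[OF J(1,3)] P[OF that] e cd(4) unfolding G_def ..
    qed
    have m: "x \<in> {x, ?y}" "?y \<in> {x, ?y}" by blast+
    have y: "?y i = x (Suc i) - 1" "?y (Suc i) = x i + 1" by simp_all
    show ?thesis
      unfolding F[OF m(1)] F[OF m(2)] y by (simp add: algebra_simps)
  qed
  then show ?thesis unfolding s by (intro sum.cong refl) simp
qed

lemma shifted_elem_shifted_symmetric: "shifted_elem n k \<in> shifted_symmetric n"
  unfolding shifted_symmetric_def using shifted_elem_polynomial shifted_elem_swap by blast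

text \<open>In a subset containing \<open>n + 1\<close> this index is the largest, so its factor is
  the bare coordinate \<open>x (Suc n)\<close>, which is zero.\<close>

lemma shifted_elem_stable:
  assumes "x (Suc n) = 0"
  shows "shifted_elem (Suc n) k x = shifted_elem n k x"
  unfolding shifted_elem_def
proof (rule sum.mono_neutral_right)
  show "finite {I. I \<subseteq> {1..Suc n} \<and> card I = k}" by simp
  show "{I. I \<subseteq> {1..n} \<and> card I = k} \<subseteq> {I. I \<subseteq> {1..Suc n} \<and> card I = k}" by auto
  show "\<forall>I\<in>{I. I \<subseteq> {1..Suc n} \<and> card I = k} - {I. I \<subseteq> {1..n} \<and> card I = k}.
      (\<Prod>i\<in>I. x i + of_nat (card {j\<in>I. i < j})) = 0"
  proof
    fix I assume I: "I \<in> {I. I \<subseteq> {1..Suc n} \<and> card I = k} - {I. I \<subseteq> {1..n} \<and> card I = k}"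
    then have fin: "finite I" using finite_subset by auto
    have "\<not> I \<subseteq> {1..n}" "I \<subseteq> {1..Suc n}" using I by auto
    then have "Suc n \<in> I" by (metis atLeastAtMostSuc_conv insertE le_add1 plus_1_eq_Suc subset_iff)
    moreover have "{j\<in>I. Suc n < j} = {}" using I by auto
    ultimately show "(\<Prod>i\<in>I. x i + of_nat (card {j\<in>I. i < j})) = 0"
      using fin assms by (intro prod_zero) (auto intro!: bexI[of _ "Suc n"])
  qed
qed

section \<open>Polynomials vanishing at dominant weights\<close>

lemma polynomials_univariate:
  "f \<in> polynomials n \<Longrightarrow> \<exists>p. \<forall>t. f (x(i := t)) = poly p t"
proof (induction rule: polynomials.induct)
  case (const c)
  show ?case by (rule exI[of _ "[:c:]"]) simp
next
  case (coord j)
  show ?case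
    by (cases "j = i") (auto intro: exI[of _ "[:0, 1:]"] exI[of _ "[:x j:]"])
next
  case (add f g)
  then obtain p q where "\<forall>t. f (x(i := t)) = poly p t" "\<forall>t. g (x(i := t)) = poly q t" by blast
  then show ?case by (intro exI[of _ "p + q"]) (simp del: fun_upd_apply)
next
  case (mult f g)
  then obtain p q where "\<forall>t. f (x(i := t)) = poly p t" "\<forall>t. g (x(i := t)) = poly q t" by blast
  then show ?case by (intro exI[of _ "p * q"]) (simp del: fun_upd_apply)
qed

text \<open>The coordinates are freed one at a time, starting with the first. Once its predecessors
  are free, a coordinate is bounded only from below by its successor, so a polynomial in one
  variable has infinitely many roots.\<close>

lemma polynomials_vanish:
  assumes h: "h \<in> polynomials n"
    and zero: "\<And>l x. (\<And>i. i \<in> {1..<n} \<Longrightarrow> l (Suc i) \<le> l i) \<Longrightarrow>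
      (\<And>i. i \<in> {1..n} \<Longrightarrow> x i = of_nat (l i)) \<Longrightarrow> h x = 0"
  shows "h x = 0"
proof -
  have "\<forall>x l. (\<forall>i\<in>{Suc j..<n}. l (Suc i) \<le> l i) \<longrightarrow> (\<forall>i\<in>{Suc j..n}. x i = of_nat (l i)) \<longrightarrow> h x = 0" if "j \<le> n" for j
    using that
  proof (induction j)
    case 0
    show ?case
    proof (intro allI impI)
      fix x :: "nat \<Rightarrow> complex" and l :: "nat \<Rightarrow> nat"
      assume "\<forall>i\<in>{Suc 0..<n}. l (Suc i) \<le> l i" "\<forall>i\<in>{Suc 0..n}. x i = of_nat (l i)"
      then show "h x = 0" by (intro zero[of l x]) auto
    qed
  next
    case (Suc j)
    show ?case
    proof (intro allI impI)
      fix x :: "nat \<Rightarrow> complex" and l :: "nat \<Rightarrow> nat"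
      assume l: "\<forall>i\<in>{Suc (Suc j)..<n}. l (Suc i) \<le> l i" and x: "\<forall>i\<in>{Suc (Suc j)..n}. x i = of_nat (l i)"
      obtain p where p: "\<And>t. h (x(Suc j := t)) = poly p t"
        using polynomials_univariate[OF h] by blast
      have root: "poly p (of_nat N) = 0" if N: "N \<ge> l (Suc (Suc j))" for N
      proof -
        let ?l = "l(Suc j := N)"
        have "h (x(Suc j := of_nat N)) = 0"
          using Suc.IH[rule_format, of ?l "x(Suc j := of_nat N)"] Suc.prems l x N
          by (auto simp: Suc_le_eq less_Suc_eq_le)
        then show ?thesis using p by simp
      qed
      have "p = 0"
      proof (rule ccontr)
        assume "p \<noteq> 0"
        then have "finite {t. poly p t = 0}" by (rule poly_roots_finite)
        moreover have "of_nat ` {l (Suc (Suc j))..} \<subseteq> {t. poly p t = 0}" using root by auto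
        ultimately have "finite (of_nat ` {l (Suc (Suc j))..} :: complex set)" by (rule rev_finite_subset)
        then have "finite {l (Suc (Suc j))..}"
          by (rule finite_imageD) (auto simp: inj_on_def)
        then show False by (simp add: infinite_Ici)
      qed
      then show "h x = 0" using p[of "x (Suc j)"] by simp
    qed
  qed
  from this[of n] show ?thesis by simp
qed

section \<open>Eigenvectors in left modules\<close>

definition eigen :: "nat \<Rightarrow> (env_alg, 'b, 'c) module_scheme \<Rightarrow> 'b \<Rightarrow> free_alg \<Rightarrow> complex \<Rightarrow> bool" where
  "eigen n V v p c \<longleftrightarrow> p \<in> tens n \<and> U_class n p \<odot>\<^bsub>V\<^esub> v = scalar n c \<odot>\<^bsub>V\<^esub> v"

context
  fixes n :: nat and V :: "(env_alg, 'b, 'c) module_scheme"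
  assumes V: "left_module (U_gl n) V"
begin

interpretation left_module "U_gl n" V by (rule V)

lemma class_smult_closed: "p \<in> tens n \<Longrightarrow> w \<in> carrier V \<Longrightarrow> U_class n p \<odot>\<^bsub>V\<^esub> w \<in> carrier V"
  by (rule smult_closed[OF U_class_closed])

lemma class_mult_smult: "p \<in> tens n \<Longrightarrow> q \<in> tens n \<Longrightarrow> w \<in> carrier V \<Longrightarrow>
    U_class n (p * q) \<odot>\<^bsub>V\<^esub> w = U_class n p \<odot>\<^bsub>V\<^esub> (U_class n q \<odot>\<^bsub>V\<^esub> w)"
  unfolding U_class_mult by (rule smult_assoc) (auto intro: U_class_closed)

lemma class_add_smult: "p \<in> tens n \<Longrightarrow> q \<in> tens n \<Longrightarrow> w \<in> carrier V \<Longrightarrow>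
    U_class n (p + q) \<odot>\<^bsub>V\<^esub> w = U_class n p \<odot>\<^bsub>V\<^esub> w \<oplus>\<^bsub>V\<^esub> U_class n q \<odot>\<^bsub>V\<^esub> w"
  unfolding U_class_add by (rule smult_l_distr) (auto intro: U_class_closed)

lemma class_smult_zero: "p \<in> tens n \<Longrightarrow> U_class n p \<odot>\<^bsub>V\<^esub> \<zero>\<^bsub>V\<^esub> = \<zero>\<^bsub>V\<^esub>"
proof -
  assume p: "p \<in> tens n"
  let ?z = "U_class n p \<odot>\<^bsub>V\<^esub> \<zero>\<^bsub>V\<^esub>"
  have z: "?z \<in> carrier V" using p by (intro class_smult_closed) auto
  have "?z \<oplus>\<^bsub>V\<^esub> ?z = ?z"
    using smult_r_distr[OF U_class_closed[OF p], of "\<zero>\<^bsub>V\<^esub>" "\<zero>\<^bsub>V\<^esub>"] z by simp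
  then show ?thesis using M.add.l_cancel_one[OF z z] by simp
qed

lemma zero_smult: "w \<in> carrier V \<Longrightarrow> scalar n 0 \<odot>\<^bsub>V\<^esub> w = \<zero>\<^bsub>V\<^esub>"
proof -
  assume w: "w \<in> carrier V"
  let ?z = "U_class n 0 \<odot>\<^bsub>V\<^esub> w"
  have z: "?z \<in> carrier V" using w by (intro class_smult_closed) auto
  have "?z \<oplus>\<^bsub>V\<^esub> ?z = ?z"
    using class_add_smult[of 0 0 w] w z by simp
  then show ?thesis using M.add.l_cancel_one[OF z z] by (simp add: scalar_def)
qed

end

context
  fixes n :: nat and V :: "(env_alg, 'b, 'c) module_scheme" and v :: 'b
  assumes V: "left_module (U_gl n) V" and v: "v \<in> carrier V"
begin

interpretation left_module "U_gl n" V by (rule V)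

lemma eigen_of_complex: "eigen n V v (of_complex c) c"
  by (simp add: eigen_def scalar_def)

lemma eigen_add: "eigen n V v p c \<Longrightarrow> eigen n V v q d \<Longrightarrow> eigen n V v (p + q) (c + d)"
  unfolding eigen_def scalar_def using v by (simp add: class_add_smult[OF V] of_complex_add tens_add)

text \<open>Scalars commute with the representatives already in the free algebra, so
  \<open>d\<close> can be moved past \<open>p\<close>.\<close>

lemma eigen_mult:
  assumes "eigen n V v p c" "eigen n V v q d"
  shows "eigen n V v (p * q) (c * d)"
proof -
  have pq: "p \<in> tens n" "q \<in> tens n" and e: "U_class n p \<odot>\<^bsub>V\<^esub> v = U_class n (of_complex c) \<odot>\<^bsub>V\<^esub> v"
    "U_class n q \<odot>\<^bsub>V\<^esub> v = U_class n (of_complex d) \<odot>\<^bsub>V\<^esub> v" using assms by (auto simp: eigen_def scalar_def)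
  have "U_class n (p * q) \<odot>\<^bsub>V\<^esub> v = U_class n (p * of_complex d) \<odot>\<^bsub>V\<^esub> v"
    using pq v e by (simp add: class_mult_smult[OF V])
  also have "p * of_complex d = of_complex d * p" by (rule of_complex_commute[symmetric])
  also have "U_class n (of_complex d * p) \<odot>\<^bsub>V\<^esub> v = U_class n (of_complex d * of_complex c) \<odot>\<^bsub>V\<^esub> v"
    using pq v e(1) by (simp add: class_mult_smult[OF V])
  also have "of_complex d * of_complex c = of_complex (c * d)"
    by (simp only: of_complex_mult[symmetric] mult.commute)
  finally show ?thesis
    using pq by (simp add: eigen_def scalar_def tens_mult)
qed

lemma eigen_mult_zero:
  assumes "p \<in> tens n" "eigen n V v q 0"
  shows "eigen n V v (p * q) 0"
  using assms v zero_smult[OF V v]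
  by (simp add: eigen_def class_mult_smult[OF V] tens_mult class_smult_zero[OF V])

lemma eigen_sum: "finite A \<Longrightarrow> (\<And>i. i \<in> A \<Longrightarrow> eigen n V v (p i) (c i)) \<Longrightarrow> eigen n V v (sum p A) (sum c A)"
proof (induction A rule: finite_induct)
  case empty
  then show ?case using eigen_of_complex[of 0] by simp
qed (simp add: eigen_add)

text \<open>The eigenspace of a central element is a submodule. It contains the nonzero vector
  \<open>v\<close>, so by irreducibility it is the whole module.\<close>

lemma eigen_central_all:
  assumes irr: "irreducible_module (U_gl n) V" and v0: "v \<noteq> \<zero>\<^bsub>V\<^esub>"
    and A: "A \<in> U_center n" "A \<odot>\<^bsub>V\<^esub> v = scalar n c \<odot>\<^bsub>V\<^esub> v" and w: "w \<in> carrier V"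
  shows "A \<odot>\<^bsub>V\<^esub> w = scalar n c \<odot>\<^bsub>V\<^esub> w"
proof -
  define W where "W = {w \<in> carrier V. A \<odot>\<^bsub>V\<^esub> w = scalar n c \<odot>\<^bsub>V\<^esub> w}"
  have AU: "A \<in> carrier (U_gl n)" and Acomm: "\<And>x. x \<in> carrier (U_gl n) \<Longrightarrow> A \<otimes>\<^bsub>U_gl n\<^esub> x = x \<otimes>\<^bsub>U_gl n\<^esub> A"
    using A by (auto simp: U_center_def)
  obtain p where p: "p \<in> tens n" "A = U_class n p" using AU carrier_U by auto
  have Wadd: "x \<oplus>\<^bsub>V\<^esub> y \<in> W" if "x \<in> W" "y \<in> W" for x y
    using that AU scalar_closed by (simp add: W_def smult_r_distr)
  have Wzero: "\<zero>\<^bsub>V\<^esub> \<in> W" using p by (simp add: W_def class_smult_zero[OF V] scalar_def)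
  have Wsm: "a \<odot>\<^bsub>V\<^esub> x \<in> W" if aU: "a \<in> carrier (U_gl n)" and xW: "x \<in> W" for a x
  proof -
    from aU obtain q where q: "q \<in> tens n" "a = U_class n q" unfolding carrier_U by blast
    have x: "x \<in> carrier V" "A \<odot>\<^bsub>V\<^esub> x = scalar n c \<odot>\<^bsub>V\<^esub> x" using xW by (auto simp: W_def)
    have "A \<odot>\<^bsub>V\<^esub> (a \<odot>\<^bsub>V\<^esub> x) = a \<odot>\<^bsub>V\<^esub> (A \<odot>\<^bsub>V\<^esub> x)"
      using AU aU x Acomm by (metis smult_assoc)
    also have "\<dots> = scalar n c \<odot>\<^bsub>V\<^esub> (a \<odot>\<^bsub>V\<^esub> x)"
      unfolding x(2) scalar_def q(2) using q x(1)
      by (simp add: class_mult_smult[OF V, symmetric] of_complex_commute[of c q])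
    finally show ?thesis using aU x by (simp add: W_def smult_closed)
  qed
  \<comment> \<open>Negatives come from the action of the scalar -1.\<close>
  have Winv: "\<ominus>\<^bsub>V\<^esub> x \<in> W" if "x \<in> W" for x
  proof -
    have x: "x \<in> carrier V" using that by (simp add: W_def)
    have "U_class n (- 1) \<odot>\<^bsub>V\<^esub> x \<oplus>\<^bsub>V\<^esub> U_class n 1 \<odot>\<^bsub>V\<^esub> x = \<zero>\<^bsub>V\<^esub>"
      using class_add_smult[OF V, of "- 1" 1 x] x zero_smult[OF V x] by (simp add: scalar_def tens_uminus)
    then have "\<ominus>\<^bsub>V\<^esub> x = U_class n (- 1) \<odot>\<^bsub>V\<^esub> x"
      using x smult_one[OF x] by (intro M.minus_equality) (auto simp: U_class_one tens_uminus class_smult_closed[OF V])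
    then show ?thesis using Wsm[OF U_class_closed that, of "- 1"] by (simp add: tens_uminus)
  qed
  have "additive_subgroup W V"
  proof (rule additive_subgroupI)
    show "subgroup W (add_monoid V)"
      by (rule group.subgroupI[OF M.a_group]) (use Wadd Wzero Winv in \<open>auto simp: W_def a_inv_def\<close>)
  qed
  then have "W = {\<zero>\<^bsub>V\<^esub>} \<or> W = carrier V"
    using irr Wsm unfolding irreducible_module_def by blast
  moreover have "v \<in> W" using v A by (simp add: W_def)
  ultimately have "w \<in> W" using v0 w by auto
  then show ?thesis by (simp add: W_def)
qed

end

text \<open>The factor of the last column acts first. Going from right to left, the first column
  moved by the permutation is sent to a smaller row; its entry is a raising operator and kills the
  highest weight vector. Only the identity permutation survives.\<close>

lemma eigen_capelli_free:
  fixes V :: "(env_alg, 'b, 'c) module_scheme"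
  assumes V: "left_module (U_gl n) V" and hw: "is_highest_weight_vector n \<nu> V v"
  shows "eigen n V v (capelli_free n k) (shifted_elem n k \<nu>)"
proof -
  have v: "v \<in> carrier V" using hw by (simp add: is_highest_weight_vector_def)
  note eig = eigen_add[OF V v] eigen_mult[OF V v] eigen_of_complex[OF V v]
  have raise: "eigen n V v (letter i j) 0" if "1 \<le> i" "i < j" "j \<le> n" for i j
    using hw that zero_smult[OF V v]
    by (auto simp: eigen_def is_highest_weight_vector_def gl_unit_def letter_in_tens)
  have diag: "eigen n V v (letter i i) (\<nu> i)" if "i \<in> {1..n}" for i
    using hw that by (auto simp: eigen_def is_highest_weight_vector_def gl_unit_def letter_in_tens)
  have trm: "eigen n V v (\<Prod>j\<leftarrow>[t..<Suc k]. letter (enum I (p j)) (enum I j) + (if p j = j then of_nat (k - p j) else 0))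
     (if \<forall>j\<in>{t..k}. p j = j then \<Prod>j\<in>{t..k}. \<nu> (enum I j) + of_nat (k - j) else 0)"
    if I: "I \<subseteq> {1..n}" "card I = k" and p: "p permutes {1..k}" and t: "1 \<le> t" "t \<le> Suc k" for I p t
    using t
  proof (induction "Suc k - t" arbitrary: t)
    case 0
    then have "t = Suc k" by simp
    then show ?case using eig(3)[of 1] by simp
  next
    case (Suc m)
    have finI: "finite I" using I(1) finite_subset by blast
    have t: "t \<in> {1..k}" using Suc by auto
    let ?A = "\<lambda>j. letter (enum I (p j)) (enum I j) + (if p j = j then of_nat (k - p j) else 0)"
    let ?c = "\<lambda>t. if \<forall>j\<in>{t..k}. p j = j then \<Prod>j\<in>{t..k}. \<nu> (enum I j) + of_nat (k - j) else 0"
    have IH: "eigen n V v (\<Prod>j\<leftarrow>[Suc t..<Suc k]. ?A j) (?c (Suc t))"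
      using Suc by (intro Suc.hyps(1)) auto
    have upt: "[t..<Suc k] = t # [Suc t..<Suc k]" using t by (intro upt_conv_Cons) simp
    have ptk: "p t \<in> {1..k}" using t p by (simp only: permutes_in_image)
    have en: "enum I (p t) \<in> {1..n}" "enum I t \<in> {1..n}" using enum_in[OF finI I(2)] ptk t I(1) by blast+
    have At: "?A t \<in> tens n" using en by (intro tens_add letter_in_tens) auto
    have set: "{t..k} = insert t {Suc t..k}" using t by auto
    show ?case
    proof (cases "\<forall>j\<in>{Suc t..k}. p j = j")
      case False
      then have "eigen n V v (\<Prod>j\<leftarrow>[Suc t..<Suc k]. ?A j) 0" using IH by (simp only: if_False)
      then have *: "eigen n V v (?A t * (\<Prod>j\<leftarrow>[Suc t..<Suc k]. ?A j)) 0" by (rule eigen_mult_zero[OF V v At])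
      have "\<not> (\<forall>j\<in>{t..k}. p j = j)" using False unfolding set by blast
      then have "?c t = 0" by (rule if_not_P)
      with * show ?thesis unfolding upt list.map prod_list.Cons by (simp only:)
    next
      case fixed: True
      have "eigen n V v (?A t) (if p t = t then \<nu> (enum I t) + of_nat (k - t) else 0)"
      proof (cases "p t = t")
        case True
        then show ?thesis
          using eig(1)[OF diag[OF en(2)] eig(3)[of "of_nat (k - t)"]] by (simp add: of_complex_of_nat)
      next
        case False
        \<comment> \<open>The columns beyond \<open>t\<close> are fixed, so by injectivity
          \<open>p t\<close> is not among them.\<close>
        have "p t < t"
        proof (rule ccontr)
          assume "\<not> p t < t"
          then have "p t \<in> {Suc t..k}" using False ptk by auto
          then have "p (p t) = p t" using fixed by blast
          then show False using False permutes_inj[OF p] by (auto dest: injD)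
        qed
        then have "enum I (p t) < enum I t" using ptk t by (intro enum_less[OF finI I(2)]) auto
        then show ?thesis using False raise en by simp
      qed
      then have *: "eigen n V v (?A t * (\<Prod>j\<leftarrow>[Suc t..<Suc k]. ?A j))
        ((if p t = t then \<nu> (enum I t) + of_nat (k - t) else 0) * ?c (Suc t))" by (rule eig(2)[OF _ IH])
      have "?c t = (if p t = t then \<nu> (enum I t) + of_nat (k - t) else 0) * ?c (Suc t)"
        unfolding set using fixed by simp
      with * show ?thesis unfolding upt list.map prod_list.Cons by (simp only:)
    qed
  qed
  have "eigen n V v (capelli_free n k) (\<Sum>I | I \<subseteq> {1..n} \<and> card I = k. \<Sum>p | p permutes {1..k}.
     of_int (sign p) * (if \<forall>j\<in>{1..k}. p j = j then \<Prod>j\<in>{1..k}. \<nu> (enum I j) + of_nat (k - j) else 0))"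
    unfolding capelli_free_def cdet_def of_complex_of_int[symmetric]
    by (intro eigen_sum[OF V v] eig(2) eig(3) trm) (auto simp: finite_permutations)
  also have "(\<Sum>I | I \<subseteq> {1..n} \<and> card I = k. \<Sum>p | p permutes {1..k}.
     of_int (sign p) * (if \<forall>j\<in>{1..k}. p j = j then \<Prod>j\<in>{1..k}. \<nu> (enum I j) + of_nat (k - j) else 0)) = shifted_elem n k \<nu>"
    unfolding shifted_elem_def
  proof (intro sum.cong refl)
    fix I assume I: "I \<in> {I. I \<subseteq> {1..n} \<and> card I = k}"
    have finI: "finite I" and cI: "card I = k" using I finite_subset by auto
    have bij: "bij_betw (enum I) {1..k} I" by (rule enum_bij[OF finI cI])
    let ?c = "\<Prod>j\<in>{1..k}. \<nu> (enum I j) + of_nat (k - j)"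
    have "(\<Sum>p | p permutes {1..k}. of_int (sign p) * (if \<forall>j\<in>{1..k}. p j = j then ?c else 0)) =
       (\<Sum>p | p permutes {1..k}. if p = id then ?c else 0)"
    proof (intro sum.cong refl)
      fix p assume "p \<in> {p. p permutes {1..k}}"
      then have "(\<forall>j\<in>{1..k}. p j = j) \<longleftrightarrow> p = id" by (auto simp: permutes_def fun_eq_iff)
      then show "of_int (sign p) * (if \<forall>j\<in>{1..k}. p j = j then ?c else 0) = (if p = id then ?c else 0)"
        by (simp add: sign_id)
    qed
    also have "\<dots> = ?c" using permutes_id[of "{1..k}"] by (simp add: finite_permutations)
    \<comment> \<open>The \<open>j\<close>-th smallest of the \<open>k\<close> elements of
      \<open>I\<close> is exceeded by \<open>k - j\<close> of them.\<close>
    also have "\<dots> = (\<Prod>j\<in>{1..k}. \<nu> (enum I j) + of_nat (card {l\<in>I. enum I j < l}))"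
    proof (intro prod.cong refl)
      fix j assume j: "j \<in> {1..k}"
      have "{l\<in>I. enum I j < l} = enum I ` {j<..k}"
      proof (intro equalityI subsetI)
        fix l assume l: "l \<in> {l\<in>I. enum I j < l}"
        then have "l \<in> enum I ` {1..k}" using bij by (simp add: bij_betw_def)
        then obtain a where a: "l = enum I a" "a \<in> {1..k}" by (rule imageE)
        have "j < a"
        proof (rule ccontr)
          assume "\<not> j < a"
          then have "a = j \<or> a < j" by linarith
          then have "a = j \<or> enum I a < enum I j" using a j enum_less[OF finI cI, of a j] by auto
          then show False using l a by auto
        qed
        then show "l \<in> enum I ` {j<..k}" using a by auto
      next
        fix l assume "l \<in> enum I ` {j<..k}"
        then show "l \<in> {l\<in>I. enum I j < l}"
          using j enum_less[OF finI cI, of j] enum_in[OF finI cI] by auto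
      qed
      moreover have "inj_on (enum I) {j<..k}"
        using bij j by (auto simp: bij_betw_def intro: inj_on_subset)
      ultimately have "card {l\<in>I. enum I j < l} = k - j" by (simp add: card_image)
      then show "\<nu> (enum I j) + of_nat (k - j) = \<nu> (enum I j) + of_nat (card {l\<in>I. enum I j < l})" by simp
    qed
    also have "\<dots> = (\<Prod>i\<in>I. \<nu> i + of_nat (card {j\<in>I. i < j}))"
      by (rule prod.reindex_bij_betw[OF bij])
    finally show "(\<Sum>p | p permutes {1..k}. of_int (sign p) * (if \<forall>j\<in>{1..k}. p j = j then ?c else 0)) =
      (\<Prod>i\<in>I. \<nu> i + of_nat (card {j\<in>I. i < j}))" .
  qed
  finally show ?thesis .
qed

section \<open>Existence of highest weight modules\<close>

definition left_ideal :: "('a, 'r) ring_scheme \<Rightarrow> 'a set \<Rightarrow> bool" where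
  "left_ideal R J \<longleftrightarrow> additive_subgroup J R \<and> (\<forall>a\<in>carrier R. \<forall>x\<in>J. a \<otimes>\<^bsub>R\<^esub> x \<in> J)"

text \<open>The quotient of the ring by \<open>J\<close> as a left module. The scalar product is a
  union over representatives; for a left ideal they all give the same coset
  (\<open>coset_smult\<close>).\<close>

definition coset_module :: "('a, 'r) ring_scheme \<Rightarrow> 'a set \<Rightarrow> ('a, 'a set) module" where
  "coset_module R J = \<lparr>carrier = a_rcosets\<^bsub>R\<^esub> J, mult = (\<lambda>X Y. J), one = J, zero = J, add = set_add R,
     module.smult = (\<lambda>a X. \<Union>x\<in>X. J +>\<^bsub>R\<^esub> (a \<otimes>\<^bsub>R\<^esub> x))\<rparr>"

lemma coset_module_simps [simp]:
  "carrier (coset_module R J) = a_rcosets\<^bsub>R\<^esub> J" "\<zero>\<^bsub>coset_module R J\<^esub> = J"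
  "add (coset_module R J) = set_add R"
  by (simp_all add: coset_module_def)

context ring
begin

lemma left_ideal_abelian_subgroup: "left_ideal R J \<Longrightarrow> abelian_subgroup J R"
  unfolding left_ideal_def by (intro abelian_subgroupI3) (auto simp: is_abelian_group)

lemma coset_smult:
  assumes J: "left_ideal R J" and a: "a \<in> carrier R" and x: "x \<in> carrier R"
  shows "a \<odot>\<^bsub>coset_module R J\<^esub> (J +> x) = J +> (a \<otimes> x)"
proof -
  interpret abelian_subgroup J R by (rule left_ideal_abelian_subgroup[OF J])
  have "J +> (a \<otimes> y) = J +> (a \<otimes> x)" if yx: "y \<in> J +> x" for y
  proof -
    from yx obtain h where h: "h \<in> J" "y = h \<oplus> x" unfolding a_r_coset_def' by blast
    have "h \<in> carrier R" by (rule a_Hcarr[OF h(1)])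
    then have eq: "a \<otimes> y = a \<otimes> h \<oplus> a \<otimes> x" unfolding h(2) by (rule r_distr[OF _ x a])
    have "a \<otimes> h \<in> J" using J a h(1) unfolding left_ideal_def by blast
    then have "a \<otimes> y \<in> J +> (a \<otimes> x)" unfolding eq a_r_coset_def' by blast
    then show ?thesis by (rule a_repr_independence'[OF _ m_closed[OF a x], symmetric])
  qed
  moreover have "x \<in> J +> x" using x by (rule a_rcos_self)
  ultimately have "(\<Union>y\<in>J +> x. J +> (a \<otimes> y)) = J +> (a \<otimes> x)"
    by (intro SUP_eq_const) blast+
  then show ?thesis by (simp add: coset_module_def)
qed

lemma coset_module_carrierE:
  assumes "X \<in> a_rcosets J"
  obtains x where "x \<in> carrier R" "X = J +> x"
  using assms by (auto simp: A_RCOSETS_def')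

lemma coset_left_module:
  assumes J: "left_ideal R J"
  shows "left_module R (coset_module R J)"
proof -
  interpret J: abelian_subgroup J R by (rule left_ideal_abelian_subgroup[OF J])
  have closed: "x \<in> carrier R \<Longrightarrow> J +> x \<in> a_rcosets J" for x
    by (rule a_rcosetsI[OF J.a_subset])
  have J0: "J = J +> \<zero>" using J.a_subset by simp
  have "abelian_group (coset_module R J)"
  proof (rule abelian_groupI)
    show "\<zero>\<^bsub>coset_module R J\<^esub> \<in> carrier (coset_module R J)" using closed[of \<zero>] J0 by simp
  next
    fix X assume "X \<in> carrier (coset_module R J)"
    then obtain x where x: "x \<in> carrier R" "X = J +> x" by (auto elim: coset_module_carrierE)
    then show "\<zero>\<^bsub>coset_module R J\<^esub> \<oplus>\<^bsub>coset_module R J\<^esub> X = X"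
      using J.a_rcos_sum[of \<zero> x] J0 by simp
    have "(J +> (\<ominus> x)) <+> X = J" using J.a_rcos_sum[of "\<ominus> x" x] x J0 by (simp add: l_neg)
    then show "\<exists>Y\<in>carrier (coset_module R J). Y \<oplus>\<^bsub>coset_module R J\<^esub> X = \<zero>\<^bsub>coset_module R J\<^esub>"
      using closed[of "\<ominus> x"] x by (intro bexI[of _ "J +> (\<ominus> x)"]) simp_all
  qed (auto elim!: coset_module_carrierE simp: J.a_rcos_sum closed a_assoc a_comm a_lcomm)
  then show ?thesis
    by (intro left_module.intro left_module_axioms.intro ring_axioms)
      (auto elim!: coset_module_carrierE simp: coset_smult[OF J] J.a_rcos_sum closed l_distr r_distr m_assoc)
qed

text \<open>The preimage \<open>K\<close> of a submodule is a left ideal containing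
  \<open>J\<close>. If it contains 1 the submodule is everything; otherwise maximality gives
  \<open>K = J\<close> and the submodule is zero.\<close>

lemma coset_irreducible:
  assumes J: "left_ideal R J" "\<one> \<notin> J"
    and max: "\<And>K. left_ideal R K \<Longrightarrow> J \<subseteq> K \<Longrightarrow> \<one> \<notin> K \<Longrightarrow> K = J"
  shows "irreducible_module R (coset_module R J)"
proof -
  interpret J: abelian_subgroup J R by (rule left_ideal_abelian_subgroup[OF J(1)])
  interpret V: left_module R "coset_module R J" by (rule coset_left_module[OF J(1)])
  have closed: "x \<in> carrier R \<Longrightarrow> J +> x \<in> a_rcosets J" for x
    by (rule a_rcosetsI[OF J.a_subset])
  have eqJ: "J +> x = J \<longleftrightarrow> x \<in> J" if "x \<in> carrier R" for x
    using that J.a_rcos_self J.a_rcos_const by blast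
  have "J +> \<one> \<noteq> J" using eqJ[of \<one>] J(2) by simp
  moreover have "J +> \<one> \<in> a_rcosets J" by (rule closed) simp
  ultimately have ne: "a_rcosets J \<noteq> {J}" by blast
  have "W = {J} \<or> W = a_rcosets J"
    if W: "additive_subgroup W (coset_module R J)" and sm: "\<forall>a\<in>carrier R. \<forall>w\<in>W. a \<odot>\<^bsub>coset_module R J\<^esub> w \<in> W" for W
  proof -
    interpret W: additive_subgroup W "coset_module R J" by (rule W)
    have Wsub: "W \<subseteq> a_rcosets J" using W.a_subset by simp
    have JW: "J \<in> W" using W.zero_closed by simp
    have WE: "\<exists>x\<in>carrier R. X = J +> x" if "X \<in> W" for X
      using that Wsub by (auto elim!: coset_module_carrierE)
    define K where "K = {x \<in> carrier R. J +> x \<in> W}"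
    have Ksm: "a \<otimes> x \<in> K" if "a \<in> carrier R" "x \<in> K" for a x
      using that sm coset_smult[OF J(1), of a x] by (force simp: K_def)
    have Kadd: "x \<oplus> y \<in> K" if "x \<in> K" "y \<in> K" for x y
      using that W.a_closed[of "J +> x" "J +> y"] by (simp add: K_def J.a_rcos_sum)
    have Kinv: "\<ominus> x \<in> K" if "x \<in> K" for x
    proof -
      have "x \<in> carrier R" using that by (simp add: K_def)
      then have "\<ominus> x = \<ominus> \<one> \<otimes> x" by (simp add: l_minus)
      then show ?thesis using Ksm[of "\<ominus> \<one>" x] that by simp
    qed
    have JK: "J \<subseteq> K"
    proof
      fix x assume x: "x \<in> J"
      then have "x \<in> carrier R" by (rule J.a_Hcarr)
      then show "x \<in> K" using eqJ[of x] x JW by (simp add: K_def)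
    qed
    have K: "left_ideal R K"
      unfolding left_ideal_def
    proof (intro conjI ballI)
      show "additive_subgroup K R"
      proof (rule additive_subgroupI)
        show "subgroup K (add_monoid R)"
        proof (rule group.subgroupI[OF a_group])
          show "K \<noteq> {}" using JK J.zero_closed by blast
        qed (use Kadd Kinv in \<open>auto simp: K_def a_inv_def\<close>)
      qed
    qed (use Ksm in auto)
    show ?thesis
    proof (cases "\<one> \<in> K")
      case True
      have "J +> x \<in> W" if "x \<in> carrier R" for x
        using Ksm[OF that True] that by (simp add: K_def)
      then have "a_rcosets J \<subseteq> W" by (auto elim!: coset_module_carrierE)
      then show ?thesis using Wsub by blast
    next
      case False
      then have KJ: "K = J" by (rule max[OF K JK])
      have "X = J" if X: "X \<in> W" for X
      proof -
        obtain x where x: "x \<in> carrier R" "X = J +> x" using WE[OF X] by blast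
        then have "x \<in> K" using X by (simp add: K_def)
        then show ?thesis using x KJ eqJ by simp
      qed
      then show ?thesis using JW by blast
    qed
  qed
  then show ?thesis
    unfolding irreducible_module_def using coset_left_module[OF J(1)] ne by simp
qed

text \<open>Zorn's lemma applies because not containing 1 is inherited by unions of chains.\<close>

lemma maximal_left_ideal_exists:
  assumes L: "left_ideal R L" "\<one> \<notin> L"
  shows "\<exists>J. left_ideal R J \<and> L \<subseteq> J \<and> \<one> \<notin> J \<and>
    (\<forall>K. left_ideal R K \<and> J \<subseteq> K \<and> \<one> \<notin> K \<longrightarrow> K = J)"
proof -
  define A where "A = {J. left_ideal R J \<and> L \<subseteq> J \<and> \<one> \<notin> J}"
  have "\<exists>M\<in>A. \<forall>X\<in>A. M \<subseteq> X \<longrightarrow> X = M"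
  proof (rule subset_Zorn_nonempty)
    show "A \<noteq> {}" using L by (auto simp: A_def)
    fix C assume C: "C \<noteq> {}" "subset.chain A C"
    have CA: "J \<in> A" if "J \<in> C" for J using C(2) that by (auto simp: subset_chain_def)
    have tot: "J \<subseteq> K \<or> K \<subseteq> J" if "J \<in> C" "K \<in> C" for J K using C(2) that by (auto simp: subset_chain_def)
    have li: "left_ideal R J" if "J \<in> C" for J using CA[OF that] by (simp add: A_def)
    have ag: "additive_subgroup J R" if "J \<in> C" for J using li[OF that] by (simp add: left_ideal_def)
    have "left_ideal R (\<Union>C)"
      unfolding left_ideal_def
    proof (intro conjI ballI)
      show "additive_subgroup (\<Union>C) R"
      proof (rule additive_subgroupI)
        show "subgroup (\<Union>C) (add_monoid R)"
        proof (rule group.subgroupI[OF a_group])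
          show "\<Union>C \<subseteq> carrier (add_monoid R)" using additive_subgroup.a_subset[OF ag] by auto
          show "\<Union>C \<noteq> {}" using C(1) additive_subgroup.zero_closed[OF ag] by blast
        next
          fix x assume "x \<in> \<Union>C"
          then obtain J where J: "J \<in> C" "x \<in> J" by blast
          interpret additive_subgroup J R by (rule ag[OF J(1)])
          interpret abelian_subgroup J R by (rule left_ideal_abelian_subgroup[OF li[OF J(1)]])
          have "\<ominus> x \<in> J" using J(2) by simp
          then show "inv\<^bsub>add_monoid R\<^esub> x \<in> \<Union>C" using J(1) by (auto simp: a_inv_def)
        next
          fix x y assume "x \<in> \<Union>C" "y \<in> \<Union>C"
          then obtain J K where JK: "J \<in> C" "x \<in> J" "K \<in> C" "y \<in> K" by blast
          then obtain M where M: "M \<in> C" "x \<in> M" "y \<in> M" using tot[OF JK(1,3)] by blast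
          then have "x \<oplus> y \<in> M" using additive_subgroup.a_closed[OF ag] by blast
          then show "x \<otimes>\<^bsub>add_monoid R\<^esub> y \<in> \<Union>C" using M(1) by auto
        qed
      qed
    next
      fix a x assume "a \<in> carrier R" "x \<in> \<Union>C"
      then show "a \<otimes> x \<in> \<Union>C" using li by (auto simp: left_ideal_def)
    qed
    moreover have "L \<subseteq> \<Union>C" "\<one> \<notin> \<Union>C" using C(1) CA by (auto simp: A_def)
    ultimately show "\<Union>C \<in> A" by (simp add: A_def)
  qed
  then obtain J where J: "J \<in> A" "\<And>X. X \<in> A \<Longrightarrow> J \<subseteq> X \<Longrightarrow> X = J" by blast
  then show ?thesis by (intro exI[of _ J]) (auto simp: A_def)
qed

end

text \<open>A highest weight vector is the tensor product, over the columns of the Young diagram of the weight, of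
  the vectors \<open>e\<^sub>1 \<and> \<dots> \<and> e\<^sub>h\<close>, where \<open>h\<close> is the height of the column.\<close>

definition block_fun :: "nat set \<Rightarrow> (nat \<Rightarrow> nat option) \<Rightarrow> complex" where
  "block_fun K x = (\<Sum>\<sigma> | \<sigma> permutes K. of_int (sign \<sigma>) * (\<Prod>a\<in>K. if x a = Some (\<sigma> a) then 1 else 0))"

text \<open>The matrix unit \<open>(i, j)\<close> replaces the factor \<open>j\<close> of the wedge
  product by \<open>i\<close>. If \<open>j\<close> occurs, then so does \<open>i\<close>, and the
  result has a repeated factor; if \<open>j\<close> does not occur, there is nothing to
  replace.\<close>

lemma block_fun_raise:
  assumes K: "finite K" and ij: "i \<noteq> j" "j \<in> K \<Longrightarrow> i \<in> K"
  shows "(\<Sum>a\<in>K. if x a = Some i then block_fun K (x(a := Some j)) else 0) = 0"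
proof (cases "j \<in> K")
  case False
  have "block_fun K (x(a := Some j)) = 0" if a: "a \<in> K" for a
    unfolding block_fun_def
  proof (intro sum.neutral ballI)
    fix \<sigma> assume "\<sigma> \<in> {\<sigma>. \<sigma> permutes K}"
    then have "\<sigma> a \<in> K" using a by (simp only: mem_Collect_eq permutes_in_image)
    then have "j \<noteq> \<sigma> a" using False by auto
    then have "(\<Prod>b\<in>K. if (x(a := Some j)) b = Some (\<sigma> b) then 1 else 0) = (0::complex)"
      using K a by (intro prod_zero) (auto intro!: bexI[of _ a])
    then show "of_int (sign \<sigma>) * (\<Prod>b\<in>K. if (x(a := Some j)) b = Some (\<sigma> b) then 1 else 0) = (0::complex)"
      by simp
  qed
  then show ?thesis by (intro sum.neutral) auto
next
  case True
  then have i: "i \<in> K" using ij by simp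
  \<comment> \<open>\<open>\<rho>\<close> performs the replacement. It does not distinguish
    \<open>i\<close> from \<open>j\<close>, which gives the symmetry that
    \<open>sum_sign_swap_zero\<close> requires.\<close>
  define \<rho> where "\<rho> = id(j := i)"
  define f where "f \<sigma> = (\<Prod>a\<in>K. if x a = Some (\<rho> (\<sigma> a)) then 1 else (0::complex))" for \<sigma> :: "nat \<Rightarrow> nat"
  have "(\<Sum>a\<in>K. if x a = Some i then (\<Prod>b\<in>K. if (x(a := Some j)) b = Some (\<sigma> b) then 1 else 0) else 0) = f \<sigma>"
    if \<sigma>: "\<sigma> permutes K" for \<sigma>
  proof -
    obtain a0 where a0: "a0 \<in> K" "\<sigma> a0 = j" using permutes_image[OF \<sigma>] True by (metis imageE)
    have inj: "\<sigma> b = j \<longleftrightarrow> b = a0" for b using permutes_inj[OF \<sigma>] a0 by (metis injD)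
    have "(\<Sum>a\<in>K. if x a = Some i then (\<Prod>b\<in>K. if (x(a := Some j)) b = Some (\<sigma> b) then 1 else 0) else 0) =
       (\<Sum>a\<in>K. if a = a0 then f \<sigma> else 0)"
    proof (intro sum.cong refl)
      fix a assume a: "a \<in> K"
      show "(if x a = Some i then (\<Prod>b\<in>K. if (x(a := Some j)) b = Some (\<sigma> b) then 1 else 0) else 0) =
         (if a = a0 then f \<sigma> else 0)"
      proof (cases "a = a0")
        case True
        show ?thesis
        proof (cases "x a = Some i")
          case xa: True
          have "(\<Prod>b\<in>K. if (x(a := Some j)) b = Some (\<sigma> b) then 1 else 0) = f \<sigma>"
            unfolding f_def
          proof (intro prod.cong refl)
            fix b assume "b \<in> K"
            show "(if (x(a := Some j)) b = Some (\<sigma> b) then 1 else 0) = (if x b = Some (\<rho> (\<sigma> b)) then 1 else (0::complex))"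
              using True xa a0 inj[of b] by (cases "b = a0") (auto simp: \<rho>_def)
          qed
          then show ?thesis using True xa by simp
        next
          case False
          have "f \<sigma> = 0" unfolding f_def
            using K a0 True False by (intro prod_zero) (auto intro!: bexI[of _ a0] simp: \<rho>_def)
          then show ?thesis using True False by simp
        qed
      next
        case False
        then have "\<sigma> a \<noteq> j" using inj by simp
        then have "(\<Prod>b\<in>K. if (x(a := Some j)) b = Some (\<sigma> b) then 1 else 0) = (0::complex)"
          using K a by (intro prod_zero) (auto intro!: bexI[of _ a])
        then show ?thesis using False by simp
      qed
    qed
    then show ?thesis using K a0 by simp
  qed
  then have "(\<Sum>a\<in>K. if x a = Some i then block_fun K (x(a := Some j)) else 0) =
     (\<Sum>\<sigma> | \<sigma> permutes K. of_int (sign \<sigma>) * f \<sigma>)"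
  proof -
    assume *: "\<And>\<sigma>. \<sigma> permutes K \<Longrightarrow> (\<Sum>a\<in>K. if x a = Some i then (\<Prod>b\<in>K. if (x(a := Some j)) b = Some (\<sigma> b) then 1 else 0) else 0) = f \<sigma>"
    have "(\<Sum>a\<in>K. if x a = Some i then block_fun K (x(a := Some j)) else 0) =
      (\<Sum>a\<in>K. \<Sum>\<sigma> | \<sigma> permutes K. of_int (sign \<sigma>) * (if x a = Some i then (\<Prod>b\<in>K. if (x(a := Some j)) b = Some (\<sigma> b) then 1 else 0) else 0))"
      by (intro sum.cong refl) (simp add: block_fun_def)
    also have "\<dots> = (\<Sum>\<sigma> | \<sigma> permutes K. \<Sum>a\<in>K. of_int (sign \<sigma>) * (if x a = Some i then (\<Prod>b\<in>K. if (x(a := Some j)) b = Some (\<sigma> b) then 1 else 0) else 0))"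
      by (rule sum.swap)
    also have "\<dots> = (\<Sum>\<sigma> | \<sigma> permutes K. of_int (sign \<sigma>) * f \<sigma>)"
      unfolding sum_distrib_left[symmetric] by (intro sum.cong refl arg_cong2[where f="(*)"] *) simp
    finally show ?thesis .
  qed
  also have "\<dots> = 0"
  proof (rule sum_sign_swap_zero[OF K i True ij(1)])
    fix \<sigma> :: "nat \<Rightarrow> nat"
    have "\<rho> (transpose i j y) = \<rho> y" for y by (simp add: \<rho>_def transpose_def)
    then show "f (transpose i j \<circ> \<sigma>) = f \<sigma>" by (simp add: f_def)
  qed
  finally show ?thesis .
qed

text \<open>Each term of the wedge product contains every index of \<open>K\<close> exactly once, so
  the diagonal unit acts by 1 or 0.\<close>

lemma block_fun_diag:
  assumes K: "finite K"
  shows "(\<Sum>a\<in>K. if x a = Some i then block_fun K (x(a := Some i)) else 0) = (if i \<in> K then block_fun K x else 0)"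
proof -
  have "(\<Sum>a\<in>K. if x a = Some i then block_fun K (x(a := Some i)) else 0) =
      (\<Sum>a\<in>K. \<Sum>\<sigma> | \<sigma> permutes K. if x a = Some i then of_int (sign \<sigma>) * (\<Prod>a\<in>K. if x a = Some (\<sigma> a) then 1 else 0) else 0)"
  proof (intro sum.cong refl)
    fix a
    show "(if x a = Some i then block_fun K (x(a := Some i)) else 0) =
      (\<Sum>\<sigma> | \<sigma> permutes K. if x a = Some i then of_int (sign \<sigma>) * (\<Prod>a\<in>K. if x a = Some (\<sigma> a) then 1 else 0) else 0)"
    proof (cases "x a = Some i")
      case True
      then have "x(a := Some i) = x" by auto
      then show ?thesis using True by (simp add: block_fun_def)
    qed simp
  qed
  also have "\<dots> = (\<Sum>\<sigma> | \<sigma> permutes K. \<Sum>a\<in>K. if x a = Some i then of_int (sign \<sigma>) * (\<Prod>a\<in>K. if x a = Some (\<sigma> a) then 1 else 0) else 0)"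
    by (rule sum.swap)
  also have "\<dots> = (\<Sum>\<sigma> | \<sigma> permutes K. if i \<in> K then of_int (sign \<sigma>) * (\<Prod>a\<in>K. if x a = Some (\<sigma> a) then 1 else 0) else 0)"
  proof (intro sum.cong refl)
    fix \<sigma> assume "\<sigma> \<in> {\<sigma>. \<sigma> permutes K}"
    then have \<sigma>: "\<sigma> permutes K" by simp
    let ?P = "of_int (sign \<sigma>) * (\<Prod>a\<in>K. if x a = Some (\<sigma> a) then 1 else (0::complex))"
    show "(\<Sum>a\<in>K. if x a = Some i then ?P else 0) = (if i \<in> K then ?P else 0)"
    proof (cases "\<forall>a\<in>K. x a = Some (\<sigma> a)")
      case False
      then have "?P = 0" using K by (auto intro!: prod_zero)
      then show ?thesis by (simp only: if_cancel sum.neutral_const)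
    next
      case True
      have "(\<Sum>a\<in>K. if x a = Some i then ?P else 0) = (\<Sum>a\<in>K. if \<sigma> a = i then ?P else 0)"
        using True by (intro sum.cong refl) auto
      also have "\<dots> = (\<Sum>a\<in>K. if a = i then ?P else 0)"
        using sum.permute[OF \<sigma>, of "\<lambda>a. if a = i then ?P else 0"] by (simp only: o_def)
      also have "\<dots> = (if i \<in> K then ?P else 0)" using K by simp
      finally show ?thesis .
    qed
  qed
  also have "\<dots> = (if i \<in> K then block_fun K x else 0)"
    by (simp add: block_fun_def)
  finally show ?thesis .
qed

text \<open>The annihilator \<open>L\<close> of the tensor \<open>F\<close> is a proper left ideal
  containing the raising operators and the differences of diagonal units and weights. In the
  quotient by a maximal left ideal above \<open>L\<close>, the coset of 1 is a highest weight
  vector.\<close>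

lemma highest_weight_module_exists:
  assumes l: "\<And>i. i \<in> {1..<n} \<Longrightarrow> l (Suc i) \<le> l i"
  shows "\<exists>V :: (env_alg, env_alg set) module. is_highest_weight_module n (\<lambda>i. of_nat (l i)) V"
proof -
  have dec: "l j \<le> l i" if "1 \<le> i" "i \<le> j" "j \<le> n" for i j
    using that(2,3)
  proof (induction j rule: dec_induct)
    case (step m)
    then show ?case using l[of m] that(1) by auto
  qed simp
  \<comment> \<open>\<open>B\<close> numbers the columns of the Young diagram with row lengths
    \<open>l\<close>, and \<open>K b\<close> consists of the rows that meet column \<open>b\<close>.
    Tensor positions are the boxes of the diagram.\<close>
  define B where "B = {1..l 1}"
  define K where "K b = {a \<in> {1..n}. b \<le> l a}" for b
  define S where "S = Sigma B K"
  define F where "F x = (\<Prod>b\<in>B. block_fun (K b) (\<lambda>a. x (b, a)))" for x :: "nat \<times> nat \<Rightarrow> nat option"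
  have fin: "finite B" "finite (K b)" "finite S" for b by (auto simp: B_def K_def S_def)
  have op: "op_at S (i, j) F x = (\<Sum>b\<in>B. (\<Sum>a\<in>K b. if x (b, a) = Some i then block_fun (K b) ((\<lambda>a. x (b, a))(a := Some j)) else 0) *
      (\<Prod>b'\<in>B - {b}. block_fun (K b') (\<lambda>a. x (b', a))))" for i j x
  proof -
    have "op_at S (i, j) F x = (\<Sum>b\<in>B. \<Sum>a\<in>K b. if x (b, a) = Some i then F (x((b, a) := Some j)) else 0)"
      unfolding op_at_def S_def fst_conv snd_conv
      by (subst sum.Sigma) (use fin in \<open>auto intro!: sum.cong\<close>)
    also have "\<dots> = (\<Sum>b\<in>B. \<Sum>a\<in>K b. (if x (b, a) = Some i then block_fun (K b) ((\<lambda>a. x (b, a))(a := Some j)) else 0) *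
       (\<Prod>b'\<in>B - {b}. block_fun (K b') (\<lambda>a. x (b', a))))"
    proof (intro sum.cong refl)
      fix b a assume b: "b \<in> B"
      have 1: "(\<lambda>c. (x((b, a) := Some j)) (b, c)) = (\<lambda>c. x (b, c))(a := Some j)" by auto
      have 2: "(\<Prod>b'\<in>B - {b}. block_fun (K b') (\<lambda>c. (x((b, a) := Some j)) (b', c))) = (\<Prod>b'\<in>B - {b}. block_fun (K b') (\<lambda>c. x (b', c)))"
        by (intro prod.cong refl) auto
      have "F (x((b, a) := Some j)) = block_fun (K b) ((\<lambda>a. x (b, a))(a := Some j)) * (\<Prod>b'\<in>B - {b}. block_fun (K b') (\<lambda>a. x (b', a)))"
        unfolding F_def prod.remove[OF fin(1) b] 1 2 ..
      then show "(if x (b, a) = Some i then F (x((b, a) := Some j)) else 0) =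
         (if x (b, a) = Some i then block_fun (K b) ((\<lambda>a. x (b, a))(a := Some j)) else 0) *
         (\<Prod>b'\<in>B - {b}. block_fun (K b') (\<lambda>a. x (b', a)))" by simp
    qed
    finally show ?thesis by (simp only: sum_distrib_right)
  qed
  have raise: "op_at S (i, j) F = (\<lambda>x. 0)" if "1 \<le> i" "i < j" "j \<le> n" for i j
  proof
    fix x
    have "j \<in> K b \<Longrightarrow> i \<in> K b" for b using that dec[of i j] by (auto simp: K_def)
    then have "(\<Sum>a\<in>K b. if x (b, a) = Some i then block_fun (K b) ((\<lambda>a. x (b, a))(a := Some j)) else 0) = 0" for b
      using block_fun_raise[OF fin(2)[of b], of i j "\<lambda>a. x (b, a)"] that by simp
    then show "op_at S (i, j) F x = 0" unfolding op by simp
  qed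
  have diag: "op_at S (i, i) F = (\<lambda>x. of_nat (l i) * F x)" if i: "i \<in> {1..n}" for i
  proof
    fix x
    have "op_at S (i, i) F x = (\<Sum>b\<in>B. if i \<in> K b then F x else 0)"
      unfolding op block_fun_diag[OF fin(2)]
      by (intro sum.cong refl) (auto simp: F_def prod.remove[OF fin(1)])
    also have "\<dots> = (\<Sum>b\<in>{b\<in>B. i \<in> K b}. F x)"
      using fin(1) by (simp add: sum.If_cases Int_def)
    \<comment> \<open>Row \<open>i\<close> meets exactly the first \<open>l i\<close> columns; they
      are all in \<open>B\<close> because the row lengths decrease.\<close>
    also have "{b\<in>B. i \<in> K b} = {1..l i}"
      using i dec[of 1 i] by (auto simp: B_def K_def)
    finally show "op_at S (i, i) F x = of_nat (l i) * F x" by simp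
  qed
  \<comment> \<open>When every box carries its own row number, only the identity permutations
    contribute. Thus \<open>F\<close> is nonzero and \<open>L\<close> does not contain 1.\<close>
  have F1: "F (\<lambda>(b, a). Some a) = 1"
  proof -
    have "block_fun (K b) Some = 1" for b
    proof -
      have "block_fun (K b) Some = (\<Sum>\<sigma> | \<sigma> permutes K b. if \<sigma> = id then 1 else 0)"
        unfolding block_fun_def
      proof (intro sum.cong refl)
        fix \<sigma> assume "\<sigma> \<in> {\<sigma>. \<sigma> permutes K b}"
        then have \<sigma>: "\<sigma> permutes K b" by simp
        show "of_int (sign \<sigma>) * (\<Prod>a\<in>K b. if Some a = Some (\<sigma> a) then 1 else 0) = (if \<sigma> = id then 1 else (0::complex))"
        proof (cases "\<sigma> = id")
          case False
          then obtain a where "\<sigma> a \<noteq> a" by (auto simp: fun_eq_iff)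
          moreover then have "a \<in> K b" using permutes_not_in[OF \<sigma>] by blast
          ultimately have "(\<Prod>a\<in>K b. if Some a = Some (\<sigma> a) then 1 else 0) = (0::complex)"
            using fin(2) by (intro prod_zero) (auto intro!: bexI[of _ a])
          then show ?thesis using False by simp
        qed (simp add: sign_id)
      qed
      also have "\<dots> = 1" using permutes_id[of "K b"] by (simp add: finite_permutations fin)
      finally show ?thesis .
    qed
    then show ?thesis by (simp add: F_def)
  qed
  \<comment> \<open>Membership of a class does not depend on the representative, since the ideal
    acts by zero; this is \<open>act_null_iff\<close>.\<close>
  define L where "L = U_class n ` {p \<in> tens n. act S p F = (\<lambda>x. 0)}"
  interpret ring "U_gl n" by (rule U_ring)
  have act_null_iff: "U_class n p \<in> L \<longleftrightarrow> act S p F = (\<lambda>x. 0)" if p: "p \<in> tens n" for p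
  proof
    assume "U_class n p \<in> L"
    then obtain q where q: "q \<in> tens n" "act S q F = (\<lambda>x. 0)" "U_class n p = U_class n q" by (auto simp: L_def)
    then have "p - q \<in> gl_ideal n" using p by (simp add: U_class_eq_iff gl_ideal_iff tens_diff)
    then have "act S (p - q) F = (\<lambda>x. 0)" by (rule act_gl_ideal[OF fin(3)])
    then show "act S p F = (\<lambda>x. 0)" using act_diff[of S p q F] q(2) by (simp add: fun_eq_iff)
  qed (use p in \<open>auto simp: L_def\<close>)
  have um: "act S (- p) F = (\<lambda>x. 0)" if "act S p F = (\<lambda>x. 0)" for p
    using act_diff[of S 0 p F] that by (simp add: act_zero)
  have Uinv: "\<ominus>\<^bsub>U_gl n\<^esub> U_class n p = U_class n (- p)" if "p \<in> tens n" for p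
    using that U_class_add[of "- p" n p]
    by (intro minus_equality) (auto simp: U_class_zero tens_uminus U_class_closed)
  have Lli: "left_ideal (U_gl n) L"
    unfolding left_ideal_def
  proof (intro conjI ballI)
    show "additive_subgroup L (U_gl n)"
    proof (rule additive_subgroupI)
      show "subgroup L (add_monoid (U_gl n))"
      proof (rule group.subgroupI[OF a_group])
        show "L \<subseteq> carrier (add_monoid (U_gl n))" by (auto simp: L_def U_class_closed)
        show "L \<noteq> {}" by (auto simp: L_def act_zero intro!: exI[of _ 0])
      next
        fix x assume "x \<in> L"
        then obtain p where p: "p \<in> tens n" "act S p F = (\<lambda>x. 0)" "x = U_class n p" by (auto simp: L_def)
        then have "U_class n (- p) \<in> L" using act_null_iff[of "- p"] um by (simp add: tens_uminus)
        then show "inv\<^bsub>add_monoid (U_gl n)\<^esub> x \<in> L" using Uinv[OF p(1)] p(3) by (simp add: a_inv_def)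
      next
        fix x y assume "x \<in> L" "y \<in> L"
        then obtain p q where p: "p \<in> tens n" "act S p F = (\<lambda>x. 0)" "x = U_class n p"
          and q: "q \<in> tens n" "act S q F = (\<lambda>x. 0)" "y = U_class n q" by (auto simp: L_def)
        then have "U_class n (p + q) \<in> L" using act_null_iff[of "p + q"] by (simp add: tens_add act_add)
        then show "x \<otimes>\<^bsub>add_monoid (U_gl n)\<^esub> y \<in> L" using p q by (simp add: U_class_add)
      qed
    qed
  next
    fix a x assume "a \<in> carrier (U_gl n)" "x \<in> L"
    then obtain p q where p: "p \<in> tens n" "a = U_class n p"
      and q: "q \<in> tens n" "act S q F = (\<lambda>x. 0)" "x = U_class n q" unfolding L_def carrier_U by blast
    then have "U_class n (p * q) \<in> L" using act_null_iff[of "p * q"] by (simp add: tens_mult act_mult act_null)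
    then show "a \<otimes>\<^bsub>U_gl n\<^esub> x \<in> L" using p q by (simp add: U_class_mult)
  qed
  have "act S 1 F \<noteq> (\<lambda>x. 0)"
  proof
    assume "act S 1 F = (\<lambda>x. 0)"
    then have "1 * F (\<lambda>(b, a). Some a) = 0" using act_of_complex[of S 1 F] by (auto simp: fun_eq_iff)
    then show False using F1 by simp
  qed
  then have L1: "\<one>\<^bsub>U_gl n\<^esub> \<notin> L" using act_null_iff[of 1] by (simp add: U_class_one)
  obtain J where J: "left_ideal (U_gl n) J" "L \<subseteq> J" "\<one>\<^bsub>U_gl n\<^esub> \<notin> J"
    "\<forall>K. left_ideal (U_gl n) K \<and> J \<subseteq> K \<and> \<one>\<^bsub>U_gl n\<^esub> \<notin> K \<longrightarrow> K = J"
    using maximal_left_ideal_exists[OF Lli L1] by (elim exE conjE)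
  interpret J: abelian_subgroup J "U_gl n" by (rule left_ideal_abelian_subgroup[OF J(1)])
  let ?V = "coset_module (U_gl n) J"
  let ?v = "J +>\<^bsub>U_gl n\<^esub> \<one>\<^bsub>U_gl n\<^esub>"
  have sm: "U_class n p \<odot>\<^bsub>?V\<^esub> ?v = J +>\<^bsub>U_gl n\<^esub> U_class n p" if "p \<in> tens n" for p
    using coset_smult[OF J(1), of "U_class n p" "\<one>\<^bsub>U_gl n\<^esub>"] U_class_closed[OF that] by simp
  have "is_highest_weight_vector n (\<lambda>i. of_nat (l i)) ?V ?v"
    unfolding is_highest_weight_vector_def
  proof (intro conjI allI impI ballI)
    show "?v \<in> carrier ?V" by (simp add: a_rcosetsI[OF J.a_subset])
    show "?v \<noteq> \<zero>\<^bsub>?V\<^esub>" using J(3) J.a_rcos_self[of "\<one>\<^bsub>U_gl n\<^esub>"] by auto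
  next
    fix i j assume ij: "1 \<le> i \<and> i < j \<and> j \<le> n"
    then have t: "letter i j \<in> tens n" by (intro letter_in_tens) auto
    have "U_class n (letter i j) \<in> L" using act_null_iff[OF t] raise ij by (simp add: act_letter)
    then have "U_class n (letter i j) \<in> J" using J(2) by blast
    then show "gl_unit n i j \<odot>\<^bsub>?V\<^esub> ?v = \<zero>\<^bsub>?V\<^esub>"
      unfolding gl_unit_def sm[OF t] by (simp add: J.a_rcos_const)
  next
    fix i assume i: "i \<in> {1..n}"
    then have t: "letter i i \<in> tens n" by (intro letter_in_tens)
    let ?c = "of_complex (of_nat (l i))"
    have d: "letter i i - ?c \<in> tens n" using t by (simp add: tens_diff)
    have "act S (letter i i - ?c) F = (\<lambda>x. 0)"
      using diag[OF i] by (simp add: act_diff act_letter act_of_complex)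
    then have "U_class n (letter i i - ?c) \<in> J" using act_null_iff[OF d] J(2) by blast
    moreover have "U_class n (letter i i) = U_class n (letter i i - ?c) \<oplus>\<^bsub>U_gl n\<^esub> U_class n ?c"
      using d by (simp flip: U_class_add)
    ultimately have "U_class n (letter i i) \<in> J +>\<^bsub>U_gl n\<^esub> U_class n ?c"
      by (auto simp: a_r_coset_def')
    then have "J +>\<^bsub>U_gl n\<^esub> U_class n (letter i i) = J +>\<^bsub>U_gl n\<^esub> U_class n ?c"
      using U_class_closed[of ?c n] by (intro J.a_repr_independence'[symmetric]) auto
    then show "gl_unit n i i \<odot>\<^bsub>?V\<^esub> ?v = scalar n (of_nat (l i)) \<odot>\<^bsub>?V\<^esub> ?v"
      unfolding gl_unit_def scalar_def by (simp add: sm t)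
  qed
  then have "is_highest_weight_module n (\<lambda>i. of_nat (l i)) ?V"
    unfolding is_highest_weight_module_def using coset_irreducible[OF J(1,3)] J(4) by blast
  then show ?thesis by blast
qed

section \<open>Stability of the eigenvalue\<close>

text \<open>Commuting with the generators passes to words by the product rule and to all elements by
  linearity.\<close>

lemma U_center_iff:
  assumes p: "p \<in> tens n"
  shows "U_class n p \<in> U_center n \<longleftrightarrow> central_free n p"
proof
  assume c: "U_class n p \<in> U_center n"
  show "central_free n p"
    unfolding central_free_def
  proof (intro ballI)
    fix i j assume "i \<in> {1..n}" "j \<in> {1..n}"
    then have l: "letter i j \<in> tens n" by (rule letter_in_tens)
    have "U_class n p \<otimes>\<^bsub>U_gl n\<^esub> U_class n (letter i j) = U_class n (letter i j) \<otimes>\<^bsub>U_gl n\<^esub> U_class n p"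
      using c U_class_closed[OF l] by (simp add: U_center_def)
    then have "U_class n (letter i j * p) = U_class n (p * letter i j)"
      using p l by (simp add: U_class_mult)
    then show "letter i j * p - p * letter i j \<in> relI n"
      using p l by (simp add: U_class_eq_iff tens_mult)
  qed
next
  assume c: "central_free n p"
  have word: "wmono u * p - p * wmono u \<in> relI n" if "set u \<subseteq> sq n" for u
    using that
  proof (induction u)
    case (Cons x u)
    let ?x = "letter (fst x) (snd x)"
    have "?x * p - p * ?x \<in> relI n" using c Cons.prems by (auto simp: central_free_def)
    moreover have "wmono u * p - p * wmono u \<in> relI n" using Cons by simp
    ultimately have "?x * (wmono u * p - p * wmono u) + (?x * p - p * ?x) * wmono u \<in> relI n"
      by (intro relI_add relI_mult_left relI_mult_right)
    then show ?case by (simp add: wmono_Cons' algebra_simps)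
  qed (simp add: wmono_Nil)
  have comm: "q * p - p * q \<in> relI n" if q: "q \<in> tens n" for q
  proof -
    let ?k = "Poly_Mapping.keys q" and ?c = "\<lambda>w. of_complex (Poly_Mapping.lookup q w)"
    have q_eq: "q = (\<Sum>w\<in>?k. ?c w * wmono (letters w))"
      using free_expansion[of q] by (simp add: ext_def)
    have 1: "q * p = (\<Sum>w\<in>?k. ?c w * (wmono (letters w) * p))"
      by (subst q_eq) (simp add: sum_distrib_right mult.assoc)
    have 2: "p * q = (\<Sum>w\<in>?k. ?c w * (p * wmono (letters w)))"
      by (subst q_eq) (simp add: sum_distrib_left mult.assoc[symmetric] of_complex_commute[of _ p])
    have "q * p - p * q = (\<Sum>w\<in>?k. ?c w * (wmono (letters w) * p - p * wmono (letters w)))"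
      unfolding 1 2 right_diff_distrib sum_subtractf ..
    also have "\<dots> \<in> relI n"
    proof (intro relI_sum relI_mult_left word)
      fix w assume "w \<in> ?k"
      then show "set (letters w) \<subseteq> sq n" using q unfolding tens_def by blast
    qed
    finally show ?thesis .
  qed
  have "U_class n p \<otimes>\<^bsub>U_gl n\<^esub> x = x \<otimes>\<^bsub>U_gl n\<^esub> U_class n p" if "x \<in> carrier (U_gl n)" for x
  proof -
    from that obtain q where q: "q \<in> tens n" "x = U_class n q" unfolding carrier_U by blast
    have "U_class n (q * p) = U_class n (p * q)"
      using comm[OF q(1)] p q(1) by (simp add: U_class_eq_iff tens_mult)
    then show ?thesis using p q by (simp add: U_class_mult)
  qed
  then show "U_class n p \<in> U_center n" using U_class_closed[OF p] by (simp add: U_center_def)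
qed

text \<open>If \<open>c - d\<close> were nonzero, it would be an invertible scalar annihilating
  \<open>v\<close>.\<close>

lemma scalar_smult_inj:
  assumes V: "left_module (U_gl n) V" and v: "v \<in> carrier V" "v \<noteq> \<zero>\<^bsub>V\<^esub>"
    and eq: "scalar n c \<odot>\<^bsub>V\<^esub> v = scalar n d \<odot>\<^bsub>V\<^esub> v"
  shows "c = d"
proof (rule ccontr)
  assume "c \<noteq> d"
  note ops = class_add_smult[OF V _ _ v(1)] class_mult_smult[OF V _ _ v(1)]
  have "U_class n (of_complex c + of_complex (- d)) \<odot>\<^bsub>V\<^esub> v = U_class n (of_complex d + of_complex (- d)) \<odot>\<^bsub>V\<^esub> v"
    using eq by (simp add: ops scalar_def)
  then have "U_class n (of_complex (c - d)) \<odot>\<^bsub>V\<^esub> v = \<zero>\<^bsub>V\<^esub>"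
    using zero_smult[OF V v(1)] v(1) by (simp add: of_complex_add[symmetric] scalar_def)
  then have "U_class n (of_complex (1 / (c - d)) * of_complex (c - d)) \<odot>\<^bsub>V\<^esub> v = \<zero>\<^bsub>V\<^esub>"
    using class_smult_zero[OF V] by (simp add: ops)
  moreover have "of_complex (1 / (c - d)) * of_complex (c - d) = 1"
    using \<open>c \<noteq> d\<close> by (simp add: of_complex_mult[symmetric])
  ultimately have "\<one>\<^bsub>U_gl n\<^esub> \<odot>\<^bsub>V\<^esub> v = \<zero>\<^bsub>V\<^esub>" by (simp add: U_class_one)
  then show False using left_module.smult_one[OF V v(1)] v(2) by simp
qed

section \<open>Harish-Chandra polynomials of polynomials in the Capelli elements\<close>

lemma shifted_symmetric_const: "(\<lambda>x. c) \<in> shifted_symmetric n"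
  by (simp add: shifted_symmetric_def polynomials.const)

lemma shifted_symmetric_add:
  "f \<in> shifted_symmetric n \<Longrightarrow> g \<in> shifted_symmetric n \<Longrightarrow> (\<lambda>x. f x + g x) \<in> shifted_symmetric n"
  unfolding shifted_symmetric_def mem_Collect_eq by (metis (no_types, lifting) polynomials.add)

lemma shifted_symmetric_mult:
  "f \<in> shifted_symmetric n \<Longrightarrow> g \<in> shifted_symmetric n \<Longrightarrow> (\<lambda>x. f x * g x) \<in> shifted_symmetric n"
  unfolding shifted_symmetric_def mem_Collect_eq by (metis (no_types, lifting) polynomials.mult)

text \<open>Two candidates agree at every decreasing sequence of natural numbers, because a highest
  weight module exists there and determines the eigenvalue. Their difference is then the zero
  polynomial.\<close>

lemma harish_chandra_eqI:
  assumes f: "f \<in> shifted_symmetric n"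
    and eig: "\<And>\<nu> (V :: (env_alg, env_alg set) module) v. is_highest_weight_module n \<nu> V \<Longrightarrow> v \<in> carrier V \<Longrightarrow>
      A \<odot>\<^bsub>V\<^esub> v = scalar n (f \<nu>) \<odot>\<^bsub>V\<^esub> v"
  shows "harish_chandra n A = f"
  unfolding harish_chandra_def
proof (rule the_equality)
  show "f \<in> shifted_symmetric n \<and> (\<forall>\<nu> (V :: (env_alg, env_alg set) module). is_highest_weight_module n \<nu> V \<longrightarrow>
      (\<forall>v\<in>carrier V. A \<odot>\<^bsub>V\<^esub> v = scalar n (f \<nu>) \<odot>\<^bsub>V\<^esub> v))"
    using f eig by simp
next
  fix g assume g: "g \<in> shifted_symmetric n \<and> (\<forall>\<nu> (V :: (env_alg, env_alg set) module). is_highest_weight_module n \<nu> V \<longrightarrow>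
      (\<forall>v\<in>carrier V. A \<odot>\<^bsub>V\<^esub> v = scalar n (g \<nu>) \<odot>\<^bsub>V\<^esub> v))"
  have gp: "g \<in> polynomials n" and fp: "f \<in> polynomials n"
    using f g by (auto simp: shifted_symmetric_def)
  have "(\<lambda>x. g x + (- 1) * f x) \<in> polynomials n"
    by (intro polynomials.add polynomials.mult polynomials.const gp fp)
  then have "g x + (- 1) * f x = 0" for x
  proof (rule polynomials_vanish)
    fix l :: "nat \<Rightarrow> nat" and x :: "nat \<Rightarrow> complex"
    assume l: "\<And>i. i \<in> {1..<n} \<Longrightarrow> l (Suc i) \<le> l i" and x: "\<And>i. i \<in> {1..n} \<Longrightarrow> x i = of_nat (l i)"
    obtain V :: "(env_alg, env_alg set) module" where "is_highest_weight_module n (\<lambda>i. of_nat (l i)) V"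
      using highest_weight_module_exists[of n l] l by blast
    \<comment> \<open>A weight enters only through its values at \<open>1, ..., n\<close>, where
      \<open>x\<close> and \<open>l\<close> agree.\<close>
    then have V: "is_highest_weight_module n x V"
      unfolding is_highest_weight_module_def is_highest_weight_vector_def using x by auto
    then obtain v where v: "is_highest_weight_vector n x V v" and irr: "irreducible_module (U_gl n) V"
      by (auto simp: is_highest_weight_module_def)
    have lm: "left_module (U_gl n) V" using irr by (simp add: irreducible_module_def)
    have v: "v \<in> carrier V" "v \<noteq> \<zero>\<^bsub>V\<^esub>" using v by (auto simp: is_highest_weight_vector_def)
    have "scalar n (g x) \<odot>\<^bsub>V\<^esub> v = scalar n (f x) \<odot>\<^bsub>V\<^esub> v"
      using g V v(1) eig[OF V v(1)] by metis
    then have "g x = f x" by (rule scalar_smult_inj[OF lm v])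
    then show "g x + (- 1) * f x = 0" by simp
  qed
  then show "g = f" by (simp add: fun_eq_iff)
qed

text \<open>The three properties concern one family \<open>f\<close> for all levels simultaneously
  and are preserved by sums and products, so they are proved together from the generators.\<close>

lemma capelli_families_eigenvalues:
  assumes "A \<in> capelli_families m"
  shows "\<exists>f. (\<forall>n. f n \<in> shifted_symmetric n) \<and>
    (\<forall>n \<nu> (V :: (env_alg, env_alg set) module) v. left_module (U_gl n) V \<longrightarrow> is_highest_weight_vector n \<nu> V v \<longrightarrow>
      eigen n V v (A n) (f n \<nu>)) \<and>
    (\<forall>x n. x (Suc n) = 0 \<longrightarrow> f (Suc n) x = f n x)"
  using assms
proof (induction rule: capelli_families.induct)
  case (const c)
  show ?case
    by (rule exI[of _ "\<lambda>n x. c"])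
      (auto simp: shifted_symmetric_const is_highest_weight_vector_def intro: eigen_of_complex)
next
  case (gen k)
  show ?case
    by (rule exI[of _ "\<lambda>n. shifted_elem n k"])
      (auto simp: shifted_elem_shifted_symmetric shifted_elem_stable intro: eigen_capelli_free)
next
  case (add A B)
  obtain f where f: "\<And>n. f n \<in> shifted_symmetric n"
    "\<And>n \<nu> (V :: (env_alg, env_alg set) module) v. left_module (U_gl n) V \<Longrightarrow> is_highest_weight_vector n \<nu> V v \<Longrightarrow>
      eigen n V v (A n) (f n \<nu>)" "\<And>x n. x (Suc n) = 0 \<Longrightarrow> f (Suc n) x = f n x"
    using add.IH(1) by blast
  obtain g where g: "\<And>n. g n \<in> shifted_symmetric n"
    "\<And>n \<nu> (V :: (env_alg, env_alg set) module) v. left_module (U_gl n) V \<Longrightarrow> is_highest_weight_vector n \<nu> V v \<Longrightarrow>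
      eigen n V v (B n) (g n \<nu>)" "\<And>x n. x (Suc n) = 0 \<Longrightarrow> g (Suc n) x = g n x"
    using add.IH(2) by blast
  show ?case
  proof (intro exI[of _ "\<lambda>n x. f n x + g n x"] conjI allI impI)
    fix n \<nu> v and V :: "(env_alg, env_alg set) module"
    assume V: "left_module (U_gl n) V" "is_highest_weight_vector n \<nu> V v"
    then have "v \<in> carrier V" by (simp add: is_highest_weight_vector_def)
    then show "eigen n V v (A n + B n) (f n \<nu> + g n \<nu>)"
      using eigen_add[OF V(1) _ f(2)[OF V] g(2)[OF V]] by blast
  qed (simp_all add: f g shifted_symmetric_add)
next
  case (mult A B)
  obtain f where f: "\<And>n. f n \<in> shifted_symmetric n"
    "\<And>n \<nu> (V :: (env_alg, env_alg set) module) v. left_module (U_gl n) V \<Longrightarrow> is_highest_weight_vector n \<nu> V v \<Longrightarrow>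
      eigen n V v (A n) (f n \<nu>)" "\<And>x n. x (Suc n) = 0 \<Longrightarrow> f (Suc n) x = f n x"
    using mult.IH(1) by blast
  obtain g where g: "\<And>n. g n \<in> shifted_symmetric n"
    "\<And>n \<nu> (V :: (env_alg, env_alg set) module) v. left_module (U_gl n) V \<Longrightarrow> is_highest_weight_vector n \<nu> V v \<Longrightarrow>
      eigen n V v (B n) (g n \<nu>)" "\<And>x n. x (Suc n) = 0 \<Longrightarrow> g (Suc n) x = g n x"
    using mult.IH(2) by blast
  show ?case
  proof (intro exI[of _ "\<lambda>n x. f n x * g n x"] conjI allI impI)
    fix n \<nu> v and V :: "(env_alg, env_alg set) module"
    assume V: "left_module (U_gl n) V" "is_highest_weight_vector n \<nu> V v"
    then have "v \<in> carrier V" by (simp add: is_highest_weight_vector_def)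
    then show "eigen n V v (A n * B n) (f n \<nu> * g n \<nu>)"
      using eigen_mult[OF V(1) _ f(2)[OF V] g(2)[OF V]] by blast
  qed (simp_all add: f g shifted_symmetric_mult)
qed

section \<open>The embeddings and the direct limit\<close>

lemma capelli_embeddingD:
  assumes "is_capelli_embedding n \<iota>"
  shows "A \<in> U_center n \<Longrightarrow> \<iota> A \<in> U_center (Suc n)"
    and "A \<in> U_center n \<Longrightarrow> B \<in> U_center n \<Longrightarrow> \<iota> (A \<otimes>\<^bsub>U_gl n\<^esub> B) = \<iota> A \<otimes>\<^bsub>U_gl (Suc n)\<^esub> \<iota> B"
    and "A \<in> U_center n \<Longrightarrow> B \<in> U_center n \<Longrightarrow> \<iota> (A \<oplus>\<^bsub>U_gl n\<^esub> B) = \<iota> A \<oplus>\<^bsub>U_gl (Suc n)\<^esub> \<iota> B"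
    and "\<iota> (scalar n c) = scalar (Suc n) c"
    and "k \<in> {1..n} \<Longrightarrow> \<iota> (capelli_H n k) = capelli_H (Suc n) k"
    and "inj_on \<iota> (U_center n)"
  using assms by (auto simp: is_capelli_embedding_def ring_hom_def center_alg_def)

context
  fixes \<iota> :: "nat \<Rightarrow> env_alg \<Rightarrow> env_alg"
  assumes emb: "\<And>n. 1 \<le> n \<Longrightarrow> is_capelli_embedding n (\<iota> n)"
begin

text \<open>The embeddings carry the centrality of the full column determinant \<^term>\<open>capelli_H k k\<close> to all
  the \<^term>\<open>capelli_H n k\<close>, so the sum over principal minors needs no separate argument.\<close>

lemma capelli_H_central:
  assumes "1 \<le> k" "k \<le> n"
  shows "capelli_H n k \<in> U_center n"
  using assms(2)
proof (induction n rule: dec_induct)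
  case base
  show ?case
    unfolding capelli_H_eq
    using capelli_free_top_central U_center_iff[OF tens_degD[OF capelli_free_tens_deg]] by blast
next
  case (step n)
  have "is_capelli_embedding n (\<iota> n)" using step assms(1) by (intro emb) simp
  from capelli_embeddingD(1)[OF this step.IH] capelli_embeddingD(5)[OF this, of k] step assms(1)
  show ?case by simp
qed

lemma capelli_free_central:
  assumes "k \<in> {1..n}"
  shows "central_free n (capelli_free n k)"
  using capelli_H_central[of k n] assms U_center_iff[OF tens_degD[OF capelli_free_tens_deg]]
  by (auto simp: capelli_H_eq)

lemma capelli_families_center:
  assumes "A \<in> capelli_families m" "m \<le> n"
  shows "U_class n (A n) \<in> U_center n"
proof -
  have "central_free n (A n)"
    by (rule capelli_families_central[OF assms(1)]) (use assms(2) in \<open>auto intro: capelli_free_central\<close>)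
  then show ?thesis using U_center_iff[OF capelli_families_tens[OF assms(1)]] by blast
qed

text \<open>The condition \<open>m \<le> n\<close> keeps the generators in the range where their
  images are prescribed and the values in the center, on which the embedding is a
  homomorphism.\<close>

lemma capelli_families_embedding:
  assumes "A \<in> capelli_families m" "m \<le> n" "1 \<le> n"
  shows "\<iota> n (U_class n (A n)) = U_class (Suc n) (A (Suc n))"
  using assms(1)
proof (induction rule: capelli_families.induct)
  case (const c)
  then show ?case using capelli_embeddingD(4)[OF emb[OF assms(3)]] by (simp add: scalar_def)
next
  case (gen k)
  then show ?case using capelli_embeddingD(5)[OF emb[OF assms(3)], of k] assms(2) by (simp add: capelli_H_eq)
next
  case (add A B)
  then show ?case
    using capelli_embeddingD(3)[OF emb[OF assms(3)]] capelli_families_center[OF _ assms(2)]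
    by (simp add: U_class_add capelli_families_tens)
next
  case (mult A B)
  then show ?case
    using capelli_embeddingD(2)[OF emb[OF assms(3)]] capelli_families_center[OF _ assms(2)]
    by (simp add: U_class_mult capelli_families_tens)
qed

text \<open>Two elements of one level that are identified at a later level were equal from the
  start; an element of the limit thus has at most one representative at each level.\<close>

lemma transport_inj:
  assumes "n \<le> N" "1 \<le> n" "A \<in> U_center n" "B \<in> U_center n" "transport \<iota> n N A = transport \<iota> n N B"
  shows "A = B"
  using assms
proof (induction "N - n" arbitrary: n A B)
  case 0
  then show ?case by (simp add: transport_def)
next
  case (Suc d)
  note e = capelli_embeddingD[OF emb[OF Suc.prems(2)]]
  have step: "transport \<iota> n N C = transport \<iota> (Suc n) N (\<iota> n C)" for C
    using Suc.hyps(2) by (simp add: transport_def upt_conv_Cons)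
  have "\<iota> n A = \<iota> n B"
  proof (rule Suc.hyps(1))
    show "transport \<iota> (Suc n) N (\<iota> n A) = transport \<iota> (Suc n) N (\<iota> n B)"
      using Suc.prems(5) unfolding step .
    show "d = N - Suc n" "Suc n \<le> N" "1 \<le> Suc n" using Suc.hyps(2) by simp_all
  qed (rule e(1)[OF Suc.prems(3)] e(1)[OF Suc.prems(4)])+
  then show ?case using e(6) Suc.prems(3,4) by (auto dest: inj_onD)
qed

end

theorem proposition7p8:
  fixes m :: nat
    and \<iota> :: "nat \<Rightarrow> env_alg \<Rightarrow> env_alg"
    and \<rho> :: "nat \<Rightarrow> env_alg"
    and \<rho>_lim :: "(nat \<times> env_alg) set"
    and \<mu> :: "nat list"
  assumes "1 \<le> m"
    and "\<And>n. 1 \<le> n \<Longrightarrow> is_capelli_embedding n (\<iota> n)"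
    and "\<rho>_lim \<in> limit_filtration \<iota> m"
    and "\<And>n. m \<le> n \<Longrightarrow> \<rho> n \<in> center_filtration n m"
    and "\<And>n. m \<le> n \<Longrightarrow> \<iota> n (\<rho> n) = \<rho> (Suc n)"
    and "\<And>n. m \<le> n \<Longrightarrow> limit_class \<iota> n (\<rho> n) = \<rho>_lim"
    and "is_partition \<mu>"
  shows "(\<exists>!c. \<forall>\<^sub>F n in sequentially. harish_chandra n (\<rho> n) (conjugate_point \<mu>) = c) \<and>
         (\<forall>\<^sub>F n in sequentially.
            harish_chandra_limit \<rho>_lim (conjugate_point \<mu>) =
            harish_chandra n (\<rho> n) (conjugate_point \<mu>))"
proof -
  \<comment> \<open>The level at which elements of degree \<open>m\<close> are in the stable range
    of \<open>center_generated\<close>.\<close>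
  define M where "M = 3 * m"
  have M: "m \<le> M" "1 \<le> M" using assms(1) by (auto simp: M_def)
  let ?x = "conjugate_point \<mu>"
  have center: "\<rho> n \<in> U_center n" if "m \<le> n" for n
    using assms(4)[OF that] by (simp add: center_filtration_def)
  have "\<rho> M \<in> U_filtration M m" using assms(4)[OF M(1)] by (simp add: center_filtration_def)
  then obtain a where a: "a \<in> tens_deg M m" "\<rho> M = U_class M a"
    by (auto simp: U_filtration_def tens_deg_def)
  have "central_free M a"
    using center[OF M(1)] a(2) U_center_iff[OF tens_degD[OF a(1)]] by simp
  then obtain Q where Q: "Q \<in> capelli_families M" "a - Q M \<in> relI M"
    using center_generated[of m M a] capelli_free_central[OF assms(2)] a(1) by (auto simp: M_def)
  have \<rho>: "\<rho> n = U_class n (Q n)" if "M \<le> n" for n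
    using that
  proof (induction n rule: dec_induct)
    case base
    show ?case using Q(2) a U_class_eq_iff[OF tens_degD[OF a(1)] capelli_families_tens[OF Q(1)]] by simp
  next
    case (step n)
    then show ?case
      using capelli_families_embedding[OF assms(2) Q(1), of n] assms(5)[of n] M by simp
  qed
  obtain f where f: "\<And>n. f n \<in> shifted_symmetric n"
    "\<And>n \<nu> (V :: (env_alg, env_alg set) module) v. left_module (U_gl n) V \<Longrightarrow> is_highest_weight_vector n \<nu> V v \<Longrightarrow>
      eigen n V v (Q n) (f n \<nu>)" "\<And>x n. x (Suc n) = 0 \<Longrightarrow> f (Suc n) x = f n x"
    using capelli_families_eigenvalues[OF Q(1)] by blast
  have hc: "harish_chandra n (\<rho> n) = f n" if n: "M \<le> n" for n
  proof (rule harish_chandra_eqI[OF f(1)])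
    fix \<nu> w and V :: "(env_alg, env_alg set) module"
    assume V: "is_highest_weight_module n \<nu> V" and w: "w \<in> carrier V"
    obtain v where v: "is_highest_weight_vector n \<nu> V v" and irr: "irreducible_module (U_gl n) V"
      using V by (auto simp: is_highest_weight_module_def)
    have lm: "left_module (U_gl n) V" using irr by (simp add: irreducible_module_def)
    have v': "v \<in> carrier V" "v \<noteq> \<zero>\<^bsub>V\<^esub>" using v by (auto simp: is_highest_weight_vector_def)
    have v_eq: "\<rho> n \<odot>\<^bsub>V\<^esub> v = scalar n (f n \<nu>) \<odot>\<^bsub>V\<^esub> v"
      using f(2)[OF lm v] \<rho>[OF n] by (simp add: eigen_def)
    have "\<rho> n \<in> U_center n" using n M by (intro center) simp
    then show "\<rho> n \<odot>\<^bsub>V\<^esub> w = scalar n (f n \<nu>) \<odot>\<^bsub>V\<^esub> w"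
      by (rule eigen_central_all[OF lm v'(1) irr v'(2) _ v_eq w])
  qed
  \<comment> \<open>\<open>sum_list \<mu>\<close> bounds every part of \<open>\<mu>\<close>, so the
    conjugate point is zero beyond it and \<open>f\<close> no longer changes.\<close>
  define N where "N = max M (sum_list \<mu>)"
  have x0: "?x (Suc n) = 0" if "N \<le> n" for n
  proof -
    have "\<mu> ! j \<le> n" if "j < length \<mu>" for j
      using member_le_sum_list[of "\<mu> ! j" \<mu>] that \<open>N \<le> n\<close> by (simp add: N_def)
    then have "{j. j < length \<mu> \<and> Suc n \<le> \<mu> ! j} = {}" by fastforce
    then show ?thesis by (simp only: conjugate_point_def card.empty of_nat_0)
  qed
  have stable: "f n ?x = f N ?x" if "N \<le> n" for n
    using that by (induction n rule: dec_induct) (simp_all add: f(3) x0)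
  have val: "harish_chandra n (\<rho> n) ?x = f N ?x" if "N \<le> n" for n
    using hc[of n] stable[OF that] that by (simp add: N_def)
  then have ev: "\<forall>\<^sub>F n in sequentially. harish_chandra n (\<rho> n) ?x = f N ?x"
    by (auto simp: eventually_sequentially)
  have uniq: "c = f N ?x" if "\<forall>\<^sub>F n in sequentially. harish_chandra n (\<rho> n) ?x = c" for c
    using eventually_happens[OF eventually_conj[OF that ev]] by auto
  \<comment> \<open>From level \<open>m\<close> on, the class contains nothing but the given
    representatives, so the description in \<open>harish_chandra_limit\<close> speaks about the
    values of \<open>\<rho>\<close>.\<close>
  have in_lim: "(n, A) \<in> \<rho>_lim \<longleftrightarrow> A = \<rho> n" if "m \<le> n" for n A
  proof -
    have n: "1 \<le> n" using that assms(1) by simp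
    have "A = \<rho> n" if "(n, A) \<in> limit_class \<iota> n (\<rho> n)"
    proof -
      from that obtain L where "L \<ge> n" "A \<in> U_center n" "transport \<iota> n L (\<rho> n) = transport \<iota> n L A"
        by (auto simp: limit_class_def)
      then show ?thesis using transport_inj[OF assms(2), of n L A "\<rho> n"] n center[OF \<open>m \<le> n\<close>] by simp
    qed
    moreover have "(n, \<rho> n) \<in> limit_class \<iota> n (\<rho> n)"
      using n center[OF that] by (auto simp: limit_class_def)
    ultimately show ?thesis using assms(6)[OF that] by auto
  qed
  have lim: "harish_chandra_limit \<rho>_lim ?x = f N ?x"
    unfolding harish_chandra_limit_def
  proof (rule the_equality)
    show "\<forall>\<^sub>F n in sequentially. \<exists>A. (n, A) \<in> \<rho>_lim \<and> harish_chandra n A ?x = f N ?x"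
      unfolding eventually_sequentially
      using val in_lim M by (intro exI[of _ N]) (auto simp: N_def)
  next
    fix c assume c: "\<forall>\<^sub>F n in sequentially. \<exists>A. (n, A) \<in> \<rho>_lim \<and> harish_chandra n A ?x = c"
    have "\<forall>\<^sub>F n in sequentially. harish_chandra n (\<rho> n) ?x = c"
      using c eventually_ge_at_top[of m] by eventually_elim (auto simp: in_lim)
    then show "c = f N ?x" by (rule uniq)
  qed
  show ?thesis
  proof (intro conjI ex1I[of _ "f N ?x"])
    show "\<forall>\<^sub>F n in sequentially. harish_chandra_limit \<rho>_lim ?x = harish_chandra n (\<rho> n) ?x"
      using ev by (rule eventually_mono) (simp only: lim)
  qed (fact ev, rule uniq)
qed

end
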